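(* Let $p,q,r\ge 0$ be integers, at most one of which is $0$. The graph $\theta(p,q,r)$ is determined by its signless Laplacian permanental polynomial; that is, for every graph $H$, if $\pi(Q(H);x)=\pi(Q(\theta(p,q,r));x)$ then $H$ is isomorphic to $\theta(p,q,r)$.
   Context: All graphs are finite, simple and undirected (not necessarily connected). For a graph $G$ with vertices $v_1,\dots,v_n$, let $A(G)$ be its $(0,1)$-adjacency matrix, $D(G)=\mathrm{diag}(d(v_1),\dots,d(v_n))$ the diagonal matrix of vertex degrees, and $Q(G)=D(G)+A(G)$ the signless Laplacian matrix. The permanent of an $n\times n$ matrix $X=(x_{ij})$ is $\mathrm{per}(X)=\sum_{\sigma}\prod_{i=1}^n x_{i\sigma(i)}$, the sum being over all permutations $\sigma$ of $\{1,\dots,n\}$. The signless Laplacian permanental polynomial of $G$ is $\pi(Q(G);x)=\mathrm{per}(xI-Q(G))$, where $I$ is the $n\times n$ identity matrix. The graph $\theta(p,q,r)$, on $n=p+q+r+2$ vertices, consists of two given distinct vertices $u,v$ joined by three internally disjoint paths having respectively $p$, $q$ and $r$ interior vertices (a path with $0$ interior vertices is the single edge $uv$), where $p,q,r\ge 0$ and at most one of them is $0$. *)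

theory Defs
  imports "Graph_Theory.Graph_Theory" "Jordan_Normal_Form.Char_Poly"
begin

text \<open>
  A finite simple undirected graph is a loop-free symmetric digraph without parallel arcs
  (locale \<^locale>\<open>pair_graph\<close>): an undirected edge \<open>ab\<close> is the pair of arcs
  \<open>(a,b)\<close>, \<open>(b,a)\<close>, so the degree of a vertex is its out-degree, and
  \<^const>\<open>digraph_iso\<close> is the usual graph isomorphism.
\<close>

text \<open>\<open>v\<^sub>1, \<dots>, v\<^sub>n\<close> is an enumeration of the vertices of \<open>G\<close>.\<close>

definition vertex_enum :: "'a pair_pre_digraph \<Rightarrow> 'a list \<Rightarrow> bool" where
  "vertex_enum G vs \<longleftrightarrow> distinct vs \<and> set vs = pverts G"

definition adjacency_mat :: "'a pair_pre_digraph \<Rightarrow> 'a list \<Rightarrow> int mat" where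
  "adjacency_mat G vs =
     mat (length vs) (length vs) (\<lambda>(i, j). if (vs ! i, vs ! j) \<in> parcs G then 1 else 0)"

definition degree_mat :: "'a pair_pre_digraph \<Rightarrow> 'a list \<Rightarrow> int mat" where
  "degree_mat G vs = mat_diag (length vs) (\<lambda>i. int (out_degree (with_proj G) (vs ! i)))"

definition signless_laplacian :: "'a pair_pre_digraph \<Rightarrow> 'a list \<Rightarrow> int mat" where
  "signless_laplacian G vs = degree_mat G vs + adjacency_mat G vs"

text \<open>For square matrices; like \<^const>\<open>det\<close>, but without the signs.\<close>

definition permanent :: "'a::comm_ring_1 mat \<Rightarrow> 'a" where
  "permanent A = (\<Sum>p \<in> {p. p permutes {0..<dim_row A}}. \<Prod>i = 0..<dim_row A. A $$ (i, p i))"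

text \<open>\<^term>\<open>char_poly_matrix A\<close> is the matrix \<open>x I - A\<close> over the polynomial ring.\<close>

definition permanental_poly :: "'a::comm_ring_1 mat \<Rightarrow> 'a poly" where
  "permanental_poly A = permanent (char_poly_matrix A)"

definition signless_laplacian_permanental_poly ::
    "'a pair_pre_digraph \<Rightarrow> 'a list \<Rightarrow> int poly" where
  "signless_laplacian_permanental_poly G vs = permanental_poly (signless_laplacian G vs)"

definition path_arcs :: "'a list \<Rightarrow> ('a \<times> 'a) set" where
  "path_arcs xs = set (zip xs (tl xs)) \<union> (set (zip xs (tl xs)))\<inverse>"

text \<open>
  Here \<open>u = 0\<close> and \<open>v = 1\<close>; the remaining vertices are split into three consecutive
  blocks of lengths \<open>p\<close>, \<open>q\<close>, \<open>r\<close>, the interiors of the three paths.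
\<close>

definition theta :: "nat \<Rightarrow> nat \<Rightarrow> nat \<Rightarrow> nat pair_pre_digraph" where
  "theta p q r = \<lparr> pverts = {0..<p + q + r + 2},
     parcs = path_arcs (0 # [2..<2 + p] @ [1])
           \<union> path_arcs (0 # [2 + p..<2 + p + q] @ [1])
           \<union> path_arcs (0 # [2 + p + q..<2 + p + q + r] @ [1]) \<rparr>"

lemma path_arcsD:
  assumes "(a, b) \<in> path_arcs xs"
  shows "a \<in> set xs" "b \<in> set xs" "distinct xs \<Longrightarrow> a \<noteq> b"
proof -
  have *: "a \<in> set xs \<and> b \<in> set xs \<and> (distinct xs \<longrightarrow> a \<noteq> b)"
    if "(a, b) \<in> set (zip xs (tl xs))" for a b
  proof -
    from that obtain i where "i < length (tl xs)" "a = xs ! i" "b = tl xs ! i"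
      by (auto simp: set_zip)
    then have "Suc i < length xs" "a = xs ! i" "b = xs ! Suc i"
      by (auto simp: nth_tl)
    then show ?thesis by (auto simp: nth_eq_iff_index_eq)
  qed
  from assms have "(a, b) \<in> set (zip xs (tl xs)) \<or> (b, a) \<in> set (zip xs (tl xs))"
    by (auto simp: path_arcs_def)
  then show "a \<in> set xs" "b \<in> set xs" "distinct xs \<Longrightarrow> a \<noteq> b"
    using * by blast+
qed

lemma path_arcs_sym: "(a, b) \<in> path_arcs xs \<Longrightarrow> (b, a) \<in> path_arcs xs"
  by (auto simp: path_arcs_def)

lemma pair_graph_theta: "pair_graph (theta p q r)"
proof -
  have arcs: "a < p + q + r + 2 \<and> b < p + q + r + 2 \<and> a \<noteq> b \<and> (b, a) \<in> parcs (theta p q r)"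
    if "(a, b) \<in> parcs (theta p q r)" for a b
  proof -
    from that consider
        "(a, b) \<in> path_arcs (0 # [2..<2 + p] @ [1])"
      | "(a, b) \<in> path_arcs (0 # [2 + p..<2 + p + q] @ [1])"
      | "(a, b) \<in> path_arcs (0 # [2 + p + q..<2 + p + q + r] @ [1])"
      by (simp only: theta_def pair_pre_digraph.simps Un_iff) blast
    then obtain k l where kl: "2 \<le> k" "l \<le> p + q + r + 2"
      and ab: "(a, b) \<in> path_arcs (0 # [k..<l] @ [1])"
    proof cases
      case 1 then show ?thesis by (rule that[rotated 2]) simp_all
    next
      case 2 then show ?thesis by (rule that[rotated 2]) simp_all
    next
      case 3 then show ?thesis by (rule that[rotated 2]) simp_all
    qed
    have "(b, a) \<in> parcs (theta p q r)"
      using that path_arcs_sym[of a b]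
      by (simp only: theta_def pair_pre_digraph.simps Un_iff) blast
    moreover have "distinct (0 # [k..<l] @ [1])" using kl by auto
    then have "a \<noteq> b" using path_arcsD(3)[OF ab] by blast
    moreover have "a < p + q + r + 2" "b < p + q + r + 2"
      using path_arcsD(1,2)[OF ab] kl by auto
    ultimately show ?thesis by blast
  qed
  have sub: "parcs (theta p q r) \<subseteq> {0..<p + q + r + 2} \<times> {0..<p + q + r + 2}"
  proof
    fix e assume "e \<in> parcs (theta p q r)"
    then show "e \<in> {0..<p + q + r + 2} \<times> {0..<p + q + r + 2}"
      using arcs[of "fst e" "snd e"] by (cases e) simp
  qed
  have verts: "pverts (theta p q r) = {0..<p + q + r + 2}" by (simp add: theta_def)
  show ?thesis
  proof unfold_locales
    fix e assume e: "e \<in> parcs (theta p q r)"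
    show "fst e \<in> pverts (theta p q r)" "snd e \<in> pverts (theta p q r)" "fst e \<noteq> snd e"
      using e arcs[of "fst e" "snd e"] unfolding verts by (cases e, simp)+
  next
    show "finite (pverts (theta p q r))" "finite (parcs (theta p q r))"
      using finite_subset[OF sub] unfolding verts by blast+
  next
    have "sym (parcs (theta p q r))" using arcs by (blast intro: symI)
    then show "symmetric (with_proj (theta p q r))" by (simp add: symmetric_def)
  qed
qed

end

theory Submission
  imports Defs
begin

text \<open>
  The two subleading coefficients of the polynomial determine \<open>\<Sum>d\<close> and \<open>\<Sum>d\<^sup>2\<close> over the vertex
  degrees. For a theta graph this gives \<open>\<Sum>(d - 2)(d - 3) = 0\<close>, so a graph with the same polynomial
  has exactly two vertices of degree 3 and all others of degree 2: it is a theta graph or a dumbbell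
  (two cycles joined by a path), together with disjoint cycles.

  Substitute \<open>x - 2 = e - 1/e\<close>. Permanents of paths become \<open>q\<close>-numbers in \<open>-e\<^sup>2\<close>, and after
  multiplication with \<open>(-e)\<^sup>n (1 + e\<^sup>2)\<^sup>3\<close> the permanent of each of these graphs is an explicit sparse
  polynomial in \<open>e\<close>. Its value at \<open>e = 1\<close> shows that disjoint cycles can only occur when all the
  path and cycle lengths of the other component are even; in that case the coefficients of odd powers
  of \<open>e\<close> in a theta polynomial are nonpositive from \<open>e\<^sup>5\<close> on, whereas a shortest cycle produces a
  positive one. Without cycles the lowest coefficients recover the three path lengths and exclude
  dumbbells.
\<close>

section \<open>Permanents of weights on finite sets\<close>

text \<open>The permanent is not multiplicative, so neither elimination nor eigenvalues are
  available; what remains is expansion at single vertices. A path attached to a graph meets it only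
  in its two ends. Hence five minors at the two vertices of degree 3 suffice to follow the permanent
  while the graph is built up path by path. The substitution comes from the recursion for paths: the
  roots of \<open>t^2 = y * t + 1\<close> are \<open>e\<close> and \<open>- 1 / e\<close>. Each
  attached path or cycle brings one denominator \<open>1 + e^2\<close>, and there are three of them.
  The power of \<open>- e\<close> is governed by the number of edges, which agrees for the graphs
  compared; therefore the total length is known and two lengths determine the third. All polynomials
  without disjoint cycles start with \<open>(1 + e + 2 * e^2)^2\<close>, so lengths show only in the
  deviation from it: a path first deviates by an odd amount, a cycle by an even one. At
  \<open>e = 1\<close> every power is 1 or -1, so that value depends on parities alone.\<close>

text \<open>The permanent of a square matrix whose rows and columns are indexed by \<open>A\<close> and \<open>B\<close>; minors then
  need no renumbering.\<close>

definition perm_on :: "('a \<Rightarrow> 'b \<Rightarrow> 'r::comm_ring_1) \<Rightarrow> 'a set \<Rightarrow> 'b set \<Rightarrow> 'r" where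
  "perm_on w A B = (\<Sum>f | f \<in> A \<rightarrow>\<^sub>E B \<and> bij_betw f A B. \<Prod>a\<in>A. w a (f a))"

lemma perm_on_empty [simp]:
  fixes w :: "'a \<Rightarrow> 'b \<Rightarrow> 'r::comm_ring_1"
  shows "perm_on w {} {} = 1"
proof -
  have "{f. f = (\<lambda>x::'a. undefined :: 'b) \<and> bij_betw f {} {}} = {\<lambda>x. undefined :: 'b}"
    by (auto simp: bij_betw_def)
  then show ?thesis by (simp add: perm_on_def)
qed

lemma perm_on_cong:
  assumes "\<And>a b. a \<in> A \<Longrightarrow> b \<in> B \<Longrightarrow> w a b = w' a b"
  shows "perm_on w A B = perm_on w' A B"
  unfolding perm_on_def
proof (intro sum.cong prod.cong refl)
  fix f a assume "f \<in> {f. f \<in> A \<rightarrow>\<^sub>E B \<and> bij_betw f A B}" "a \<in> A"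
  then show "w a (f a) = w' a (f a)" by (intro assms) auto
qed

text \<open>Bijections are sorted by the image of \<open>x\<close>: \<open>f\<close> corresponds to
  the pair of \<open>f x\<close> and its restriction to the other rows.\<close>

lemma perm_on_expand_row:
  assumes "finite A" "finite B" "x \<in> A"
  shows "perm_on w A B = (\<Sum>t\<in>B. w x t * perm_on w (A - {x}) (B - {t}))"
proof -
  let ?F = "\<lambda>A B. {f. f \<in> A \<rightarrow>\<^sub>E B \<and> bij_betw f A B}"
  have fin: "finite (?F (A - {x}) (B - {t}))" for t
    using assms by (intro finite_subset[OF _ finite_PiE[of "A - {x}" "\<lambda>_. B - {t}"]]) auto
  have "(\<Sum>t\<in>B. w x t * perm_on w (A - {x}) (B - {t}))
      = (\<Sum>t\<in>B. \<Sum>g\<in>?F (A - {x}) (B - {t}). w x t * (\<Prod>a\<in>A - {x}. w a (g a)))"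
    by (simp add: perm_on_def sum_distrib_left)
  also have "\<dots> = (\<Sum>(t, g)\<in>Sigma B (\<lambda>t. ?F (A - {x}) (B - {t})). w x t * (\<Prod>a\<in>A - {x}. w a (g a)))"
    using assms fin by (intro sum.Sigma) auto
  also have "\<dots> = (\<Sum>f\<in>?F A B. \<Prod>a\<in>A. w a (f a))"
  proof (rule sum.reindex_bij_witness[where i = "\<lambda>f. (f x, restrict f (A - {x}))"
          and j = "\<lambda>(t, g). g(x := t)"])
    fix p assume p: "p \<in> Sigma B (\<lambda>t. ?F (A - {x}) (B - {t}))"
    obtain t g where [simp]: "p = (t, g)" by (cases p)
    have t: "t \<in> B" and g: "g \<in> A - {x} \<rightarrow>\<^sub>E B - {t}" "bij_betw g (A - {x}) (B - {t})"
      using p by auto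
    have "bij_betw (g(x := t)) (A - {x}) (B - {t})"
      using g(2) by (subst bij_betw_cong[of _ _ g]) auto
    then have "bij_betw (g(x := t)) (insert x (A - {x})) (insert ((g(x := t)) x) (B - {t}))"
      using notIn_Un_bij_betw[of x "A - {x}" "g(x := t)" "B - {t}"] by simp
    then have b: "bij_betw (g(x := t)) A B"
      using t assms(3) by (simp add: insert_absorb)
    show "(case p of (t, g) \<Rightarrow> g(x := t)) \<in> ?F A B"
      using b g(1) t assms(3) by (auto simp: PiE_def extensional_def Pi_def)
    show "((case p of (t, g) \<Rightarrow> g(x := t)) x, restrict (case p of (t, g) \<Rightarrow> g(x := t)) (A - {x})) = p"
      using g(1) by (auto simp: fun_eq_iff PiE_def extensional_def)
    have "(\<Prod>a\<in>A. w a ((g(x := t)) a)) = w x t * (\<Prod>a\<in>A - {x}. w a ((g(x := t)) a))"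
      using assms by (subst prod.remove[of A x]) auto
    also have "(\<Prod>a\<in>A - {x}. w a ((g(x := t)) a)) = (\<Prod>a\<in>A - {x}. w a (g a))"
      by (intro prod.cong) auto
    finally show "(\<Prod>a\<in>A. w a ((case p of (t, g) \<Rightarrow> g(x := t)) a)) =
        (case p of (t, g) \<Rightarrow> w x t * (\<Prod>a\<in>A - {x}. w a (g a)))"
      by simp
  next
    fix f assume f: "f \<in> ?F A B"
    have b: "bij_betw f A B" using f by auto
    have fx: "f x \<in> B" using b assms(3) by (auto simp: bij_betw_def)
    have "bij_betw f (A - {x}) (B - {f x})"
      using b assms(3) by (auto simp: bij_betw_def inj_on_def)
    then have "bij_betw (restrict f (A - {x})) (A - {x}) (B - {f x})"
      by (subst bij_betw_cong[of _ _ f]) auto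
    then show "(f x, restrict f (A - {x})) \<in> Sigma B (\<lambda>t. ?F (A - {x}) (B - {t}))"
      using fx by (auto simp: bij_betw_def)
    show "(case (f x, restrict f (A - {x})) of (t, g) \<Rightarrow> g(x := t)) = f"
      using f assms(3) by (auto simp: fun_eq_iff PiE_def extensional_def)
  qed
  finally show ?thesis by (simp add: perm_on_def)
qed

text \<open>Restricting the inverse makes it extensional again. Inversion thereby becomes a
  two-sided correspondence between the bijections counted by a permanent and those counted by its
  transpose.\<close>

lemma restrict_the_inv_into:
  assumes "f \<in> A \<rightarrow>\<^sub>E B" "bij_betw f A B"
  shows "restrict (the_inv_into A f) B \<in> B \<rightarrow>\<^sub>E A"
    and "bij_betw (restrict (the_inv_into A f) B) B A"
    and "restrict (the_inv_into B (restrict (the_inv_into A f) B)) A = f"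
proof -
  have b: "bij_betw (the_inv_into A f) B A" using assms(2) by (rule bij_betw_the_inv_into)
  show b': "bij_betw (restrict (the_inv_into A f) B) B A"
    using b by (subst bij_betw_cong[of _ _ "the_inv_into A f"]) auto
  show "restrict (the_inv_into A f) B \<in> B \<rightarrow>\<^sub>E A"
    using b by (auto simp: bij_betw_def)
  show "restrict (the_inv_into B (restrict (the_inv_into A f) B)) A = f"
  proof
    fix a
    show "restrict (the_inv_into B (restrict (the_inv_into A f) B)) A a = f a"
    proof (cases "a \<in> A")
      case True
      have "f a \<in> B" using True assms(1) by auto
      moreover have "the_inv_into A f (f a) = a"
        using assms(2) True by (auto simp: bij_betw_def the_inv_into_f_f)
      ultimately show ?thesis
        using True b' by (auto simp: bij_betw_def intro!: the_inv_into_f_eq)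
    next
      case False
      then show ?thesis using assms(1) by (auto simp: PiE_def extensional_def)
    qed
  qed
qed

lemma perm_on_transpose: "perm_on w A B = perm_on (\<lambda>a b. w b a) B A"
  unfolding perm_on_def
proof (rule sum.reindex_bij_witness[where i = "\<lambda>g. restrict (the_inv_into B g) A"
        and j = "\<lambda>f. restrict (the_inv_into A f) B"])
  fix f assume f: "f \<in> {f. f \<in> A \<rightarrow>\<^sub>E B \<and> bij_betw f A B}"
  show "restrict (the_inv_into B (restrict (the_inv_into A f) B)) A = f"
    "restrict (the_inv_into A f) B \<in> {f. f \<in> B \<rightarrow>\<^sub>E A \<and> bij_betw f B A}"
    using restrict_the_inv_into[of f A B] f by auto
  have i: "inj_on f A" "f ` A = B" using f by (auto simp: bij_betw_def)
  show "(\<Prod>b\<in>B. w (restrict (the_inv_into A f) B b) b) = (\<Prod>a\<in>A. w a (f a))"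
    using i by (subst i(2)[symmetric], subst prod.reindex)
      (auto simp: the_inv_into_f_f intro!: prod.cong)
next
  fix g assume g: "g \<in> {f. f \<in> B \<rightarrow>\<^sub>E A \<and> bij_betw f B A}"
  show "restrict (the_inv_into A (restrict (the_inv_into B g) A)) B = g"
    "restrict (the_inv_into B g) A \<in> {f. f \<in> A \<rightarrow>\<^sub>E B \<and> bij_betw f A B}"
    using restrict_the_inv_into[of g B A] g by auto
qed

lemma perm_on_expand_col:
  assumes "finite A" "finite B" "x \<in> B"
  shows "perm_on w A B = (\<Sum>t\<in>A. w t x * perm_on w (A - {t}) (B - {x}))"
proof -
  have "perm_on w A B = perm_on (\<lambda>a b. w b a) B A" by (rule perm_on_transpose)
  also have "\<dots> = (\<Sum>t\<in>A. w t x * perm_on (\<lambda>a b. w b a) (B - {x}) (A - {t}))"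
    using assms by (intro perm_on_expand_row) auto
  also have "\<dots> = (\<Sum>t\<in>A. w t x * perm_on w (A - {t}) (B - {x}))"
    by (intro sum.cong refl arg_cong2[where f = "(*)"] perm_on_transpose[symmetric])
  finally show ?thesis .
qed

text \<open>Relabelling carries the permanent over matrix positions to one over vertices, where row
  and column sets can be enlarged vertex by vertex.\<close>

lemma perm_on_image:
  assumes "inj_on g (A \<union> B)"
  shows "perm_on w (g ` A) (g ` B) = perm_on (\<lambda>a b. w (g a) (g b)) A B"
proof -
  let ?h = "the_inv_into (A \<union> B) g"
  have h: "?h (g x) = x" if "x \<in> A \<union> B" for x
    using assms that by (rule the_inv_into_f_f)
  have gA: "inj_on g A" and gB: "inj_on g B" using assms by (auto intro: inj_on_subset)
  show ?thesis
    unfolding perm_on_def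
  proof (rule sum.reindex_bij_witness[where j = "\<lambda>f. restrict (?h \<circ> f \<circ> g) A"
        and i = "\<lambda>f. restrict (g \<circ> f \<circ> ?h) (g ` A)"])
    fix f assume f: "f \<in> {f. f \<in> g ` A \<rightarrow>\<^sub>E g ` B \<and> bij_betw f (g ` A) (g ` B)}"
    have fb: "f (g a) \<in> g ` B" if "a \<in> A" for a using f that by auto
    have gh: "g (?h (f (g a))) = f (g a)" if "a \<in> A" for a
      using fb[OF that] h by auto
    show "restrict (g \<circ> restrict (?h \<circ> f \<circ> g) A \<circ> ?h) (g ` A) = f"
      using f gh h by (auto simp: fun_eq_iff PiE_def extensional_def)
    have "bij_betw (?h \<circ> f \<circ> g) A B"
    proof -
      have 1: "bij_betw g A (g ` A)" using gA by (rule inj_on_imp_bij_betw)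
      have 2: "bij_betw f (g ` A) (g ` B)" using f by auto
      have 3: "bij_betw ?h (g ` B) B"
        by (rule bij_betw_byWitness[where f' = g]) (auto simp: h)
      show ?thesis using bij_betw_trans[OF bij_betw_trans[OF 1 2] 3] by (simp only: comp_assoc)
    qed
    then have "bij_betw (restrict (?h \<circ> f \<circ> g) A) A B"
      by (subst bij_betw_cong[of _ _ "?h \<circ> f \<circ> g"]) auto
    then show "restrict (?h \<circ> f \<circ> g) A \<in> {f. f \<in> A \<rightarrow>\<^sub>E B \<and> bij_betw f A B}"
      by (auto simp: bij_betw_def)
    show "(\<Prod>a\<in>A. w (g a) (g (restrict (?h \<circ> f \<circ> g) A a))) = (\<Prod>a\<in>g ` A. w a (f a))"
      using gA gh by (subst prod.reindex) (auto intro!: prod.cong)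
  next
    fix f assume f: "f \<in> {f. f \<in> A \<rightarrow>\<^sub>E B \<and> bij_betw f A B}"
    have fb: "f a \<in> B" if "a \<in> A" for a using f that by auto
    show "restrict (?h \<circ> restrict (g \<circ> f \<circ> ?h) (g ` A) \<circ> g) A = f"
      using f fb h by (auto simp: fun_eq_iff PiE_def extensional_def)
    have "bij_betw (g \<circ> f \<circ> ?h) (g ` A) (g ` B)"
    proof -
      have 1: "bij_betw g B (g ` B)" using gB by (rule inj_on_imp_bij_betw)
      have 2: "bij_betw f A B" using f by auto
      have 3: "bij_betw ?h (g ` A) A"
        by (rule bij_betw_byWitness[where f' = g]) (auto simp: h)
      show ?thesis using bij_betw_trans[OF bij_betw_trans[OF 3 2] 1] by (simp only: comp_assoc)
    qed
    then have "bij_betw (restrict (g \<circ> f \<circ> ?h) (g ` A)) (g ` A) (g ` B)"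
      by (subst bij_betw_cong[of _ _ "g \<circ> f \<circ> ?h"]) auto
    then show "restrict (g \<circ> f \<circ> ?h) (g ` A) \<in> {f. f \<in> g ` A \<rightarrow>\<^sub>E g ` B \<and> bij_betw f (g ` A) (g ` B)}"
      by (auto simp: bij_betw_def)
  qed
qed

text \<open>The value 0 for an absent row or column makes expansion sums over a fixed set of
  neighbours correct without case distinctions.\<close>

definition perm_minor :: "('a \<Rightarrow> 'b \<Rightarrow> 'r::comm_ring_1) \<Rightarrow> 'a set \<Rightarrow> 'b set \<Rightarrow> 'a \<Rightarrow> 'b \<Rightarrow> 'r" where
  "perm_minor w A B a b = (if a \<in> A \<and> b \<in> B then perm_on w (A - {a}) (B - {b}) else 0)"

lemma perm_on_insert_col:
  assumes "finite A" "finite B" "finite N" "x \<notin> B"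
    and "\<And>s. s \<in> A \<Longrightarrow> s \<notin> N \<Longrightarrow> w s x = 0"
  shows "perm_on w A (insert x B) = (\<Sum>s\<in>N. w s x * (if s \<in> A then perm_on w (A - {s}) B else 0))"
proof -
  have "perm_on w A (insert x B) = (\<Sum>s\<in>A. w s x * perm_on w (A - {s}) B)"
    using assms by (subst perm_on_expand_col[of _ _ x]) auto
  also have "\<dots> = (\<Sum>s\<in>A. w s x * (if s \<in> A then perm_on w (A - {s}) B else 0))"
    by (intro sum.cong) auto
  also have "\<dots> = (\<Sum>s\<in>A \<inter> N. w s x * (if s \<in> A then perm_on w (A - {s}) B else 0))"
    using assms by (intro sum.mono_neutral_right) auto
  also have "\<dots> = (\<Sum>s\<in>N. w s x * (if s \<in> A then perm_on w (A - {s}) B else 0))"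
    using assms by (intro sum.mono_neutral_left) auto
  finally show ?thesis .
qed

lemma perm_on_insert_row:
  assumes "finite A" "finite B" "finite N" "x \<notin> A"
    and "\<And>t. t \<in> B \<Longrightarrow> t \<notin> N \<Longrightarrow> w x t = 0"
  shows "perm_on w (insert x A) B = (\<Sum>t\<in>N. w x t * (if t \<in> B then perm_on w A (B - {t}) else 0))"
proof -
  have "perm_on w (insert x A) B = perm_on (\<lambda>a b. w b a) B (insert x A)"
    by (rule perm_on_transpose)
  also have "\<dots> = (\<Sum>t\<in>N. w x t * (if t \<in> B then perm_on (\<lambda>a b. w b a) (B - {t}) A else 0))"
    using assms by (intro perm_on_insert_col) auto
  also have "\<dots> = (\<Sum>t\<in>N. w x t * (if t \<in> B then perm_on w A (B - {t}) else 0))"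
    by (intro sum.cong refl arg_cong2[where f = "(*)"] if_cong perm_on_transpose[symmetric])
  finally show ?thesis .
qed

text \<open>A bijection either fixes \<open>x\<close>, or row \<open>x\<close> goes to some column
  \<open>t\<close> and column \<open>x\<close> is hit from some row \<open>s\<close>. The set
  \<open>N\<close> only has to contain the neighbours of \<open>x\<close>; the zero convention of
  \<open>perm_minor\<close> discards those outside \<open>A\<close> or \<open>B\<close>.\<close>

lemma perm_on_insert_both:
  assumes "finite A" "finite B" "finite N" "x \<notin> A" "x \<notin> B" "x \<notin> N"
    and "\<And>t. t \<in> B \<Longrightarrow> t \<notin> N \<Longrightarrow> w x t = 0"
    and "\<And>s. s \<in> A \<Longrightarrow> s \<notin> N \<Longrightarrow> w s x = 0"
  shows "perm_on w (insert x A) (insert x B) =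
    w x x * perm_on w A B + (\<Sum>t\<in>N. \<Sum>s\<in>N. w x t * w s x * perm_minor w A B s t)"
proof -
  have "perm_on w (insert x A) (insert x B) =
      (\<Sum>t\<in>insert x N. w x t * (if t \<in> insert x B then perm_on w A (insert x B - {t}) else 0))"
    using assms by (intro perm_on_insert_row) auto
  also have "\<dots> = w x x * perm_on w A B +
      (\<Sum>t\<in>N. w x t * (if t \<in> insert x B then perm_on w A (insert x B - {t}) else 0))"
    using assms by simp
  also have "(\<Sum>t\<in>N. w x t * (if t \<in> insert x B then perm_on w A (insert x B - {t}) else 0)) =
      (\<Sum>t\<in>N. \<Sum>s\<in>N. w x t * w s x * perm_minor w A B s t)"
  proof (intro sum.cong refl)
    fix t assume "t \<in> N"
    then have tx: "t \<noteq> x" using assms by auto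
    show "w x t * (if t \<in> insert x B then perm_on w A (insert x B - {t}) else 0) =
        (\<Sum>s\<in>N. w x t * w s x * perm_minor w A B s t)"
    proof (cases "t \<in> B")
      case True
      have "perm_on w A (insert x B - {t}) = perm_on w A (insert x (B - {t}))"
        using tx by (simp add: insert_Diff_if)
      also have "\<dots> = (\<Sum>s\<in>N. w s x * (if s \<in> A then perm_on w (A - {s}) (B - {t}) else 0))"
        using assms by (intro perm_on_insert_col) auto
      also have "\<dots> = (\<Sum>s\<in>N. w s x * perm_minor w A B s t)"
        using True by (simp add: perm_minor_def)
      finally show ?thesis using True by (simp add: sum_distrib_left mult.assoc)
    qed (use tx in \<open>simp add: perm_minor_def\<close>)
  qed
  finally show ?thesis .
qed

section \<open>Weights of graphs, pendant paths and ears\<close>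

text \<open>With \<open>d s\<close> equal to \<open>x\<close> minus the degree of \<open>s\<close>
  this is the matrix \<open>x I - Q\<close>. The diagonal does not depend on \<open>E\<close> or on
  the index sets, so a vertex keeps its entry while the graph is built up from smaller vertex
  sets.\<close>

definition graph_weight :: "('a \<times> 'a) set \<Rightarrow> ('a \<Rightarrow> 'r) \<Rightarrow> 'a \<Rightarrow> 'a \<Rightarrow> 'r::comm_ring_1" where
  "graph_weight E d s t = (if s = t then d s else if (s, t) \<in> E then - 1 else 0)"

lemma sym_iff: "sym E \<Longrightarrow> (s, t) \<in> E \<longleftrightarrow> (t, s) \<in> E"
  by (auto simp: sym_def)

lemma graph_weight_sym: "sym E \<Longrightarrow> graph_weight E d s t = graph_weight E d t s"
  by (auto simp: graph_weight_def sym_def)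

lemma perm_on_graph_weight_sym:
  "sym E \<Longrightarrow> perm_on (graph_weight E d) A B = perm_on (graph_weight E d) B A"
  unfolding perm_on_transpose[of "graph_weight E d" A B]
  using graph_weight_sym[of E d] by (intro perm_on_cong) auto

lemma perm_minor_sym:
  "sym E \<Longrightarrow> perm_minor (graph_weight E d) A B s t = perm_minor (graph_weight E d) B A t s"
  by (simp add: perm_minor_def perm_on_graph_weight_sym[of E d "A - {s}" "B - {t}"] conj_commute)

text \<open>Fibonacci polynomials: \<open>gfib y (Suc k)\<close> is the permanent belonging to a path with \<open>k\<close>
  vertices.\<close>

fun gfib :: "'r::comm_ring_1 \<Rightarrow> nat \<Rightarrow> 'r" where
  "gfib y 0 = 0"
| "gfib y (Suc 0) = 1"
| "gfib y (Suc (Suc n)) = y * gfib y (Suc n) + gfib y n"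

text \<open>A path listed from its free end, whose last vertex is joined to \<open>b\<close>. Each
  vertex is tested only against \<open>U\<close> and the vertices after it, in step with expansions
  that strip the free end first.\<close>

fun pendant :: "('a \<times> 'a) set \<Rightarrow> 'a set \<Rightarrow> 'a list \<Rightarrow> 'a \<Rightarrow> bool" where
  "pendant E U [] b \<longleftrightarrow> True"
| "pendant E U (x # xs) b \<longleftrightarrow> x \<notin> U \<and> x \<notin> set xs \<and>
     (\<forall>t\<in>U \<union> set xs. (x, t) \<in> E \<longleftrightarrow> t = hd (xs @ [b])) \<and> pendant E U xs b"

lemma pendant_notin: "pendant E U xs b \<Longrightarrow> x \<in> set xs \<Longrightarrow> x \<notin> U"
  by (induction xs) auto

lemma hd_append_mem: "hd (xs @ [b]) \<in> insert b (set xs)"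
  by (cases xs) auto

context
  fixes E :: "('a \<times> 'a) set" and d :: "'a \<Rightarrow> 'r::comm_ring_1" and y :: 'r and U :: "'a set" and b :: 'a
  assumes symE: "sym E" and finU: "finite U" and bU: "b \<in> U"
begin

private abbreviation (input) "W \<equiv> graph_weight E d"

text \<open>The end \<open>x\<close> has a single neighbour, so it is either fixed or exchanged with
  it. An exchange contributes the product 1 of two entries -1, where a determinant would give
  -1.\<close>

lemma perm_on_insert_pendant_end:
  assumes "pendant E U (x # xs) b" "d x = y" "A \<subseteq> U" "B \<subseteq> U"
  shows "perm_on W (insert x (A \<union> set xs)) (insert x (B \<union> set xs)) =
    y * perm_on W (A \<union> set xs) (B \<union> set xs)
      + perm_minor W (A \<union> set xs) (B \<union> set xs) (hd (xs @ [b])) (hd (xs @ [b]))"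
proof -
  let ?n = "hd (xs @ [b])"
  have n: "?n \<in> U \<union> set xs" using bU hd_append_mem[of xs b] by auto
  have x: "x \<notin> U" "x \<notin> set xs" using assms by auto
  have nx: "?n \<noteq> x" using n x by auto
  have e: "(x, t) \<in> E \<longleftrightarrow> t = ?n" "(t, x) \<in> E \<longleftrightarrow> t = ?n" if "t \<in> U \<union> set xs" for t
    using assms(1) that symE by (auto simp: sym_def)
  have fin: "finite A" "finite B" using assms finU by (auto intro: finite_subset)
  have w: "W x ?n = - 1" "W ?n x = - 1" "W x x = y"
    using e[OF n] nx assms by (auto simp: graph_weight_def)
  have "perm_on W (insert x (A \<union> set xs)) (insert x (B \<union> set xs)) =
     W x x * perm_on W (A \<union> set xs) (B \<union> set xs)
     + (\<Sum>t\<in>{?n}. \<Sum>s\<in>{?n}. W x t * W s x * perm_minor W (A \<union> set xs) (B \<union> set xs) s t)"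
    using fin x nx e assms by (intro perm_on_insert_both) (auto simp: graph_weight_def)
  then show ?thesis by (simp add: w)
qed

text \<open>Removing the free end either keeps its neighbour or deletes it too, which is the
  recursion of \<open>gfib\<close>. Row and column sets may differ inside \<open>U\<close>, so that
  all minors needed later are covered.\<close>

lemma perm_on_pendant:
  assumes "pendant E U xs b" "\<And>x. x \<in> set xs \<Longrightarrow> d x = y" "A \<subseteq> U" "B \<subseteq> U"
  shows "perm_on W (A \<union> set xs) (B \<union> set xs) =
    gfib y (Suc (length xs)) * perm_on W A B + gfib y (length xs) * perm_minor W A B b b"
  using assms(1,2)
proof (induction xs rule: induct_list012)
  case 1
  then show ?case by simp
next
  case (2 x)
  then show ?case using perm_on_insert_pendant_end[of x "[]" A B] assms by simp
next
  case (3 x x' xs)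
  have x': "x' \<notin> A \<union> set xs" "x' \<notin> B \<union> set xs" using 3 assms by auto
  have s: "A \<union> set (x # x' # xs) = insert x (A \<union> set (x' # xs))"
    "B \<union> set (x # x' # xs) = insert x (B \<union> set (x' # xs))" by auto
  have "perm_on W (A \<union> set (x # x' # xs)) (B \<union> set (x # x' # xs)) =
     y * perm_on W (A \<union> set (x' # xs)) (B \<union> set (x' # xs))
     + perm_minor W (A \<union> set (x' # xs)) (B \<union> set (x' # xs)) x' x'"
    unfolding s using perm_on_insert_pendant_end[of x "x' # xs" A B] 3 assms by simp
  also have "perm_minor W (A \<union> set (x' # xs)) (B \<union> set (x' # xs)) x' x'
     = perm_on W (A \<union> set xs) (B \<union> set xs)"
  proof -
    have "A \<union> set (x' # xs) - {x'} = A \<union> set xs" "B \<union> set (x' # xs) - {x'} = B \<union> set xs"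
      using x' by auto
    then show ?thesis by (simp add: perm_minor_def)
  qed
  also have "perm_on W (A \<union> set xs) (B \<union> set xs) =
    gfib y (Suc (length xs)) * perm_on W A B + gfib y (length xs) * perm_minor W A B b b"
    using 3 by auto
  also have "perm_on W (A \<union> set (x' # xs)) (B \<union> set (x' # xs)) =
    gfib y (Suc (length (x' # xs))) * perm_on W A B + gfib y (length (x' # xs)) * perm_minor W A B b b"
    using 3 by (intro 3(2)) auto
  finally show ?case by (simp add: algebra_simps)
qed

text \<open>With the row of the first path vertex deleted, its column has only one nonzero entry, in
  the row of the next vertex. This forced choice repeats along the path and gives a factor -1 for
  every path vertex. For an empty path the first vertex is \<open>b\<close>, which may be missing
  from \<open>A\<close>; hence the conditional.\<close>

lemma perm_on_pendant_traverse:
  assumes "pendant E U xs b" "A \<subseteq> U" "B \<subseteq> U"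
  shows "(if hd (xs @ [b]) \<in> A \<union> set xs
      then perm_on W (A \<union> set xs - {hd (xs @ [b])}) (B \<union> set xs) else 0) =
    (- 1) ^ length xs * (if b \<in> A then perm_on W (A - {b}) B else 0)"
  using assms(1)
proof (induction xs)
  case Nil
  then show ?case by simp
next
  case (Cons x xs)
  let ?n = "hd (xs @ [b])"
  have n: "?n \<in> U \<union> set xs" using bU hd_append_mem[of xs b] by auto
  have x: "x \<notin> U" "x \<notin> set xs" using Cons.prems by auto
  have nx: "?n \<noteq> x" using n x by auto
  have e: "(t, x) \<in> E \<longleftrightarrow> t = ?n" if "t \<in> U \<union> set xs" for t
    using Cons.prems that symE by (auto simp: sym_def)
  have fin: "finite A" "finite B" using assms finU by (auto intro: finite_subset)
  have w: "W ?n x = - 1" using e[OF n] nx assms by (auto simp: graph_weight_def)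
  have s: "A \<union> set (x # xs) - {x} = A \<union> set xs" "B \<union> set (x # xs) = insert x (B \<union> set xs)"
    using x assms by auto
  have "perm_on W (A \<union> set xs) (insert x (B \<union> set xs)) =
     (\<Sum>s\<in>{?n}. W s x * (if s \<in> A \<union> set xs then perm_on W (A \<union> set xs - {s}) (B \<union> set xs) else 0))"
    using fin x nx e assms by (intro perm_on_insert_col) (auto simp: graph_weight_def)
  also have "\<dots> = - (if ?n \<in> A \<union> set xs then perm_on W (A \<union> set xs - {?n}) (B \<union> set xs) else 0)"
    by (simp add: w)
  also have "\<dots> = - ((- 1) ^ length xs * (if b \<in> A then perm_on W (A - {b}) B else 0))"
    using Cons.IH Cons.prems by (simp only: pendant.simps simp_thms)
  finally show ?case unfolding s list.sel append_Cons by simp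
qed

lemma perm_minor_pendant_traverse:
  assumes "pendant E U xs b" "A \<subseteq> U" "B \<subseteq> U" "a \<in> U"
  shows "perm_minor W (A \<union> set xs) (B \<union> set xs) (hd (xs @ [b])) a =
    (- 1) ^ length xs * perm_minor W A B b a"
proof -
  have a: "a \<notin> set xs" using pendant_notin[OF assms(1)] assms(4) by blast
  then have B: "B \<union> set xs - {a} = (B - {a}) \<union> set xs" by auto
  show ?thesis
  proof (cases "a \<in> B")
    case True
    have "perm_minor W (A \<union> set xs) (B \<union> set xs) (hd (xs @ [b])) a =
      (if hd (xs @ [b]) \<in> A \<union> set xs
       then perm_on W (A \<union> set xs - {hd (xs @ [b])}) ((B - {a}) \<union> set xs) else 0)"
      using True by (simp only: perm_minor_def B Un_iff simp_thms)
    also have "\<dots> = (- 1) ^ length xs * (if b \<in> A then perm_on W (A - {b}) (B - {a}) else 0)"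
      using assms by (intro perm_on_pendant_traverse) auto
    also have "\<dots> = (- 1) ^ length xs * perm_minor W A B b a"
      using True by (simp only: perm_minor_def simp_thms)
    finally show ?thesis .
  next
    case False
    then show ?thesis using a by (simp add: perm_minor_def)
  qed
qed

text \<open>The first interior vertex \<open>x\<close> has the two neighbours \<open>a\<close> and
  \<open>hd (xs @ [b])\<close>. If it is entered from and left to the same one, a pendant path
  remains; the two mixed choices force the whole path to be traversed, once in each
  direction.\<close>

lemma perm_on_ear:
  assumes "pendant E U xs b" "x \<notin> U" "x \<notin> set xs" "a \<in> U" "a \<noteq> hd (xs @ [b])"
    and nb: "\<And>t. t \<in> U \<union> set xs \<Longrightarrow> (x, t) \<in> E \<longleftrightarrow> t = a \<or> t = hd (xs @ [b])"
    and d: "\<And>t. t \<in> set (x # xs) \<Longrightarrow> d t = y" and AB: "A \<subseteq> U" "B \<subseteq> U"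
  shows "perm_on W (A \<union> set (x # xs)) (B \<union> set (x # xs)) =
    gfib y (length xs + 2) * perm_on W A B + gfib y (length xs + 1) * perm_minor W A B b b
    + (if a \<in> A \<and> a \<in> B then gfib y (length xs + 1) * perm_on W (A - {a}) (B - {a})
        + gfib y (length xs) * perm_minor W (A - {a}) (B - {a}) b b else 0)
    + (- 1) ^ length xs * (perm_minor W A B b a + perm_minor W A B a b)"
proof -
  let ?n = "hd (xs @ [b])"
  let ?A = "A \<union> set xs" and ?B = "B \<union> set xs"
  have n: "?n \<in> U \<union> set xs" using bU hd_append_mem[of xs b] by auto
  have nx: "?n \<noteq> x" "a \<noteq> x" using n assms by auto
  have e: "(x, t) \<in> E \<longleftrightarrow> t = a \<or> t = ?n" "(t, x) \<in> E \<longleftrightarrow> t = a \<or> t = ?n" if "t \<in> U \<union> set xs" for t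
    using nb that symE by (auto simp: sym_def)
  have fin: "finite A" "finite B" using assms finU by (auto intro: finite_subset)
  have w: "W x ?n = - 1" "W ?n x = - 1" "W x a = -1" "W a x = -1" "W x x = y"
    using e[OF n] e[of a] nx assms by (auto simp: graph_weight_def)
  have s: "A \<union> set (x # xs) = insert x ?A" "B \<union> set (x # xs) = insert x ?B" by auto
  have "perm_on W (insert x ?A) (insert x ?B) = W x x * perm_on W ?A ?B
     + (\<Sum>t\<in>{a, ?n}. \<Sum>s\<in>{a, ?n}. W x t * W s x * perm_minor W ?A ?B s t)"
    using fin nx e assms(2,3) AB by (intro perm_on_insert_both) (auto simp: graph_weight_def)
  also have "\<dots> = (y * perm_on W ?A ?B + perm_minor W ?A ?B ?n ?n) + perm_minor W ?A ?B a a
     + (perm_minor W ?A ?B ?n a + perm_minor W ?A ?B a ?n)"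
    using assms(5) by (simp add: w)
  also have "perm_minor W ?A ?B a ?n = (- 1) ^ length xs * perm_minor W A B a b"
    using perm_minor_pendant_traverse[OF assms(1) AB(2,1) assms(4)]
    by (simp only: perm_minor_sym[OF symE, of d ?B ?A] perm_minor_sym[OF symE, of d B A])
  also have "perm_minor W ?A ?B ?n a = (- 1) ^ length xs * perm_minor W A B b a"
    using perm_minor_pendant_traverse[OF assms(1) AB assms(4)] .
  also have "perm_minor W ?A ?B a a =
     (if a \<in> A \<and> a \<in> B then gfib y (length xs + 1) * perm_on W (A - {a}) (B - {a})
        + gfib y (length xs) * perm_minor W (A - {a}) (B - {a}) b b else 0)"
  proof -
    have a: "a \<notin> set xs" using pendant_notin[OF assms(1)] assms(4) by blast
    then have D: "?A - {a} = (A - {a}) \<union> set xs" "?B - {a} = (B - {a}) \<union> set xs" by auto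
    have "perm_on W ((A - {a}) \<union> set xs) ((B - {a}) \<union> set xs) =
       gfib y (Suc (length xs)) * perm_on W (A - {a}) (B - {a})
       + gfib y (length xs) * perm_minor W (A - {a}) (B - {a}) b b"
      using assms by (intro perm_on_pendant) auto
    then show ?thesis using a by (simp add: perm_minor_def[of _ ?A] D)
  qed
  \<comment> \<open>If \<open>xs\<close> is empty, \<open>?n\<close> is \<open>b\<close> itself;
    otherwise it is a path vertex whose removal shortens the path, and the recursion of
    \<open>gfib\<close> applies.\<close>
  also have "y * perm_on W ?A ?B + perm_minor W ?A ?B ?n ?n =
     gfib y (length xs + 2) * perm_on W A B + gfib y (length xs + 1) * perm_minor W A B b b"
  proof (cases xs)
    case Nil
    then show ?thesis by simp
  next
    case (Cons x' xs')
    have 1: "perm_on W ?A ?B = gfib y (Suc (length xs)) * perm_on W A B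
        + gfib y (length xs) * perm_minor W A B b b"
      using assms by (intro perm_on_pendant) auto
    have x': "x' \<notin> A \<union> set xs'" "x' \<notin> B \<union> set xs'" using Cons assms by auto
    then have "?A - {x'} = A \<union> set xs'" "?B - {x'} = B \<union> set xs'" using Cons by auto
    then have "perm_minor W ?A ?B ?n ?n = perm_on W (A \<union> set xs') (B \<union> set xs')"
      using Cons by (simp add: perm_minor_def)
    also have "\<dots> = gfib y (Suc (length xs')) * perm_on W A B
        + gfib y (length xs') * perm_minor W A B b b"
      using assms Cons by (intro perm_on_pendant) auto
    finally show ?thesis unfolding 1 using Cons by (simp add: algebra_simps)
  qed
  finally show ?thesis unfolding s by (simp add: algebra_simps)
qed

end

section \<open>Attaching paths and cycles\<close>

text \<open>The list \<open>zs\<close> is the interior of a path from \<open>a\<close> to \<open>b\<close> attached to the graph induced on \<open>U\<close>;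
  the two ends may coincide.\<close>

definition ear :: "('a \<times> 'a) set \<Rightarrow> 'a set \<Rightarrow> 'a \<Rightarrow> 'a list \<Rightarrow> 'a \<Rightarrow> bool" where
  "ear E U a zs b \<longleftrightarrow> zs \<noteq> [] \<and> a \<in> U \<and> b \<in> U \<and> hd zs \<notin> U \<and> hd zs \<notin> set (tl zs) \<and>
     pendant E U (tl zs) b \<and> a \<noteq> hd (tl zs @ [b]) \<and>
     (\<forall>t\<in>U \<union> set (tl zs). (hd zs, t) \<in> E \<longleftrightarrow> t = a \<or> t = hd (tl zs @ [b]))"

lemma ear_disjoint: "ear E U a zs b \<Longrightarrow> set zs \<inter> U = {}"
  by (cases zs) (auto simp: ear_def dest: pendant_notin)

text \<open>\<open>g\<close> counts the edges of the new path. The sign \<open>(- 1) ^ g\<close> of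
  a traversal has one factor for each of them.\<close>

lemma ear_perm_on:
  fixes d :: "'a \<Rightarrow> 'r::comm_ring_1"
  assumes "ear E U a zs b" "sym E" "finite U" "A \<subseteq> U" "B \<subseteq> U" "\<And>t. t \<in> set zs \<Longrightarrow> d t = y"
  defines "W \<equiv> graph_weight E d" and "g \<equiv> Suc (length zs)"
  shows "perm_on W (A \<union> set zs) (B \<union> set zs) =
    gfib y g * perm_on W A B + gfib y (g - 1) * perm_minor W A B b b
    + (if a \<in> A \<and> a \<in> B then gfib y (g - 1) * perm_on W (A - {a}) (B - {a})
        + (gfib y g - y * gfib y (g - 1)) * perm_minor W (A - {a}) (B - {a}) b b else 0)
    + (- 1) ^ g * (perm_minor W A B b a + perm_minor W A B a b)"
proof -
  obtain x xs where zs: "zs = x # xs" using assms(1) by (cases zs) (auto simp: ear_def)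
  have e: "pendant E U xs b" "x \<notin> U" "x \<notin> set xs" "a \<in> U" "b \<in> U" "a \<noteq> hd (xs @ [b])"
    "\<And>t. t \<in> U \<union> set xs \<Longrightarrow> (x, t) \<in> E \<longleftrightarrow> t = a \<or> t = hd (xs @ [b])"
    using assms(1) zs by (auto simp: ear_def)
  show ?thesis
    using perm_on_ear[OF assms(2,3) e(5,1,2,3,4,6,7), of d y A B] assms(4,5,6)
    unfolding zs W_def g_def by simp
qed

type_synonym 'r state = "'r \<times> 'r \<times> 'r \<times> 'r \<times> 'r"

text \<open>For a new path with both ends in \<open>{u, v}\<close>, \<open>ear_perm_on\<close>
  expresses each of these minors through the same five, so they are all that has to be remembered of
  the graph built so far. The minor with \<open>u\<close> and \<open>v\<close> interchanged equals
  the last one by symmetry.\<close>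

definition state :: "('a \<times> 'a) set \<Rightarrow> ('a \<Rightarrow> 'r::comm_ring_1) \<Rightarrow> 'a \<Rightarrow> 'a \<Rightarrow> 'a set \<Rightarrow> 'r state" where
  "state E d u v V =
    (perm_on (graph_weight E d) V V,
     perm_on (graph_weight E d) (V - {u}) (V - {u}),
     perm_on (graph_weight E d) (V - {v}) (V - {v}),
     perm_on (graph_weight E d) (V - {u, v}) (V - {u, v}),
     perm_on (graph_weight E d) (V - {u}) (V - {v}))"

text \<open>The effect of a new path with \<open>g\<close> edges between \<open>u\<close> and \<open>v\<close>. The factor
  \<open>gfib y g - y * gfib y (g - 1)\<close> stands for \<open>gfib y (g - 2)\<close> and takes the right value 1 for \<open>g = 1\<close>,
  so that a single edge is covered as well.\<close>

fun join_state :: "'r::comm_ring_1 \<Rightarrow> nat \<Rightarrow> 'r state \<Rightarrow> 'r state" where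
  "join_state y g (P, Pu, Pv, Puv, M) =
    (gfib y g * P + gfib y (g - 1) * (Pu + Pv) + (gfib y g - y * gfib y (g - 1)) * Puv + 2 * (- 1) ^ g * M,
     gfib y g * Pu + gfib y (g - 1) * Puv,
     gfib y g * Pv + gfib y (g - 1) * Puv,
     gfib y g * Puv,
     gfib y g * M + (- 1) ^ g * Puv)"

fun swap_state :: "'r state \<Rightarrow> 'r state" where
  "swap_state (P, Pu, Pv, Puv, M) = (P, Pv, Pu, Puv, M)"

text \<open>A cycle with \<open>g\<close> edges is attached at \<open>u\<close>. The second kind of
  summand collects the cases that use up \<open>u\<close>: it is exchanged with one of its two new
  neighbours, or the cycle is rotated in one of two directions.\<close>

fun loop_state :: "'r::comm_ring_1 \<Rightarrow> nat \<Rightarrow> 'r state \<Rightarrow> 'r state" where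
  "loop_state y g (P, Pu, Pv, Puv, M) =
    (gfib y g * P + 2 * (gfib y (g - 1) + (- 1) ^ g) * Pu,
     gfib y g * Pu,
     gfib y g * Pv + 2 * (gfib y (g - 1) + (- 1) ^ g) * Puv,
     gfib y g * Puv,
     gfib y g * M)"

lemma swap_state: "sym E \<Longrightarrow> swap_state (state E d u v V) = state E d v u V"
  using perm_on_graph_weight_sym[of E d "V - {u}" "V - {v}"]
  by (simp add: state_def insert_commute)

lemma state_join:
  fixes d :: "'a \<Rightarrow> 'r::comm_ring_1"
  assumes e: "ear E V u zs v" and E: "sym E" and V: "finite V" and uv: "u \<noteq> v"
    and d: "\<And>t. t \<in> set zs \<Longrightarrow> d t = y"
  shows "state E d u v (V \<union> set zs) = join_state y (Suc (length zs)) (state E d u v V)"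
proof -
  note p = ear_perm_on[OF e E V _ _ d]
  have uvV: "u \<in> V" "v \<in> V" using e by (auto simp: ear_def)
  have "u \<notin> set zs" "v \<notin> set zs" using ear_disjoint[OF e] uvV by auto
  then have s: "V \<union> set zs - {u} = (V - {u}) \<union> set zs" "V \<union> set zs - {v} = (V - {v}) \<union> set zs"
    "V \<union> set zs - {u, v} = (V - {u, v}) \<union> set zs" by auto
  have m: "perm_on (graph_weight E d) (V - {v}) (V - {u}) = perm_on (graph_weight E d) (V - {u}) (V - {v})"
    by (rule perm_on_graph_weight_sym[OF E])
  have s2: "V - {u} - {v} = V - {u, v}" "V - {v} - {u} = V - {u, v}" by auto
  show ?thesis
    unfolding state_def s join_state.simps
    using uv uvV
    by (simp add: p perm_minor_def s2 m algebra_simps)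
qed

lemma state_loop:
  fixes d :: "'a \<Rightarrow> 'r::comm_ring_1"
  assumes e: "ear E V u zs u" and E: "sym E" and V: "finite V" and uv: "u \<noteq> v" "v \<in> V"
    and d: "\<And>t. t \<in> set zs \<Longrightarrow> d t = y"
  shows "state E d u v (V \<union> set zs) = loop_state y (Suc (length zs)) (state E d u v V)"
proof -
  note p = ear_perm_on[OF e E V _ _ d]
  have uvV: "u \<in> V" using e by (auto simp: ear_def)
  have "u \<notin> set zs" "v \<notin> set zs" using ear_disjoint[OF e] uvV uv by auto
  then have s: "V \<union> set zs - {u} = (V - {u}) \<union> set zs" "V \<union> set zs - {v} = (V - {v}) \<union> set zs"
    "V \<union> set zs - {u, v} = (V - {u, v}) \<union> set zs" by auto
  have s2: "V - {u} - {v} = V - {u, v}" "V - {v} - {u} = V - {u, v}" by auto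
  show ?thesis
    unfolding state_def s loop_state.simps
    using uv uvV
    by (simp add: p perm_minor_def s2 algebra_simps)
qed

lemma state_loop':
  fixes d :: "'a \<Rightarrow> 'r::comm_ring_1"
  assumes e: "ear E V v zs v" and E: "sym E" and V: "finite V" and uv: "u \<noteq> v" "u \<in> V"
    and d: "\<And>t. t \<in> set zs \<Longrightarrow> d t = y"
  shows "state E d u v (V \<union> set zs) =
    swap_state (loop_state y (Suc (length zs)) (swap_state (state E d u v V)))"
proof -
  have "swap_state (state E d v u (V \<union> set zs)) =
    swap_state (loop_state y (Suc (length zs)) (state E d v u V))"
    using state_loop[OF e E V _ uv(2) d] uv(1) by auto
  then show ?thesis by (simp add: swap_state[OF E])
qed

section \<open>Disjoint cycles and the initial state\<close>

text \<open>The three summands belong to a chosen vertex that is fixed, exchanged with one of its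
  two neighbours, or moved along the whole cycle in one of two directions.\<close>

definition cycle_perm :: "'r::comm_ring_1 \<Rightarrow> nat \<Rightarrow> 'r" where
  "cycle_perm y c = y * gfib y c + 2 * gfib y (c - 1) + 2 * (- 1) ^ c"

text \<open>The cycle is an ear from \<open>x\<close> to itself, attached while \<open>x\<close> is
  still an isolated vertex. Rows and columns are deleted only inside \<open>U\<close>, so all minors
  get the same factor.\<close>

lemma perm_on_cycle:
  fixes d :: "'a \<Rightarrow> 'r::comm_ring_1"
  assumes e: "ear E (insert x U) x zs x" and E: "sym E" and U: "finite U" "x \<notin> U" "A \<subseteq> U" "B \<subseteq> U"
    and iso: "\<And>t. t \<in> U \<Longrightarrow> (x, t) \<notin> E"
    and d: "\<And>t. t \<in> set (x # zs) \<Longrightarrow> d t = y"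
  shows "perm_on (graph_weight E d) (A \<union> set (x # zs)) (B \<union> set (x # zs)) =
     cycle_perm y (Suc (length zs)) * perm_on (graph_weight E d) A B"
proof -
  let ?W = "graph_weight E d"
  have x: "x \<notin> A" "x \<notin> B" and fin: "finite A" "finite B" using U by (auto intro: finite_subset)
  have iso': "(t, x) \<notin> E" if "t \<in> U" for t using iso that E by (auto simp: sym_def)
  have "perm_on ?W (insert x A) (insert x B) = ?W x x * perm_on ?W A B
    + (\<Sum>t\<in>{}. \<Sum>s\<in>{}. ?W x t * ?W s x * perm_minor ?W A B s t)"
    using x fin iso iso' U by (intro perm_on_insert_both) (auto simp: graph_weight_def)
  then have 1: "perm_on ?W (insert x A) (insert x B) = y * perm_on ?W A B"
    using d[of x] by (simp add: graph_weight_def)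
  have 2: "perm_minor ?W (insert x A) (insert x B) x x = perm_on ?W A B"
    using x by (simp add: perm_minor_def)
  have s: "A \<union> set (x # zs) = insert x A \<union> set zs" "B \<union> set (x # zs) = insert x B \<union> set zs" by auto
  have "perm_on ?W (insert x A \<union> set zs) (insert x B \<union> set zs) =
    gfib y (Suc (length zs)) * perm_on ?W (insert x A) (insert x B)
    + gfib y (Suc (length zs) - 1) * perm_minor ?W (insert x A) (insert x B) x x
    + (if x \<in> insert x A \<and> x \<in> insert x B
        then gfib y (Suc (length zs) - 1) * perm_on ?W (insert x A - {x}) (insert x B - {x})
        + (gfib y (Suc (length zs)) - y * gfib y (Suc (length zs) - 1))
          * perm_minor ?W (insert x A - {x}) (insert x B - {x}) x x else 0)
    + (- 1) ^ Suc (length zs) * (perm_minor ?W (insert x A) (insert x B) x x + perm_minor ?W (insert x A) (insert x B) x x)"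
    using U d by (intro ear_perm_on[OF e E]) auto
  then show ?thesis unfolding s 1 2 cycle_perm_def using x by (simp add: perm_minor_def algebra_simps)
qed

text \<open>Two nonadjacent vertices with diagonal entry \<open>y - 1\<close>; \<open>K\<close> is the contribution of disjoint cycles.\<close>

definition base_state :: "'r::comm_ring_1 \<Rightarrow> 'r \<Rightarrow> 'r state" where
  "base_state y K = (K * (y - 1) ^ 2, K * (y - 1), K * (y - 1), K, 0)"

text \<open>An adjacent pair can also be exchanged, which adds 1, and its mixed minor becomes -1.
  Adjacency of \<open>u\<close> and \<open>v\<close> is thus covered by joining a path with one
  edge.\<close>

lemma join_base_state:
  "join_state y 1 (base_state y K) = (K * ((y - 1) ^ 2 + 1), K * (y - 1), K * (y - 1), K, - K)"
  by (simp add: base_state_def algebra_simps)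

text \<open>Paths and cycles may be attached in any order. Together with the next lemma this brings
  every dumbbell to the one order used in \<open>dumbbell_perm\<close>.\<close>

lemma loop_join_commute: "loop_state y g (join_state y l s) = join_state y l (loop_state y g s)"
  by (cases s) (simp add: algebra_simps)

lemma loop_join_commute':
  "swap_state (loop_state y g (swap_state (join_state y l s))) =
    join_state y l (swap_state (loop_state y g (swap_state s)))"
  by (cases s) (simp add: algebra_simps)

section \<open>Closed forms after the substitution y = e - 1/e\<close>

text \<open>The scaled permanent of a theta graph without its factor \<open>- e\<close>. The blocks
  are ordered by the number of paths whose power of \<open>- (x^2)\<close> enters; the last block
  comes from the cycles formed by two of the three paths.\<close>

definition theta_fun :: "real \<Rightarrow> nat \<Rightarrow> nat \<Rightarrow> nat \<Rightarrow> real" where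
  "theta_fun x a b c = (1 + x + 2 * x\<^sup>2)\<^sup>2
    - x\<^sup>2 * (1 + x)\<^sup>2 * ((- (x\<^sup>2)) ^ a + (- (x\<^sup>2)) ^ b + (- (x\<^sup>2)) ^ c)
    + (1 - x)\<^sup>2 * ((- (x\<^sup>2)) ^ (a + b) + (- (x\<^sup>2)) ^ (a + c) + (- (x\<^sup>2)) ^ (b + c))
    - (2 - x + x\<^sup>2)\<^sup>2 * (- (x\<^sup>2)) ^ (a + b + c)
    + 2 * (1 + x\<^sup>2)\<^sup>2 * (x ^ (a + b) * (1 - (- (x\<^sup>2)) ^ c) + x ^ (a + c) * (1 - (- (x\<^sup>2)) ^ b)
        + x ^ (b + c) * (1 - (- (x\<^sup>2)) ^ a))"

text \<open>The scaled permanent of a dumbbell is affine in the \<open>l\<close>-th power of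
  \<open>- (x^2)\<close>, which belongs to the connecting path. Both its constant and its linear
  part split into one factor for each cycle: \<open>dumbbell_end\<close> and
  \<open>dumbbell_end'\<close>.\<close>

definition dumbbell_end :: "real \<Rightarrow> nat \<Rightarrow> real" where
  "dumbbell_end x g = 1 + x + 2 * x\<^sup>2 + (- (x\<^sup>2)) ^ g * (1 - x) + 2 * x ^ g * (1 + x\<^sup>2)"

definition dumbbell_end' :: "real \<Rightarrow> nat \<Rightarrow> real" where
  "dumbbell_end' x g = x * (1 + x) + (- (x\<^sup>2)) ^ g * (2 - x + x\<^sup>2) + 2 * x ^ g * (1 + x\<^sup>2)"

definition dumbbell_fun :: "real \<Rightarrow> nat \<Rightarrow> nat \<Rightarrow> nat \<Rightarrow> real" where
  "dumbbell_fun x l g h = dumbbell_end x g * dumbbell_end x h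
     - (- (x\<^sup>2)) ^ l * dumbbell_end' x g * dumbbell_end' x h"

context
  fixes e y :: real
  assumes e: "e \<noteq> 0" and y: "y = e - 1 / e"
begin

text \<open>As \<open>e\<close> and \<open>- 1 / e\<close> are the roots of
  \<open>t^2 = y * t + 1\<close>, the value \<open>gfib y k\<close> is
  \<open>(e^k - (- 1 / e)^k) / (e + 1 / e)\<close>. The factors in front clear the
  denominators.\<close>

lemma gfib_closed: "(- e) ^ k * (1 + e\<^sup>2) * gfib y k = - e * (1 - (- (e\<^sup>2)) ^ k)"
proof (induction k rule: induct_nat_012)
  case 0
  then show ?case by simp
next
  case 1
  then show ?case by (simp add: algebra_simps)
next
  case (ge2 n)
  have ey: "e * y = e\<^sup>2 - 1" using e by (simp add: y field_simps power2_eq_square)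
  have "(- e) ^ Suc (Suc n) * (1 + e\<^sup>2) * gfib y (Suc (Suc n)) =
     - (e * y) * ((- e) ^ Suc n * (1 + e\<^sup>2) * gfib y (Suc n)) + e\<^sup>2 * ((- e) ^ n * (1 + e\<^sup>2) * gfib y n)"
    by (simp add: algebra_simps power2_eq_square)
  also have "\<dots> = - (e\<^sup>2 - 1) * (- e * (1 - (- (e\<^sup>2)) ^ Suc n)) + e\<^sup>2 * (- e * (1 - (- (e\<^sup>2)) ^ n))"
    by (simp only: ge2 ey)
  also have "\<dots> = - e * (1 - (- (e\<^sup>2)) ^ Suc (Suc n))"
    by (simp add: algebra_simps)
  finally show ?case .
qed

lemma gfib_pred_closed:
  assumes "g \<ge> 1"
  shows "(- e) ^ g * (1 + e\<^sup>2) * gfib y (g - 1) = e\<^sup>2 + (- (e\<^sup>2)) ^ g"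
proof -
  obtain k where k: "g = Suc k" using assms by (cases g) auto
  have "(- e) ^ g * (1 + e\<^sup>2) * gfib y (g - 1) = - e * ((- e) ^ k * (1 + e\<^sup>2) * gfib y k)"
    by (simp add: k)
  also have "\<dots> = e\<^sup>2 + (- (e\<^sup>2)) ^ g"
    unfolding gfib_closed by (simp add: k algebra_simps power2_eq_square)
  finally show ?thesis .
qed

text \<open>The additional \<open>e\<close> clears the denominator of \<open>y\<close>. At
  \<open>g = 1\<close> the difference is 1, as required for a single edge.\<close>

lemma gfib_pred2_closed:
  assumes "g \<ge> 1"
  shows "e * ((- e) ^ g * (1 + e\<^sup>2) * (gfib y g - y * gfib y (g - 1))) = - (e ^ 4) + (- (e\<^sup>2)) ^ g"
proof -
  have ey: "e * y = e\<^sup>2 - 1" using e by (simp add: y field_simps power2_eq_square)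
  have "e * ((- e) ^ g * (1 + e\<^sup>2) * (gfib y g - y * gfib y (g - 1))) =
    e * ((- e) ^ g * (1 + e\<^sup>2) * gfib y g) - (e * y) * ((- e) ^ g * (1 + e\<^sup>2) * gfib y (g - 1))"
    by (simp add: algebra_simps)
  also have "\<dots> = - (e ^ 4) + (- (e\<^sup>2)) ^ g"
    unfolding gfib_closed gfib_pred_closed[OF assms] ey by (simp add: algebra_simps power2_eq_square power4_eq_xxxx)
  finally show ?thesis .
qed

lemma sign_scaled: "(- e) ^ g * (- 1) ^ g = e ^ g"
  by (simp add: power_mult_distrib[symmetric])

text \<open>The first two summands of \<open>cycle_perm\<close> form the Lucas companion
  \<open>e^c + (- 1 / e)^c\<close> of \<open>gfib\<close>; the third is
  \<open>2 * (- 1)^c\<close>.\<close>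

lemma cycle_perm_closed:
  assumes "c \<ge> 1"
  shows "(- e) ^ c * cycle_perm y c = 1 + 2 * e ^ c + (- (e\<^sup>2)) ^ c"
proof -
  have ey: "e * y = e\<^sup>2 - 1" using e by (simp add: y field_simps power2_eq_square)
  have "e * (1 + e\<^sup>2) * ((- e) ^ c * cycle_perm y c) =
     (e * y) * ((- e) ^ c * (1 + e\<^sup>2) * gfib y c) + 2 * e * ((- e) ^ c * (1 + e\<^sup>2) * gfib y (c - 1))
     + 2 * e * (1 + e\<^sup>2) * ((- e) ^ c * (- 1) ^ c)"
    by (simp add: cycle_perm_def algebra_simps)
  also have "\<dots> = e * (1 + e\<^sup>2) * (1 + 2 * e ^ c + (- (e\<^sup>2)) ^ c)"
    unfolding gfib_closed gfib_pred_closed[OF assms] ey sign_scaled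
    by (simp add: algebra_simps power2_eq_square)
  finally show ?thesis using e by (simp add: add_nonneg_eq_0_iff)
qed

lemma fst_join_state_base:
  "fst (join_state y a (join_state y b (join_state y c (base_state y K)))) =
    K * ((y - 1)\<^sup>2 * gfib y a * gfib y b * gfib y c
      + 2 * (y - 1) * (gfib y (a - 1) * gfib y b * gfib y c + gfib y a * gfib y (b - 1) * gfib y c
          + gfib y a * gfib y b * gfib y (c - 1))
      + ((gfib y a - y * gfib y (a - 1)) * gfib y b * gfib y c
          + gfib y a * (gfib y b - y * gfib y (b - 1)) * gfib y c
          + gfib y a * gfib y b * (gfib y c - y * gfib y (c - 1)))
      + 2 * (gfib y (a - 1) * gfib y (b - 1) * gfib y c + gfib y (a - 1) * gfib y b * gfib y (c - 1)
          + gfib y a * gfib y (b - 1) * gfib y (c - 1))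
      + 2 * ((- 1) ^ a * (- 1) ^ b * gfib y c + (- 1) ^ a * gfib y b * (- 1) ^ c
          + gfib y a * (- 1) ^ b * (- 1) ^ c))"
  by (simp add: base_state_def algebra_simps power2_eq_square)

text \<open>Each of the three paths brings its own factor \<open>(- e)^a * (1 + e^2)\<close>, which
  turns its Fibonacci values into polynomials in \<open>e\<close>.\<close>

lemma theta_closed:
  assumes "a \<ge> 1" "b \<ge> 1" "c \<ge> 1"
  shows "(- e) ^ (a + b + c) * (1 + e\<^sup>2) ^ 3 *
    fst (join_state y a (join_state y b (join_state y c (base_state y K)))) = - e * K * theta_fun e a b c"
proof -
  define q where "q = 1 + e\<^sup>2"
  define A0 B0 C0 where "A0 = (- e) ^ a * q * gfib y a" and "B0 = (- e) ^ b * q * gfib y b"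
    and "C0 = (- e) ^ c * q * gfib y c"
  define A1 B1 C1 where "A1 = (- e) ^ a * q * gfib y (a - 1)" and "B1 = (- e) ^ b * q * gfib y (b - 1)"
    and "C1 = (- e) ^ c * q * gfib y (c - 1)"
  define A2 B2 C2 where "A2 = e * ((- e) ^ a * q * (gfib y a - y * gfib y (a - 1)))"
    and "B2 = e * ((- e) ^ b * q * (gfib y b - y * gfib y (b - 1)))"
    and "C2 = e * ((- e) ^ c * q * (gfib y c - y * gfib y (c - 1)))"
  define A3 B3 C3 where "A3 = (- e) ^ a * (- 1) ^ a" and "B3 = (- e) ^ b * (- 1) ^ b"
    and "C3 = (- e) ^ c * (- 1 :: real) ^ c"
  define Y where "Y = e * (y - 1)"
  have e2: "e\<^sup>2 \<noteq> 0" using e by simp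
  have Y: "Y = e\<^sup>2 - 1 - e" using e by (simp add: Y_def y field_simps power2_eq_square)
  \<comment> \<open>The additional \<open>e^2\<close> supplies the factor \<open>e\<close> contained
    in \<open>Y\<close> and in \<open>A2\<close>, \<open>B2\<close>, \<open>C2\<close>.\<close>
  have "e\<^sup>2 * ((- e) ^ (a + b + c) * q ^ 3 *
      fst (join_state y a (join_state y b (join_state y c (base_state y K))))) =
    K * (Y\<^sup>2 * A0 * B0 * C0 + 2 * e * Y * (A1 * B0 * C0 + A0 * B1 * C0 + A0 * B0 * C1)
      + e * (A2 * B0 * C0 + A0 * B2 * C0 + A0 * B0 * C2)
      + 2 * e\<^sup>2 * (A1 * B1 * C0 + A1 * B0 * C1 + A0 * B1 * C1)
      + 2 * e\<^sup>2 * q\<^sup>2 * (A3 * B3 * C0 + A3 * B0 * C3 + A0 * B3 * C3))"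
    unfolding fst_join_state_base A0_def B0_def C0_def A1_def B1_def C1_def A2_def B2_def C2_def
      A3_def B3_def C3_def Y_def power_add
    by Groebner_Basis.algebra
  also have "\<dots> = e\<^sup>2 * (- e * K * theta_fun e a b c)"
  proof -
    have 0: "A0 = - e * (1 - (- (e\<^sup>2)) ^ a)" "B0 = - e * (1 - (- (e\<^sup>2)) ^ b)" "C0 = - e * (1 - (- (e\<^sup>2)) ^ c)"
      unfolding A0_def B0_def C0_def q_def by (rule gfib_closed)+
    have 1: "A1 = e\<^sup>2 + (- (e\<^sup>2)) ^ a" "B1 = e\<^sup>2 + (- (e\<^sup>2)) ^ b" "C1 = e\<^sup>2 + (- (e\<^sup>2)) ^ c"
      unfolding A1_def B1_def C1_def q_def using assms by (simp_all only: gfib_pred_closed)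
    have 2: "A2 = - (e ^ 4) + (- (e\<^sup>2)) ^ a" "B2 = - (e ^ 4) + (- (e\<^sup>2)) ^ b" "C2 = - (e ^ 4) + (- (e\<^sup>2)) ^ c"
      unfolding A2_def B2_def C2_def q_def using assms by (simp_all only: gfib_pred2_closed)
    have 3: "A3 = e ^ a" "B3 = e ^ b" "C3 = e ^ c"
      unfolding A3_def B3_def C3_def by (rule sign_scaled)+
    show ?thesis unfolding 0 1 2 3 Y q_def theta_fun_def power_add by Groebner_Basis.algebra
  qed
  finally show ?thesis unfolding q_def by (simp only: mult_left_cancel[OF e2])
qed

lemma dumbbell_closed:
  assumes "l \<ge> 1" "g \<ge> 1" "h \<ge> 1"
  shows "(- e) ^ (l + g + h) * (1 + e\<^sup>2) ^ 3 *
    fst (join_state y l (loop_state y g (swap_state (loop_state y h (swap_state (base_state y K)))))) =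
    - e * K * dumbbell_fun e l g h"
proof -
  define q where "q = 1 + e\<^sup>2"
  define A0 B0 C0 where "A0 = (- e) ^ l * q * gfib y l" and "B0 = (- e) ^ g * q * gfib y g"
    and "C0 = (- e) ^ h * q * gfib y h"
  define A1 B1 C1 where "A1 = (- e) ^ l * q * gfib y (l - 1)" and "B1 = (- e) ^ g * q * gfib y (g - 1)"
    and "C1 = (- e) ^ h * q * gfib y (h - 1)"
  define A2 where "A2 = e * ((- e) ^ l * q * (gfib y l - y * gfib y (l - 1)))"
  define B3 C3 where "B3 = (- e) ^ g * (- 1) ^ g" and "C3 = (- e) ^ h * (- 1 :: real) ^ h"
  define Y where "Y = e * (y - 1)"
  have e2: "e\<^sup>2 \<noteq> 0" using e by simp
  have Y: "Y = e\<^sup>2 - 1 - e" using e by (simp add: Y_def y field_simps power2_eq_square)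
  have "e\<^sup>2 * ((- e) ^ (l + g + h) * q ^ 3 *
      fst (join_state y l (loop_state y g (swap_state (loop_state y h (swap_state (base_state y K))))))) =
    K * (A0 * (Y * B0 + 2 * e * (B1 + q * B3)) * (Y * C0 + 2 * e * (C1 + q * C3))
      + e * A1 * (B0 * (Y * C0 + 2 * e * (C1 + q * C3)) + (Y * B0 + 2 * e * (B1 + q * B3)) * C0)
      + e * A2 * B0 * C0)"
    unfolding base_state_def swap_state.simps loop_state.simps join_state.simps fst_conv
      A0_def B0_def C0_def A1_def B1_def C1_def A2_def B3_def C3_def Y_def power_add
    by Groebner_Basis.algebra
  also have "\<dots> = e\<^sup>2 * (- e * K * dumbbell_fun e l g h)"
  proof -
    have 0: "A0 = - e * (1 - (- (e\<^sup>2)) ^ l)" "B0 = - e * (1 - (- (e\<^sup>2)) ^ g)" "C0 = - e * (1 - (- (e\<^sup>2)) ^ h)"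
      unfolding A0_def B0_def C0_def q_def by (rule gfib_closed)+
    have 1: "A1 = e\<^sup>2 + (- (e\<^sup>2)) ^ l" "B1 = e\<^sup>2 + (- (e\<^sup>2)) ^ g" "C1 = e\<^sup>2 + (- (e\<^sup>2)) ^ h"
      unfolding A1_def B1_def C1_def q_def using assms by (simp_all only: gfib_pred_closed)
    have 2: "A2 = - (e ^ 4) + (- (e\<^sup>2)) ^ l"
      unfolding A2_def q_def using assms by (simp_all only: gfib_pred2_closed)
    have 3: "B3 = e ^ g" "C3 = e ^ h"
      unfolding B3_def C3_def by (rule sign_scaled)+
    show ?thesis
      unfolding 0 1 2 3 Y q_def dumbbell_fun_def dumbbell_end_def dumbbell_end'_def by Groebner_Basis.algebra
  qed
  finally show ?thesis unfolding q_def by (simp only: mult_left_cancel[OF e2])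
qed

end

section \<open>Comparison of coefficients\<close>

text \<open>The expansion of \<open>s * x^n * (1 + x)^2\<close>, contributed by a single
  path.\<close>

definition square_terms :: "real \<Rightarrow> nat \<Rightarrow> real poly" where
  "square_terms s n = monom s n + monom (2 * s) (n + 1) + monom s (n + 2)"

text \<open>The expansion of \<open>2 * s * x^n * (1 + x^2)^2\<close>, contributed by a cycle
  through two paths.\<close>

definition path_terms :: "real \<Rightarrow> nat \<Rightarrow> real poly" where
  "path_terms s n = monom (2 * s) n + monom (4 * s) (n + 2) + monom (2 * s) (n + 4)"

text \<open>This is \<open>(1 + x + 2 * x^2)^2\<close>, the part that does not depend on the lengths
  and is common to theta graphs and dumbbells.\<close>

definition const_poly :: "real poly" where
  "const_poly = [:1, 2, 5, 4, 4:]"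

text \<open>\<open>theta_fun\<close> multiplied out into monomials, so that a coefficient becomes a
  sum of conditionals on exponents. An exponent such as \<open>2 * a + b + c\<close> belongs to the
  cycle of lengths \<open>b\<close> and \<open>c\<close> together with the power of
  \<open>x^2\<close> of the third path.\<close>

definition theta_poly :: "nat \<Rightarrow> nat \<Rightarrow> nat \<Rightarrow> real poly" where
  "theta_poly a b c = const_poly
    - (square_terms ((- 1) ^ a) (2 * a + 2) + square_terms ((- 1) ^ b) (2 * b + 2)
        + square_terms ((- 1) ^ c) (2 * c + 2))
    + (let m = (\<lambda>k. monom ((- 1) ^ k) (2 * k) - monom (2 * (- 1) ^ k) (2 * k + 1) + monom ((- 1) ^ k) (2 * k + 2))
       in m (a + b) + m (a + c) + m (b + c))
    + (path_terms 1 (a + b) + path_terms 1 (a + c) + path_terms 1 (b + c))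
    - (path_terms ((- 1) ^ a) (2 * a + b + c) + path_terms ((- 1) ^ b) (a + 2 * b + c)
        + path_terms ((- 1) ^ c) (a + b + 2 * c))
    - (let k = a + b + c; s = (- 1) ^ k in monom (4 * s) (2 * k) - monom (4 * s) (2 * k + 1)
        + monom (5 * s) (2 * k + 2) - monom (2 * s) (2 * k + 3) + monom s (2 * k + 4))"

lemma minus_square_power: "(- (x\<^sup>2)) ^ k = (- 1) ^ k * x ^ (2 * k)" for x :: real
  by (metis mult_minus1 power_mult power_mult_distrib)

lemma poly_theta_poly: "poly (theta_poly a b c) x = theta_fun x a b c"
proof -
  have p: "x ^ (2 * k) = x ^ k * x ^ k" for k by (simp add: mult_2 power_add)
  show ?thesis
    unfolding theta_poly_def theta_fun_def const_poly_def square_terms_def path_terms_def Let_def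
      minus_square_power
    by (simp add: poly_monom power_add p) Groebner_Basis.algebra
qed

text \<open>The part of the dumbbell polynomial (cycles of lengths \<open>g \<le> h\<close>, path with \<open>l\<close> edges) below the
  powers \<open>2 * g\<close> and \<open>2 * l + 1 + g\<close>.\<close>

definition dumbbell_main :: "nat \<Rightarrow> nat \<Rightarrow> nat \<Rightarrow> real poly" where
  "dumbbell_main l g h = const_poly
    + (let m = (\<lambda>k. monom 2 k + monom 2 (k + 1) + monom 6 (k + 2) + monom 2 (k + 3) + monom 4 (k + 4))
       in m g + m h)
    - square_terms ((- 1) ^ l) (2 * l + 2)"

text \<open>Only low coefficients of a dumbbell polynomial are needed explicitly; everything else
  can stay hidden in \<open>p\<close>.\<close>

lemma dumbbell_fun_poly:
  assumes "g \<le> h" "1 \<le> g"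
  obtains p where "\<And>x. poly p x = dumbbell_fun x l g h"
    "\<And>n. n < 2 * g \<Longrightarrow> n < 2 * l + 1 + g \<Longrightarrow> coeff p n = coeff (dumbbell_main l g h) n"
proof -
  obtain j where h: "h = g + j" using assms(1) le_Suc_ex by blast
  \<comment> \<open>The product of the two cycle terms beside the connecting path carries
    \<open>x^(2 * l + g + h)\<close>. Writing \<open>h - 1\<close> as \<open>i + j\<close> lets
    \<open>x^(2 * l + 1 + g)\<close> be split off.\<close>
  obtain i where g: "g = Suc i" using assms(2) by (cases g) auto
  define s where "s k = [:(- 1) ^ k :: real:]" for k
  define M where "M k = monom (1 :: real) k" for k
  define X where "X = [:0, 1 :: real:]"
  \<comment> \<open>\<open>dumbbell_end x k\<close> is \<open>1 + x + 2 * x^2 + x^k * u k\<close>,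
    and \<open>dumbbell_end' x k\<close> is \<open>x * (1 + x) + x^k * v k\<close>. After
    multiplying out, \<open>R1\<close> and \<open>R2\<close> collect what
    \<open>dumbbell_main\<close> omits.\<close>
  define u where "u k = s k * M k * (1 - X) + 2 * (1 + X ^ 2)" for k
  define v where "v k = s k * M k * (2 - X + X ^ 2) + 2 * (1 + X ^ 2)" for k
  define R1 where "R1 = (1 + X + 2 * X ^ 2) * (1 - X) * (s g + s h * M j * M j) + M j * u g * u h"
  define R2 where "R2 = - s l * ((1 + X) * (v g + M j * v h) + M i * M j * v g * v h)"
  define p where "p = dumbbell_main l g h + M (2 * g) * R1 + M (2 * l + 1 + g) * R2"
  have "poly p x = dumbbell_fun x l g h" for x
  proof -
    have p: "x ^ (2 * k) = x ^ k * x ^ k" for k by (simp add: mult_2 power_add)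
    have xg: "x ^ g = x * x ^ i" by (simp add: g)
    have "poly p x = dumbbell_fun x l g h"
      unfolding p_def R1_def R2_def u_def v_def s_def M_def X_def dumbbell_main_def Let_def
        dumbbell_fun_def dumbbell_end_def dumbbell_end'_def const_poly_def square_terms_def
        minus_square_power h
      by (simp add: poly_monom power_add p xg) Groebner_Basis.algebra
    then show ?thesis .
  qed
  moreover have "coeff p n = coeff (dumbbell_main l g h) n" if "n < 2 * g" "n < 2 * l + 1 + g" for n
    using that by (simp add: p_def M_def coeff_monom_mult)
  ultimately show ?thesis using that by blast
qed

section \<open>The factor contributed by disjoint cycles\<close>

definition cycle_poly :: "nat list \<Rightarrow> real poly" where
  "cycle_poly cs = (\<Prod>c\<leftarrow>cs. 1 + monom 2 c + monom ((- 1) ^ c) (2 * c))"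

lemma poly_cycle_poly: "poly (cycle_poly cs) x = (\<Prod>c\<leftarrow>cs. 1 + 2 * x ^ c + (- (x\<^sup>2)) ^ c)"
  by (induction cs) (simp_all add: cycle_poly_def poly_monom minus_square_power)

text \<open>A product of nonconstant terms from two factors has degree at least
  \<open>2 * m\<close>, and so has the last term of each factor. Below that only the single terms
  \<open>2 * x^c\<close> count.\<close>

lemma coeff_cycle_poly:
  assumes "\<And>c. c \<in> set cs \<Longrightarrow> m \<le> c" "j < 2 * m"
  shows "coeff (cycle_poly cs) j = (if j = 0 then 1 else 0) + 2 * real (count_list cs j)"
  using assms
proof (induction cs arbitrary: j)
  case Nil
  then show ?case by (simp add: cycle_poly_def coeff_1)
next
  case (Cons c cs)
  have "cycle_poly (c # cs) = cycle_poly cs + monom 2 c * cycle_poly cs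
      + monom ((- 1) ^ c) (2 * c) * cycle_poly cs"
    by (simp add: cycle_poly_def algebra_simps)
  moreover have "coeff (cycle_poly cs) j = (if j = 0 then 1 else 0) + 2 * real (count_list cs j)"
    using Cons by auto
  moreover have "coeff (monom ((- 1) ^ c) (2 * c) * cycle_poly cs) j = 0"
    using Cons.prems(1)[of c] Cons.prems(2) by (simp add: coeff_monom_mult)
  moreover have "coeff (monom 2 c * cycle_poly cs) j = (if j = c then 2 else 0)"
  proof (cases "c \<le> j")
    case True
    have c: "m \<le> c" using Cons.prems by auto
    have "coeff (cycle_poly cs) (j - c) = (if j - c = 0 then 1 else 0) + 2 * real (count_list cs (j - c))"
      using Cons by auto
    moreover have "j - c \<notin> set cs" using Cons.prems c by fastforce
    then have "count_list cs (j - c) = 0" by simp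
    ultimately show ?thesis using True by (auto simp: coeff_monom_mult)
  qed (auto simp: coeff_monom_mult)
  moreover have "j = c \<Longrightarrow> j \<noteq> 0" using Cons.prems(1)[of c] Cons.prems(2) by auto
  ultimately show ?case by auto
qed

text \<open>At 1 an odd cycle has the factor 2 and an even cycle the factor 4.\<close>

lemma cycle_poly_at_1:
  "cs = [] \<or> poly (cycle_poly cs) 1 = 2 \<or> poly (cycle_poly cs) 1 \<ge> 4"
proof (induction cs)
  case (Cons c cs)
  have f: "1 + 2 * 1 ^ c + (- ((1 :: real)\<^sup>2)) ^ c \<in> {2, 4}"
    by (cases "even c") auto
  have "poly (cycle_poly (c # cs)) 1 = (1 + 2 * 1 ^ c + (- ((1 :: real)\<^sup>2)) ^ c) * poly (cycle_poly cs) 1"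
    unfolding poly_cycle_poly by simp
  moreover have "poly (cycle_poly []) 1 = 1" by (simp add: cycle_poly_def)
  ultimately show ?case using f Cons.IH by (cases "even c") auto
qed simp

text \<open>Apart from the constant coefficient, \<open>q\<close> starts at degree \<open>c\<close>,
  and it is nonnegative below \<open>2 * c\<close>. Of the nonnegative products in the convolution
  only the one with \<open>coeff q c\<close> is kept.\<close>

lemma coeff_mult_ge:
  fixes p q :: "real poly"
  assumes "coeff q 0 = 1" "\<And>j. 0 < j \<Longrightarrow> j < c \<Longrightarrow> coeff q j = 0"
    and "\<And>j. j < 2 * c \<Longrightarrow> coeff q j \<ge> 0" "\<And>i. i \<le> k \<Longrightarrow> coeff p i \<ge> 0" "k < c"
  shows "coeff (p * q) (c + k) \<ge> coeff p (c + k) + coeff p k * coeff q c"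
proof -
  have "coeff (p * q) (c + k) = (\<Sum>i\<le>c + k. coeff p i * coeff q (c + k - i))"
    by (rule coeff_mult)
  also have "\<dots> = (\<Sum>i\<in>insert (c + k) {..k}. coeff p i * coeff q (c + k - i))"
    using assms(2,5) by (intro sum.mono_neutral_right) auto
  also have "\<dots> = coeff p (c + k) + (\<Sum>i\<le>k. coeff p i * coeff q (c + k - i))"
    using assms(1,5) by (subst sum.insert) auto
  finally have "coeff (p * q) (c + k) = coeff p (c + k) + (\<Sum>i\<le>k. coeff p i * coeff q (c + k - i))" .
  moreover have "coeff p k * coeff q (c + k - k) \<le> (\<Sum>i\<le>k. coeff p i * coeff q (c + k - i))"
    using assms(3,4,5) by (intro member_le_sum) auto
  ultimately show ?thesis by simp
qed

section \<open>First deviations from the constant part\<close>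

lemmas theta_coeff_simps = theta_poly_def square_terms_def path_terms_def Let_def coeff_monom

lemma minus_one_power_cases: "(- 1) ^ k = (1 :: real) \<or> (- 1) ^ k = (- 1 :: real)"
  by (cases "even k") auto

text \<open>The lowest exponents outside the constant part are \<open>2 * a + 2\<close>, from the
  shortest path, and \<open>a + b\<close>, from the cycle through the two shortest paths.\<close>

lemma theta_coeff_below:
  assumes "1 \<le> a" "a \<le> b" "b \<le> c" "2 \<le> b" "n < 2 * a + 2" "n < a + b"
  shows "coeff (theta_poly a b c) n = coeff const_poly n"
  using assms by (simp add: theta_coeff_simps)

lemma theta_coeff_far:
  assumes "1 \<le> a" "a + 2 \<le> b" "b \<le> c"
  shows "coeff (theta_poly a b c) (2 * a + 2) - coeff const_poly (2 * a + 2) \<in> {- 1, 1, 3, 5}"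
proof -
  have "coeff (theta_poly a b c) (2 * a + 2) - coeff const_poly (2 * a + 2) =
      - ((- 1) ^ a) + (if b = a + 2 then 2 else 0) + (if c = a + 2 then 2 else 0)"
    using assms by (simp add: theta_coeff_simps)
  then show ?thesis using minus_one_power_cases[of a] assms by auto
qed

lemma theta_coeff_near:
  assumes "1 \<le> a" "a \<le> b" "b \<le> c" "2 \<le> b" "b \<le> a + 1"
  shows "coeff (theta_poly a b c) (a + b) - coeff const_poly (a + b) =
    2 + (if c = b then 2 else 0) + (if c = a then 2 else 0)"
  using assms by (auto simp: theta_coeff_simps)

text \<open>The shortest path contributes 1 or -1 at its first exponent, every cycle contributes 2
  at its own. The parity of the first deviation thus shows whether the shortest path takes part in
  it; the set lists the odd values that occur.\<close>

lemma theta_coeff_parity: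
  assumes "1 \<le> a" "a \<le> b" "b \<le> c" "2 \<le> b"
  defines "f \<equiv> \<lambda>n. coeff (theta_poly a b c) n - coeff const_poly n"
    and "m \<equiv> if a + 2 \<le> b then 2 * a + 2 else a + b"
  shows "f m \<in> {- 1, 1, 3, 5} \<longleftrightarrow> a + 2 \<le> b" "f m \<noteq> 0"
proof -
  have "(f m \<in> {- 1, 1, 3, 5} \<longleftrightarrow> a + 2 \<le> b) \<and> f m \<noteq> 0"
  proof (cases "a + 2 \<le> b")
    case True
    then have "f m \<in> {- 1, 1, 3, 5}"
      using theta_coeff_far[OF assms(1) True assms(3)] by (simp only: f_def m_def if_True)
    then show ?thesis using True by auto
  next
    case False
    then have "f m = 2 + (if c = b then 2 else 0) + (if c = a then 2 else 0)"
      using theta_coeff_near[OF assms(1-4)] by (simp add: f_def m_def)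
    then have "f m = 2 \<or> f m = 4 \<or> f m = 6" by (simp split: if_splits)
    then show ?thesis using False by auto
  qed
  then show "f m \<in> {- 1, 1, 3, 5} \<longleftrightarrow> a + 2 \<le> b" "f m \<noteq> 0" by blast+
qed

text \<open>After the contribution of the shortest path is removed, the next deviation is the
  positive one of the cycle through the two shortest paths. It reveals \<open>a + b\<close>.\<close>

lemma theta_coeff_far_second:
  assumes "1 \<le> a" "a + 2 \<le> b" "b \<le> c"
  shows "n < a + b \<Longrightarrow> coeff (theta_poly a b c) n =
      coeff const_poly n - coeff (square_terms ((- 1) ^ a) (2 * a + 2)) n"
    and "coeff (theta_poly a b c) (a + b) =
      coeff const_poly (a + b) - coeff (square_terms ((- 1) ^ a) (2 * a + 2)) (a + b)
        + 2 + (if c = b then 2 else 0)"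
  using assms by (simp_all add: theta_coeff_simps)

text \<open>If \<open>a\<close> and \<open>b\<close> differ by at least 2, the first deviation gives
  \<open>a\<close> and the second one \<open>a + b\<close>. Otherwise only \<open>a + b\<close> is
  obtained, but this determines both because they differ by at most 1. Parity tells the two
  situations apart, and \<open>c\<close> follows from the total.\<close>

lemma theta_poly_inject_sorted:
  assumes "1 \<le> a" "a \<le> b" "b \<le> c" "2 \<le> b" and "1 \<le> a'" "a' \<le> b'" "b' \<le> c'" "2 \<le> b'"
    and eq: "theta_poly a b c = theta_poly a' b' c'" and s: "a + b + c = a' + b' + c'"
  shows "a = a' \<and> b = b' \<and> c = c'"
proof -
  define f where "f n = coeff (theta_poly a b c) n - coeff const_poly n" for n
  have f': "f n = coeff (theta_poly a' b' c') n - coeff const_poly n" for n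
    by (simp add: f_def eq)
  define m where "m a b = (if a + 2 \<le> b then 2 * a + 2 else a + b)" for a b :: nat
  have m: "f n = 0" if "n < m a b" for n
    using theta_coeff_below[OF assms(1-4), of n] that by (simp add: f_def m_def split: if_splits)
  have m': "f n = 0" if "n < m a' b'" for n
    using theta_coeff_below[OF assms(5-8), of n] that by (simp add: f' m_def split: if_splits)
  have odd: "f (m a b) \<in> {- 1, 1, 3, 5} \<longleftrightarrow> a + 2 \<le> b" "f (m a b) \<noteq> 0"
    unfolding f_def m_def by (rule theta_coeff_parity[OF assms(1-4)])+
  have odd': "f (m a' b') \<in> {- 1, 1, 3, 5} \<longleftrightarrow> a' + 2 \<le> b'" "f (m a' b') \<noteq> 0"
    unfolding f' m_def by (rule theta_coeff_parity[OF assms(5-8)])+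
  have mm: "m a b = m a' b'"
    using m[of "m a' b'"] m'[of "m a b"] odd(2) odd'(2) by linarith
  then have far: "a + 2 \<le> b \<longleftrightarrow> a' + 2 \<le> b'" using odd(1) odd'(1) by simp
  show ?thesis
  proof (cases "a + 2 \<le> b")
    case True
    then have t': "a' + 2 \<le> b'" using far by simp
    then have aa: "a' = a" using True mm by (simp add: m_def)
    define h where "h n = f n + coeff (square_terms ((- 1) ^ a) (2 * a + 2)) n" for n
    have h: "h n = 0" if "n < a + b" for n
      using theta_coeff_far_second(1)[OF assms(1) True assms(3) that] by (simp add: h_def f_def)
    have h': "h n = 0" if "n < a' + b'" for n
      using theta_coeff_far_second(1)[OF assms(5) t' assms(7) that] by (simp add: h_def f' aa)
    have "h (a + b) \<noteq> 0"
      using theta_coeff_far_second(2)[OF assms(1) True assms(3)] by (simp add: h_def f_def)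
    moreover have "h (a' + b') \<noteq> 0"
      using theta_coeff_far_second(2)[OF assms(5) t' assms(7)] by (simp add: h_def f' aa)
    ultimately have "a + b = a' + b'" using h[of "a' + b'"] h'[of "a + b"] by linarith
    then show ?thesis using aa s by simp
  next
    case False
    then have ab: "a + b = a' + b'" using far mm by (simp add: m_def)
    have "b = a \<or> b = a + 1" "b' = a' \<or> b' = a' + 1" using False far assms(2,6) by linarith+
    then show ?thesis using ab s by presburger
  qed
qed

lemma sort3:
  fixes a b c :: nat
  obtains x y z where "mset [a, b, c] = mset [x, y, z]" "x \<le> y" "y \<le> z"
proof -
  have L: "length (sort [a, b, c]) = Suc (Suc (Suc 0))"
    by (simp only: length_sort list.size add_Suc_right add_0_right One_nat_def)
  then obtain x y z where xyz: "sort [a, b, c] = [x, y, z]"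
    unfolding length_Suc_conv length_0_conv by blast
  have "mset [x, y, z] = mset [a, b, c]" "sorted [x, y, z]"
    unfolding xyz[symmetric] by (rule mset_sort, rule sorted_sort)
  then show ?thesis by (intro that[of x y z]) auto
qed

lemma mset3_cases:
  assumes "mset [a, b, c] = mset [x, y, z]"
  shows "(x, y, z) = (a, b, c) \<or> (x, y, z) = (b, a, c) \<or> (x, y, z) = (a, c, b) \<or>
    (x, y, z) = (b, c, a) \<or> (x, y, z) = (c, a, b) \<or> (x, y, z) = (c, b, a)"
  using assms by (auto simp: add_eq_conv_ex)

lemma symmetric3:
  assumes 1: "\<And>a b c. f a b c = f b a c" and 2: "\<And>a b c. f a b c = f a c b"
    and m: "mset [a, b, c] = mset [x, y, z]"
  shows "f a b c = f x y z"
proof -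
  note mset3_cases[OF m]
  moreover note 1[of a b c] 2[of a b c] 2[of b a c] 1[of a c b] 2[of c a b]
  ultimately show ?thesis by (elim disjE) (simp_all only: prod.inject)
qed

lemma theta_poly_mset:
  assumes "mset [a, b, c] = mset [x, y, z]"
  shows "theta_poly a b c = theta_poly x y z"
proof (rule symmetric3[where f = theta_poly, OF _ _ assms])
  show "theta_poly a b c = theta_poly b a c" "theta_poly a b c = theta_poly a c b" for a b c
    by (rule poly_ext, simp add: poly_theta_poly theta_fun_def algebra_simps)+
qed

lemma theta_poly_inject:
  assumes "theta_poly a b c = theta_poly a' b' c'" "a + b + c = a' + b' + c'"
    and "1 \<le> a" "2 \<le> b" "2 \<le> c" "1 \<le> a'" "2 \<le> b'" "2 \<le> c'"
  shows "mset [a, b, c] = mset [a', b', c']"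
proof -
  obtain x y z where x: "mset [a, b, c] = mset [x, y, z]" "x \<le> y" "y \<le> z" by (rule sort3)
  obtain x' y' z' where x': "mset [a', b', c'] = mset [x', y', z']" "x' \<le> y'" "y' \<le> z'" by (rule sort3)
  have "x = x' \<and> y = y' \<and> z = z'"
  proof (rule theta_poly_inject_sorted)
    show "theta_poly x y z = theta_poly x' y' z'"
      using theta_poly_mset[OF x(1)] theta_poly_mset[OF x'(1)] assms(1) by simp
    have "sum_mset (mset [a, b, c]) = sum_mset (mset [x, y, z])"
      "sum_mset (mset [a', b', c']) = sum_mset (mset [x', y', z'])" using x x' by simp_all
    then show "x + y + z = x' + y' + z'" using assms(2) by simp
    show "1 \<le> x" "2 \<le> y" "1 \<le> x'" "2 \<le> y'"
      using mset3_cases[OF x(1)] mset3_cases[OF x'(1)] x(2,3) x'(2,3) assms(3-) by auto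
  qed (use x x' in auto)
  then show ?thesis using x x' by simp
qed

lemmas dumbbell_coeff_simps = dumbbell_main_def square_terms_def Let_def coeff_monom

text \<open>An end cycle contributes 2 at its length, the connecting path 1 or -1 at
  \<open>2 * l + 2\<close>. Parity again shows whether the path takes part in the first
  deviation.\<close>

lemma dumbbell_coeff_parity:
  assumes "3 \<le> g" "g \<le> h" "1 \<le> l"
  defines "f \<equiv> \<lambda>n. coeff (dumbbell_main l g h) n - coeff const_poly n"
    and "m \<equiv> min g (2 * l + 2)"
  shows "f m \<in> {- 1, 1, 3, 5} \<longleftrightarrow> 2 * l + 2 \<le> g" "f m \<noteq> 0" "n < m \<Longrightarrow> f n = 0"
proof -
  consider "2 * l + 2 < g" | "2 * l + 2 = g" | "g < 2 * l + 2" by linarith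
  then have "(f m \<in> {- 1, 1, 3, 5} \<longleftrightarrow> 2 * l + 2 \<le> g) \<and> f m \<noteq> 0"
  proof cases
    case 1
    then have "f m = - ((- 1) ^ l)"
      using assms(1-3) by (simp add: f_def m_def dumbbell_coeff_simps min_def)
    then show ?thesis using 1 minus_one_power_cases[of l] by auto
  next
    case 2
    then have "f m = 2 + (if h = g then 2 else 0) - (- 1) ^ l"
      using assms(1-3) by (simp add: f_def m_def dumbbell_coeff_simps min_def)
    then have "f m = 1 \<or> f m = 3 \<or> f m = 5" using minus_one_power_cases[of l] by (auto split: if_splits)
    then show ?thesis using 2 by auto
  next
    case 3
    then have "f m = 2 + (if h = g then 2 else 0)"
      using assms(1-3) by (simp add: f_def m_def dumbbell_coeff_simps min_def)
    then have "f m = 2 \<or> f m = 4" by (auto split: if_splits)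
    then show ?thesis using 3 by auto
  qed
  then show "f m \<in> {- 1, 1, 3, 5} \<longleftrightarrow> 2 * l + 2 \<le> g" "f m \<noteq> 0" by blast+
  show "f n = 0" if "n < m"
    using that assms(1-3) by (simp add: f_def m_def dumbbell_coeff_simps)
qed

text \<open>A cycle of the theta graph enters as \<open>2 * x^n * (1 + x^2)^2\<close>, an end cycle
  of the dumbbell as \<open>2 * x^g * (1 + x^2) * (1 + x + 2 * x^2)\<close>. Once their first
  exponents are matched, the coefficient one degree higher tells them apart.\<close>

lemma theta_neq_dumbbell_sorted:
  assumes a: "1 \<le> a" "a \<le> b" "b \<le> c" "2 \<le> b" and g: "3 \<le> g" "g \<le> h" "1 \<le> l"
    and s: "a + b + c = l + g + h"
    and eq: "\<And>n. n \<le> g + 2 \<Longrightarrow> coeff (theta_poly a b c) n = coeff (dumbbell_main l g h) n"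
  shows False
proof -
  define f where "f n = coeff (theta_poly a b c) n - coeff const_poly n" for n
  have f': "f n = coeff (dumbbell_main l g h) n - coeff const_poly n" if "n \<le> g + 2" for n
    using eq[OF that] by (simp add: f_def)
  define m where "m = (if a + 2 \<le> b then 2 * a + 2 else a + b)"
  define m' where "m' = min g (2 * l + 2)"
  have m'g: "m' \<le> g + 2" by (simp add: m'_def)
  have m: "n < m \<Longrightarrow> f n = 0" for n
    using theta_coeff_below[OF a, of n] by (simp add: f_def m_def split: if_splits)
  have m': "n < m' \<Longrightarrow> f n = 0" for n
    using dumbbell_coeff_parity(3)[OF g, of n] f'[of n] m'g by (auto simp: m'_def)
  have odd: "f m \<in> {- 1, 1, 3, 5} \<longleftrightarrow> a + 2 \<le> b" "f m \<noteq> 0"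
    unfolding f_def m_def by (rule theta_coeff_parity[OF a])+
  have odd': "f m' \<in> {- 1, 1, 3, 5} \<longleftrightarrow> 2 * l + 2 \<le> g" "f m' \<noteq> 0"
    unfolding f'[OF m'g] by (rule dumbbell_coeff_parity(1,2)[OF g, folded m'_def])+
  have mm: "m = m'"
    using m[of m'] m'[of m] odd(2) odd'(2) by linarith
  then have far: "a + 2 \<le> b \<longleftrightarrow> 2 * l + 2 \<le> g" using odd(1) odd'(1) by simp
  show False
  proof (cases "a + 2 \<le> b")
    case True
    then have l: "l = a" and g': "2 * l + 2 \<le> g" using far mm by (auto simp: m_def m'_def)
    define k where "k n = f n + coeff (square_terms ((- 1) ^ a) (2 * a + 2)) n" for n
    have k': "k n = coeff (dumbbell_main l g h) n - coeff const_poly n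
        + coeff (square_terms ((- 1) ^ a) (2 * a + 2)) n" if "n \<le> g + 2" for n
      using f'[OF that] by (simp add: k_def)
    have k1: "k n = 0" if "n < a + b" for n
      using theta_coeff_far_second(1)[OF a(1) True a(3) that] by (simp add: k_def f_def)
    have k1': "k (a + b) \<noteq> 0"
      using theta_coeff_far_second(2)[OF a(1) True a(3)] by (simp add: k_def f_def)
    have k2: "k n = 0" if "n < g" for n
      using that g by (simp add: k' dumbbell_main_def Let_def coeff_monom l)
    have k3: "k g \<noteq> 0" "k (g + 1) \<noteq> 0"
      using g by (simp_all add: k' dumbbell_main_def Let_def coeff_monom l)
    have ab: "a + b = g" using k1[of g] k2[of "a + b"] k1' k3(1) by linarith
    \<comment> \<open>With \<open>l = a\<close> and \<open>g = a + b\<close> the totals give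
      \<open>c = a + h\<close>. The other cycles of the theta graph are then too long to reach the
      exponent \<open>g + 1\<close>.\<close>
    then have "c \<ge> b + 2" using s l g a by linarith
    then have "coeff (theta_poly a b c) (a + b + 1) =
      coeff const_poly (a + b + 1) - coeff (square_terms ((- 1) ^ a) (2 * a + 2)) (a + b + 1)"
      using a True by (simp add: theta_coeff_simps)
    then have "k (g + 1) = 0" by (simp add: k_def f_def ab)
    then show False using k3 by simp
  next
    case False
    then have gl: "g < 2 * l + 2" and ab: "g = a + b" using far mm by (auto simp: m_def m'_def)
    consider "b = a + 1" | "b = a" using False a by linarith
    then show False
    proof cases
      case 1
      have t: "f (g + 1) = - ((- 1) ^ a) + (if c = a + 2 then 2 else 0) + (if c = a + 1 then 2 else 0)"
        using a 1 ab by (simp add: f_def theta_coeff_simps)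
      have d: "f (g + 1) = 2 + (if h = g then 2 else 0) + (if h = g + 1 then 2 else 0)
          - (if l = a then (- 1) ^ l else 0)"
        using g 1 ab gl by (subst f') (auto simp: dumbbell_coeff_simps)
      \<comment> \<open>The value in \<open>t\<close> is odd, so the one in \<open>d\<close> must
        contain the contribution of the connecting path.\<close>
      have "l = a"
        using t d minus_one_power_cases[of a] by (auto split: if_splits)
      moreover from this have "c \<noteq> a + 2" "c \<noteq> a + 1" using s g a ab 1 by linarith+
      ultimately show False using t d by (auto split: if_splits)
    next
      case 2
      have "f g = 2 + (if c = a then 4 else 0)"
        unfolding f_def theta_coeff_simps coeff_add coeff_diff using a 2 ab by simp
      moreover have "f g = 2 + (if h = g then 2 else 0)"
        using g gl by (subst f') (auto simp: dumbbell_coeff_simps)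
      \<comment> \<open>The theta graph gives 2 or 6 and the dumbbell 2 or 4, so both values are
        2.\<close>
      ultimately have ca: "c \<noteq> a" "h \<noteq> g" by (auto split: if_splits)
      have "f (g + 1) = (if c = a + 1 then 4 else 0)"
        unfolding f_def theta_coeff_simps coeff_add coeff_diff using a 2 ab ca by simp
      moreover have "f (g + 1) = 2 + (if h = g + 1 then 2 else 0)"
        using g gl ca 2 ab by (subst f') (auto simp: dumbbell_coeff_simps, presburger+)
      \<comment> \<open>Here 0 or 4 has to equal 2 or 4. Both are 4, and the lengths obtained make
        the total of the dumbbell too large.\<close>
      ultimately have "c = a + 1" "h = g + 1" by (auto split: if_splits)
      then show False using s 2 ab g by linarith
    qed
  qed
qed

section \<open>Odd coefficients when all lengths are even\<close>

lemma coeff_square_terms_odd: "coeff (square_terms s (2 * m)) (2 * k + 1) = (if k = m then 2 * s else 0)"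
proof -
  have "2 * m \<noteq> 2 * k + 1" "2 * m + 2 \<noteq> 2 * k + 1" by presburger+
  then show ?thesis by (simp add: square_terms_def coeff_monom)
qed

lemma coeff_path_terms_odd: "even n \<Longrightarrow> coeff (path_terms s n) (2 * k + 1) = 0"
proof -
  assume "even n"
  then have "n \<noteq> 2 * k + 1" "n + 2 \<noteq> 2 * k + 1" "n + 4 \<noteq> 2 * k + 1" by presburger+
  then show ?thesis by (simp add: path_terms_def coeff_monom)
qed

lemma coeff_const_poly_ge_5: "n \<ge> 5 \<Longrightarrow> coeff const_poly n = 0"
  by (rule coeff_eq_0) (simp add: const_poly_def)

text \<open>For even lengths all signs are 1 and the terms of cycles have even exponents. Odd
  exponents come only from the mixed terms of the remaining squares; the positive ones stem from the
  last block, and \<open>k \<ge> 2\<close> lies beyond the constant part.\<close>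

lemma theta_coeff_even:
  assumes "even a" "even b" "even c" "k \<ge> 2"
  shows "coeff (theta_poly a b c) (2 * k + 1) =
    - 2 * (of_bool (k = a + 1) + of_bool (k = b + 1) + of_bool (k = c + 1)
        + of_bool (k = a + b) + of_bool (k = a + c) + of_bool (k = b + c))
    + 4 * of_bool (k = a + b + c) + 2 * of_bool (k = a + b + c + 1)"
proof -
  have sq: "coeff (square_terms s (2 * a + 2)) (2 * k + 1) = (if k = a + 1 then 2 * s else 0)" for s a
    using coeff_square_terms_odd[of s "a + 1" k] by simp
  have "2 * j \<noteq> 2 * k + 1" "2 * j + 2 \<noteq> 2 * k + 1" "2 * j + 4 \<noteq> 2 * k + 1"
    "2 * j + 1 = 2 * k + 1 \<longleftrightarrow> k = j" "2 * j + 3 = 2 * k + 1 \<longleftrightarrow> k = j + 1" for j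
    by presburger+
  note cm = coeff_monom this if_False
  have s: "(- 1 :: real) ^ (a + b) = 1" "(- 1 :: real) ^ (a + c) = 1" "(- 1 :: real) ^ (b + c) = 1"
    "(- 1 :: real) ^ a = 1" "(- 1 :: real) ^ b = 1" "(- 1 :: real) ^ c = 1" "(- 1 :: real) ^ (a + b + c) = 1"
    using assms by auto
  have c0: "coeff const_poly (2 * k + 1) = 0" using assms by (intro coeff_const_poly_ge_5) simp
  have ev: "even (a + b)" "even (a + c)" "even (b + c)" "even (2 * a + b + c)" "even (a + 2 * b + c)"
    "even (a + b + 2 * c)" using assms by auto
  have "coeff (theta_poly a b c) (2 * k + 1) =
    0 - ((if k = a + 1 then 2 * 1 else 0) + (if k = b + 1 then 2 * 1 else 0) + (if k = c + 1 then 2 * 1 else 0))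
    + ((0 - (if k = a + b then 2 * 1 else 0) + 0) + (0 - (if k = a + c then 2 * 1 else 0) + 0)
        + (0 - (if k = b + c then 2 * 1 else 0) + 0))
    + (0 + 0 + 0) - (0 + 0 + 0)
    - (0 - (if k = a + b + c then 4 * 1 else 0) + 0 - (if k = a + b + c + 1 then 2 * 1 else 0) + 0)"
    unfolding theta_poly_def Let_def s
    by (simp only: coeff_add coeff_diff c0 sq cm coeff_path_terms_odd[OF ev(1)] coeff_path_terms_odd[OF ev(2)]
        coeff_path_terms_odd[OF ev(3)] coeff_path_terms_odd[OF ev(4)] coeff_path_terms_odd[OF ev(5)]
        coeff_path_terms_odd[OF ev(6)])
  moreover have "(if P then x * 1 else 0) = x * of_bool P" for P and x :: real by simp
  ultimately show ?thesis by (simp only:) (simp only: algebra_simps)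
qed

text \<open>The indicators for \<open>a + 1\<close>, \<open>b + 1\<close>, \<open>c + 1\<close> need
  an odd \<open>k\<close>, those for sums of two lengths an even one. At most three of the six are
  active, which gives -6 instead of -12.\<close>

lemma theta_coeff_even_bounds:
  assumes "even a" "even b" "even c" "2 \<le> k"
  shows "coeff (theta_poly a b c) (2 * k + 1) \<ge> - 6"
    and "k < a + b + c \<Longrightarrow> coeff (theta_poly a b c) (2 * k + 1) \<le> 0"
proof -
  have of_bool: "0 \<le> (of_bool P :: real)" "(of_bool P :: real) \<le> 1" for P by auto
  have bound: "- 6 \<le> - 2 * (x + y + t) + 4 * u + 2 * v"
    if "x \<le> 1" "y \<le> 1" "t \<le> 1" "0 \<le> u" "0 \<le> v" for x y t u v :: real
  proof -
    have "x + y + t \<le> 3" "0 \<le> 4 * u + 2 * v" using that by simp_all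
    then show ?thesis by argo
  qed
  show "coeff (theta_poly a b c) (2 * k + 1) \<ge> - 6"
  proof (cases "even k")
    case True
    then have z: "(k = a + 1) = False" "(k = b + 1) = False" "(k = c + 1) = False" using assms by auto
    show ?thesis unfolding theta_coeff_even[OF assms] z of_bool_eq add_0_left
      by (rule bound; rule of_bool)
  next
    case False
    then have z: "(k = a + b) = False" "(k = a + c) = False" "(k = b + c) = False" using assms by auto
    show ?thesis unfolding theta_coeff_even[OF assms] z of_bool_eq add_0_right
      by (rule bound; rule of_bool)
  qed
  assume "k < a + b + c"
  then have z: "(k = a + b + c) = False" "(k = a + b + c + 1) = False" by auto
  show "coeff (theta_poly a b c) (2 * k + 1) \<le> 0"
    unfolding theta_coeff_even[OF assms] z of_bool_eq mult_zero_right add_0_right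
    by (intro mult_nonpos_nonneg add_nonneg_nonneg of_bool) simp
qed

text \<open>All powers at 1 are 1 or -1, so only the parities of the lengths matter and eight cases
  remain.\<close>

lemma theta_at_1:
  "poly (theta_poly a b c) 1 \<in> {0, 32, 48, 80}"
  "poly (theta_poly a b c) 1 = 0 \<longleftrightarrow> even a \<and> even b \<and> even c"
  by (cases "even a"; cases "even b"; cases "even c"; simp add: poly_theta_poly theta_fun_def)+

lemma dumbbell_at_1:
  "dumbbell_fun 1 l g h \<in> {0, 32, 48, 80, 96, 128}"
  "dumbbell_fun 1 l g h = 0 \<longleftrightarrow> even l \<and> even g \<and> even h"
  by (cases "even l"; cases "even g"; cases "even h";
      simp add: dumbbell_fun_def dumbbell_end_def dumbbell_end'_def)+

text \<open>Twice a nonzero value of the second set is never in the first set, and four times the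
  least one, 32, already exceeds 80. Equality is possible only at 0.\<close>

lemma theta_at_1_mult_cycles:
  assumes "t = t' * poly (cycle_poly cs) 1" "cs \<noteq> []"
    and "t \<in> {0, 32, 48, 80}" "t' \<in> {0, 32, 48, 80, 96, 128}"
  shows "t = 0 \<and> t' = 0"
proof -
  have K: "poly (cycle_poly cs) 1 = 2 \<or> poly (cycle_poly cs) 1 \<ge> 4"
    using cycle_poly_at_1[of cs] assms(2) by simp
  have "t' = 0"
  proof (rule ccontr)
    assume "t' \<noteq> 0"
    then have "t' \<ge> 32" using assms(4) by auto
    show False
    proof (cases "poly (cycle_poly cs) 1 = 2")
      case True
      then show False using assms \<open>t' \<noteq> 0\<close> by auto
    next
      case False
      then have "32 * 4 \<le> t' * poly (cycle_poly cs) 1"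
        using \<open>t' \<ge> 32\<close> K by (intro mult_mono) auto
      then show False using assms(1,3) by auto
    qed
  qed
  then show ?thesis using assms(1) by simp
qed

text \<open>The gain comes from multiplying \<open>coeff p k\<close> by the terms
  \<open>2 * x^m\<close> of the cycles of length \<open>m\<close>. The bound \<open>m\<close> may
  lie below all cycle lengths, as happens for a dumbbell with a shorter end cycle; then nothing is
  gained.\<close>

lemma cycle_poly_factor:
  assumes "cs \<noteq> [] \<Longrightarrow> m \<le> Min (set cs)" "0 < m" "k < m"
    and "\<And>i. i \<le> k \<Longrightarrow> coeff p i \<ge> 0"
  shows "coeff (p * cycle_poly cs) (m + k) \<ge> coeff p (m + k) + coeff p k * (2 * real (count_list cs m))"
proof -
  have le: "m \<le> c" if "c \<in> set cs" for c
  proof -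
    have "cs \<noteq> []" using that by auto
    then have "m \<le> Min (set cs)" by (rule assms(1))
    also have "\<dots> \<le> c" using that by (intro Min_le) auto
    finally show ?thesis .
  qed
  have K: "coeff (cycle_poly cs) j = (if j = 0 then 1 else 0) + 2 * real (count_list cs j)" if "j < 2 * m" for j
    using le that by (rule coeff_cycle_poly)
  have z: "count_list cs j = 0" if "j < m" for j
    using le[of j] that by (auto simp: count_list_0_iff)
  have "coeff (p * cycle_poly cs) (m + k) \<ge> coeff p (m + k) + coeff p k * coeff (cycle_poly cs) m"
    using assms(2-4) z by (intro coeff_mult_ge) (auto simp: K)
  then show ?thesis using assms(2) by (simp add: K)
qed

lemma const_poly_coeffs:
  "coeff const_poly 0 = 1" "coeff const_poly 1 = 2" "coeff const_poly 2 = 5" "coeff const_poly 3 = 4"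
  by (simp_all add: const_poly_def numeral_2_eq_2 numeral_3_eq_3)

text \<open>The value at 1 forces all path lengths on both sides to be even. A shortest disjoint
  cycle then raises some odd coefficient by at least 8, which outweighs the lower bound -6, although
  that coefficient is nonpositive on the left.\<close>

lemma theta_mult_cycles:
  assumes eq: "theta_poly a b c = theta_poly a' b' c' * cycle_poly cs"
    and s: "a + b + c = a' + b' + c' + sum_list cs"
    and pos: "1 \<le> a'" "1 \<le> b'" "1 \<le> c'" and cs: "\<And>k. k \<in> set cs \<Longrightarrow> 3 \<le> k"
  shows "cs = []"
proof (rule ccontr)
  assume ne: "cs \<noteq> []"
  have "poly (theta_poly a b c) 1 = 0 \<and> poly (theta_poly a' b' c') 1 = 0"
    using theta_at_1(1)[of a b c] theta_at_1(1)[of a' b' c'] ne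
    by (intro theta_at_1_mult_cycles[of _ _ cs]) (auto simp: eq)
  then have ev: "even a" "even b" "even c" "even a'" "even b'" "even c'" by (simp_all add: theta_at_1)
  then have ge: "2 \<le> a'" "2 \<le> b'" "2 \<le> c'" using pos by (auto elim!: evenE)
  define m where "m = Min (set cs)"
  have m: "m \<in> set cs" "3 \<le> m" using ne cs by (auto simp: m_def)
  have cm: "count_list cs m \<ge> 1" using m(1) by (metis One_nat_def Suc_leI count_list_0_iff neq0_conv)
  have ms: "m \<le> sum_list cs" using m(1) by (intro member_le_sum_list) auto
  \<comment> \<open>The index \<open>m + k\<close> has to be odd and \<open>k < m\<close>. The
    constant part has coefficient 5 at 2 and 4 at 3; its 2 at 1 would raise the coefficient by 4
    only, which does not outweigh 6.\<close>
  define k where "k = (if odd m then 2 else 3 :: nat)"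
  have k: "k < m" using m by (auto simp: k_def elim: evenE) presburger
  have "odd (m + k)" by (simp add: k_def)
  then obtain j where j: "m + k = 2 * j + 1" by (rule oddE)
  \<comment> \<open>The total length bounds \<open>m\<close>, so the index stays below the positive
    terms at \<open>a + b + c\<close>.\<close>
  have j2: "2 \<le> j" "j < a + b + c" using j m k s ms ge by (auto simp: k_def split: if_splits)
  have low: "coeff (theta_poly a' b' c') i = coeff const_poly i" if "i \<le> 3" for i
    using ge that by (simp add: theta_coeff_simps)
  have ck: "coeff (theta_poly a' b' c') k \<ge> 4"
    using low[of 2] low[of 3] by (simp add: k_def const_poly_coeffs)
  have "0 \<le> coeff (theta_poly a' b' c') i" if "i \<le> k" for i
  proof -
    have "i = 0 \<or> i = 1 \<or> i = 2 \<or> i = 3" using that by (auto simp: k_def split: if_splits)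
    then show ?thesis using low[of i] by (auto simp: const_poly_coeffs simp del: One_nat_def)
  qed
  then have "coeff (theta_poly a b c) (m + k) \<ge> coeff (theta_poly a' b' c') (m + k)
      + coeff (theta_poly a' b' c') k * (2 * real (count_list cs m))"
    unfolding eq using m k by (intro cycle_poly_factor) (auto simp: m_def)
  moreover have "coeff (theta_poly a' b' c') k * (2 * real (count_list cs m)) \<ge> 4 * (2 * 1)"
    using ck cm by (intro mult_mono) auto
  moreover have "coeff (theta_poly a' b' c') (m + k) \<ge> - 6"
    unfolding j using ev j2 by (intro theta_coeff_even_bounds) auto
  moreover have "coeff (theta_poly a b c) (m + k) \<le> 0"
    unfolding j using ev j2 by (intro theta_coeff_even_bounds) auto
  ultimately show False by simp
qed

lemma dumbbell_low_coeffs: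
  assumes "4 \<le> g" "g \<le> h" "2 \<le> l" "i \<le> 3"
  shows "coeff (dumbbell_main l g h) i = coeff const_poly i"
  using assms by (simp add: dumbbell_coeff_simps)

text \<open>End cycles contribute positively at odd exponents; the only negative contribution is
  that of the connecting path, at \<open>2 * l + 3\<close>.\<close>

lemma dumbbell_coeff_even:
  assumes "even g" "even h" "even l" "2 \<le> k"
  shows "coeff (dumbbell_main l g h) (2 * k + 1) =
    2 * (of_bool (g = 2 * k) + of_bool (g + 2 = 2 * k) + of_bool (h = 2 * k) + of_bool (h + 2 = 2 * k))
    - 2 * of_bool (k = l + 1)"
proof -
  have sq: "coeff (square_terms s (2 * l + 2)) (2 * k + 1) = (if k = l + 1 then 2 * s else 0)" for s
    using coeff_square_terms_odd[of s "l + 1" k] by simp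
  have s: "(- 1 :: real) ^ l = 1" using assms by auto
  have m: "coeff (monom 2 j + monom 2 (j + 1) + monom 6 (j + 2) + monom 2 (j + 3) + monom 4 (j + 4)) (2 * k + 1)
      = 2 * of_bool (j = 2 * k) + 2 * (of_bool (j + 2 = 2 * k) :: real)" if "even j" for j
  proof -
    have "j \<noteq> 2 * k + 1" "j + 2 \<noteq> 2 * k + 1" "j + 4 \<noteq> 2 * k + 1"
      "j + 1 = 2 * k + 1 \<longleftrightarrow> j = 2 * k" "j + 3 = 2 * k + 1 \<longleftrightarrow> j + 2 = 2 * k"
      using that by presburger+
    then show ?thesis by (simp only: coeff_add coeff_monom if_False) simp
  qed
  have c0: "coeff const_poly (2 * k + 1) = 0" using assms by (intro coeff_const_poly_ge_5) simp
  have "coeff (dumbbell_main l g h) (2 * k + 1) = 0 +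
    (2 * of_bool (g = 2 * k) + 2 * of_bool (g + 2 = 2 * k) + (2 * of_bool (h = 2 * k) + 2 * of_bool (h + 2 = 2 * k)))
    - (if k = l + 1 then 2 * 1 else 0)"
    unfolding dumbbell_main_def Let_def s coeff_diff sq c0[symmetric] m[OF assms(1), symmetric] m[OF assms(2), symmetric]
    by (simp only: coeff_add)
  then show ?thesis by simp
qed

text \<open>The argument of \<open>theta_mult_cycles\<close> is repeated with \<open>m\<close> the
  least length among all cycles, end cycles included. For odd \<open>m\<close> the coefficient at
  \<open>m + 2\<close> suffices. For even \<open>m\<close> those at \<open>m + 1\<close> and
  \<open>m + 3\<close> are added, because the negative term of the connecting path meets at most one
  of them.\<close>

lemma theta_neq_dumbbell_cycles:
  assumes eq: "\<And>x. poly (theta_poly a b c) x = dumbbell_fun x l g h * poly (cycle_poly cs) x"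
    and s: "a + b + c = l + g + h + sum_list cs" and gh: "3 \<le> g" "g \<le> h" "1 \<le> l"
    and ne: "cs \<noteq> []" and cs: "\<And>k. k \<in> set cs \<Longrightarrow> 3 \<le> k"
  shows False
proof -
  obtain p where p: "\<And>x. poly p x = dumbbell_fun x l g h"
    "\<And>n. n < 2 * g \<Longrightarrow> n < 2 * l + 1 + g \<Longrightarrow> coeff p n = coeff (dumbbell_main l g h) n"
    using dumbbell_fun_poly[of g h l] gh by auto
  have eq': "theta_poly a b c = p * cycle_poly cs" by (rule poly_ext) (simp add: eq p(1))
  have "poly (theta_poly a b c) 1 = 0 \<and> dumbbell_fun 1 l g h = 0"
    using theta_at_1(1)[of a b c] dumbbell_at_1(1)[of l g h] ne
    by (intro theta_at_1_mult_cycles[of _ _ cs]) (auto simp: eq)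
  then have ev: "even a" "even b" "even c" "even l" "even g" "even h"
    by (simp_all add: theta_at_1 dumbbell_at_1)
  have ge: "4 \<le> g" "2 \<le> l" using ev gh by (auto elim!: evenE)
  define m where "m = min g (Min (set cs))"
  have mcs: "m \<le> Min (set cs)" "m \<le> g" by (simp_all add: m_def)
  have M: "Min (set cs) \<in> set cs" using ne by simp
  have m3: "3 \<le> m" using M cs gh by (simp add: m_def)
  have "Min (set cs) \<le> sum_list cs" using M by (intro member_le_sum_list) auto
  then have ms: "m \<le> sum_list cs" using mcs by linarith
  have low: "coeff p i = coeff const_poly i" if "i \<le> 3" for i
    using that ge gh by (subst p(2)) (auto intro!: dumbbell_low_coeffs)
  have low0: "0 \<le> coeff p i" if "i \<le> 3" for i
  proof -
    have "i = 0 \<or> i = 1 \<or> i = 2 \<or> i = 3" using that by linarith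
    then show ?thesis using low[of i] by (auto simp: const_poly_coeffs simp del: One_nat_def)
  qed
  have main: "coeff (dumbbell_main l g h) (m + k) + coeff const_poly k * (2 * real (count_list cs m)) \<le> 0"
    if k: "k < m" "k \<le> 3" "odd (m + k)" "1 \<le> k" for k
  proof -
    obtain j where j: "m + k = 2 * j + 1" using k(3) by (rule oddE)
    have "2 \<le> j" using j m3 k by (cases "m = 3") auto
    moreover have "j < a + b + c" using j k s ms by linarith
    ultimately have "coeff (theta_poly a b c) (m + k) \<le> 0"
      unfolding j using ev by (intro theta_coeff_even_bounds(2)) auto
    moreover have "coeff (p * cycle_poly cs) (m + k) \<ge> coeff p (m + k)
        + coeff p k * (2 * real (count_list cs m))"
      using mcs m3 k low0 by (intro cycle_poly_factor) auto
    moreover have "coeff p (m + k) = coeff (dumbbell_main l g h) (m + k)"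
      using mcs k ge by (intro p(2)) auto
    ultimately show ?thesis unfolding eq' using low[of k] k by simp
  qed
  have of_bool: "0 \<le> (of_bool P :: real)" "(of_bool P :: real) \<le> 1" for P by auto
  show False
  proof (cases "odd m")
    case True
    then have "m \<noteq> g" using ev by auto
    then have "m \<in> set cs" using M by (auto simp: m_def min_def split: if_splits)
    then have c: "count_list cs m \<ge> 1" by (metis One_nat_def Suc_leI count_list_0_iff neq0_conv)
    obtain j where j: "m + 2 = 2 * j + 1" using True by (metis oddE odd_add even_numeral)
    have "2 \<le> j" using j m3 by linarith
    then have "coeff (dumbbell_main l g h) (m + 2) \<ge> - 2"
      unfolding j using ev dumbbell_coeff_even[of g h l j] of_bool by simp
    then show False using main[of 2] True m3 c by (simp add: const_poly_coeffs)
  next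
    case False
    then obtain i where i: "m = 2 * i" by (auto elim: evenE)
    have i2: "2 \<le> i" using i m3 by linarith
    have c1: "coeff (dumbbell_main l g h) (m + 1) = 2 * (of_bool (g = 2 * i) + of_bool (g + 2 = 2 * i)
        + of_bool (h = 2 * i) + of_bool (h + 2 = 2 * i)) - 2 * of_bool (i = l + 1)"
      unfolding i using ev i2 by (intro dumbbell_coeff_even) auto
    have "m + 3 = 2 * (i + 1) + 1" using i by simp
    then have c3: "coeff (dumbbell_main l g h) (m + 3) = 2 * (of_bool (g = 2 * (i + 1)) + of_bool (g + 2 = 2 * (i + 1))
        + of_bool (h = 2 * (i + 1)) + of_bool (h + 2 = 2 * (i + 1))) - 2 * of_bool (i + 1 = l + 1)"
      using dumbbell_coeff_even[of g h l "i + 1"] ev i2 by (simp only:)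
    have l1: "of_bool (i = l + 1) + of_bool (i + 1 = l + 1) \<le> (1 :: real)" by simp
    have m1: "coeff (dumbbell_main l g h) (m + 1) + 4 * real (count_list cs m) \<le> 0"
      using main[of 1] i m3 by (simp add: const_poly_coeffs[simplified])
    have m3': "coeff (dumbbell_main l g h) (m + 3) + 8 * real (count_list cs m) \<le> 0"
      using main[of 3] i i2 by (simp add: const_poly_coeffs)
    \<comment> \<open>If \<open>m = g\<close>, the end cycle supplies 2 at each of the two
      exponents. Otherwise \<open>m\<close> is the length of a disjoint cycle, which supplies 4 at
      the first and 8 at the second.\<close>
    have cge: "2 * (of_bool (g = 2 * i)) + 2 * of_bool (g + 2 = 2 * (i + 1)) + 12 * real (count_list cs m) \<ge> 4"
    proof (cases "m = g")
      case True
      then show ?thesis using i by simp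
    next
      case False
      then have "m \<in> set cs" using M by (auto simp: m_def min_def split: if_splits)
      then have "count_list cs m \<ge> 1" by (metis One_nat_def Suc_leI count_list_0_iff neq0_conv)
      then have "12 * real (count_list cs m) \<ge> 12" by simp
      then show ?thesis using of_bool(1)[of "g = 2 * i"] of_bool(1)[of "g + 2 = 2 * (i + 1)"] by linarith
    qed
    show False
      using m1 m3' l1 cge of_bool(1)[of "g + 2 = 2 * i"] of_bool(1)[of "h = 2 * i"] of_bool(1)[of "h + 2 = 2 * i"]
        of_bool(1)[of "g = 2 * (i + 1)"] of_bool(1)[of "h = 2 * (i + 1)"] of_bool(1)[of "h + 2 = 2 * (i + 1)"]
      unfolding c1 c3 by argo
  qed
qed

lemma theta_neq_dumbbell:
  assumes eq: "\<And>x. poly (theta_poly a b c) x = dumbbell_fun x l g h * poly (cycle_poly cs) x"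
    and s: "a + b + c = l + g + h + sum_list cs" and gh: "3 \<le> g" "3 \<le> h" "1 \<le> l"
    and cs: "\<And>k. k \<in> set cs \<Longrightarrow> 3 \<le> k" and abc: "1 \<le> a" "2 \<le> b" "2 \<le> c"
  shows False
proof -
  have main: False
    if eq: "\<And>x. poly (theta_poly a b c) x = dumbbell_fun x l g h * poly (cycle_poly cs) x"
      and s: "a + b + c = l + g + h + sum_list cs" and gh: "3 \<le> g" "g \<le> h" for g h
  proof (cases "cs = []")
    case True
    obtain p where p: "\<And>x. poly p x = dumbbell_fun x l g h"
      "\<And>n. n < 2 * g \<Longrightarrow> n < 2 * l + 1 + g \<Longrightarrow> coeff p n = coeff (dumbbell_main l g h) n"
      using dumbbell_fun_poly[of g h l] gh by auto
    have eq': "theta_poly a b c = p"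
      by (rule poly_ext) (simp add: eq p(1) True cycle_poly_def)
    obtain x y z where x: "mset [a, b, c] = mset [x, y, z]" "x \<le> y" "y \<le> z" by (rule sort3)
    show False
    proof (rule theta_neq_dumbbell_sorted)
      show "1 \<le> x" "2 \<le> y" "x + y + z = l + g + h"
        using mset3_cases[OF x(1)] x(2,3) abc s True by auto
      show "coeff (theta_poly x y z) n = coeff (dumbbell_main l g h) n" if "n \<le> g + 2" for n
        using p(2)[of n] that gh assms(5) by (simp add: eq' theta_poly_mset[OF x(1), symmetric])
    qed (use x gh assms(5) in auto)
  next
    case False
    then show False using theta_neq_dumbbell_cycles[OF eq s gh assms(5) False cs] by blast
  qed
  show False
  proof (cases "g \<le> h")
    case True
    then show False using main[OF eq s gh(1)] by blast
  next
    case False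
    have "dumbbell_fun x l g h = dumbbell_fun x l h g" for x by (simp add: dumbbell_fun_def)
    then show False using main[of h g] eq s gh False by (simp add: add.commute add.left_commute)
  qed
qed

section \<open>Decomposition of graphs with two branching vertices\<close>

lemma path_arcs_single [simp]: "path_arcs [x] = {}"
  by (simp add: path_arcs_def)

lemma path_arcs_Cons:
  "xs \<noteq> [] \<Longrightarrow> path_arcs (x # xs) = {(x, hd xs), (hd xs, x)} \<union> path_arcs xs"
  by (cases xs) (auto simp: path_arcs_def)

lemma path_arcs_snoc:
  "xs \<noteq> [] \<Longrightarrow> path_arcs (xs @ [b]) = {(last xs, b), (b, last xs)} \<union> path_arcs xs"
  by (induction xs) (auto simp: path_arcs_Cons)

lemma path_arcs_mid:
  "(y, last (a # ys)) \<in> path_arcs (a # ys @ y # ws @ [b]) \<and>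
   (y, hd (ws @ [b])) \<in> path_arcs (a # ys @ y # ws @ [b])"
proof (induction ys arbitrary: a)
  case Nil
  have "path_arcs (a # y # ws @ [b]) =
      {(a, y), (y, a)} \<union> ({(y, hd (ws @ [b])), (hd (ws @ [b]), y)} \<union> path_arcs (ws @ [b]))"
    by (simp add: path_arcs_Cons)
  then show ?case by simp
next
  case (Cons x ys)
  have "path_arcs (a # (x # ys) @ y # ws @ [b]) = {(a, x), (x, a)} \<union> path_arcs (x # ys @ y # ws @ [b])"
    by (subst path_arcs_Cons) auto
  then show ?case using Cons.IH[of x] by simp
qed

definition nbs :: "('a \<times> 'a) set \<Rightarrow> 'a set \<Rightarrow> 'a \<Rightarrow> 'a set" where
  "nbs E V x = {t \<in> V. (x, t) \<in> E}"

context
  fixes E :: "('a \<times> 'a) set"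
  assumes symE: "sym E" and irreflE: "irrefl E"
begin

text \<open>\<open>pendant\<close> compares a vertex only with later ones, as expansions require.
  The form here is free of an order of removal: inside \<open>U \<union> set zs\<close> the vertices
  of \<open>zs\<close> have no edges but those of the path.\<close>

lemma pendant_iff:
  assumes "b \<in> U"
  shows "pendant E U zs b \<longleftrightarrow> distinct zs \<and> set zs \<inter> U = {} \<and>
    (\<forall>x\<in>set zs. \<forall>t\<in>U \<union> set zs. (x, t) \<in> E \<longleftrightarrow> (x, t) \<in> path_arcs (zs @ [b]))"
proof (induction zs)
  case Nil
  then show ?case by simp
next
  case (Cons x zs)
  let ?n = "hd (zs @ [b])"
  have n: "?n \<in> U \<union> set zs" using hd_append_mem[of zs b] assms by auto
  have p: "(s, t) \<in> path_arcs (x # zs @ [b]) \<longleftrightarrow>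
      s = x \<and> t = ?n \<or> s = ?n \<and> t = x \<or> (s, t) \<in> path_arcs (zs @ [b])" for s t
    by (subst path_arcs_Cons) auto
  have x: "(x, t) \<notin> path_arcs (zs @ [b])" "(t, x) \<notin> path_arcs (zs @ [b])" if "x \<notin> U" "x \<notin> set zs" for t
    using path_arcsD(1)[of x t "zs @ [b]"] path_arcsD(2)[of t x "zs @ [b]"] that assms by auto
  note sE = sym_iff[OF symE]
  have iE: "(x, x) \<notin> E" using irreflE by (auto simp: irrefl_def)
  show ?case
  proof (cases "x \<notin> U \<and> x \<notin> set zs")
    case True
    then have nx: "?n \<noteq> x" using n by auto
    have "(\<forall>s\<in>set (x # zs). \<forall>t\<in>U \<union> set (x # zs). (s, t) \<in> E \<longleftrightarrow> (s, t) \<in> path_arcs ((x # zs) @ [b]))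
      \<longleftrightarrow> (\<forall>t\<in>U \<union> set zs. (x, t) \<in> E \<longleftrightarrow> t = ?n) \<and>
        (\<forall>s\<in>set zs. \<forall>t\<in>U \<union> set zs. (s, t) \<in> E \<longleftrightarrow> (s, t) \<in> path_arcs (zs @ [b]))" (is "?L \<longleftrightarrow> ?R")
    proof
      assume L: ?L
      show ?R
      proof (intro conjI ballI)
        fix t assume "t \<in> U \<union> set zs"
        moreover from this have "t \<noteq> x" using True by auto
        ultimately show "(x, t) \<in> E \<longleftrightarrow> t = ?n" using L x True nx by (auto simp: p)
      next
        fix s t assume "s \<in> set zs" "t \<in> U \<union> set zs"
        moreover from this have "s \<noteq> x" "t \<noteq> x" using True by auto
        ultimately show "(s, t) \<in> E \<longleftrightarrow> (s, t) \<in> path_arcs (zs @ [b])" using L by (auto simp: p)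
      qed
    next
      assume R: ?R
      show ?L
      proof (intro ballI)
        fix s t assume st: "s \<in> set (x # zs)" "t \<in> U \<union> set (x # zs)"
        have "(s, t) \<in> E \<longleftrightarrow> s = x \<and> t = ?n \<or> s = ?n \<and> t = x \<or> (s, t) \<in> path_arcs (zs @ [b])"
        proof (cases "s = x")
          case True
          then show ?thesis using R st iE x[of t] \<open>x \<notin> U \<and> x \<notin> set zs\<close> nx by auto
        next
          case sx: False
          then have s: "s \<in> set zs" using st by auto
          show ?thesis
          proof (cases "t = x")
            case True
            then show ?thesis using R s sx sE[of s x] x(2)[of s] \<open>x \<notin> U \<and> x \<notin> set zs\<close> by auto
          next
            case False
            then show ?thesis using R s st sx by auto
          qed
        qed
        then show "(s, t) \<in> E \<longleftrightarrow> (s, t) \<in> path_arcs ((x # zs) @ [b])" by (simp add: p)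
      qed
    qed
    then show ?thesis using Cons.IH True by auto
  qed auto
qed

text \<open>The condition \<open>a \<noteq> hd (tl zs @ [b])\<close> turns into the length bound: a
  closed ear with one interior vertex would use the same edge at both ends.\<close>

lemma ear_iff:
  "ear E U a zs b \<longleftrightarrow> zs \<noteq> [] \<and> a \<in> U \<and> b \<in> U \<and> (a = b \<longrightarrow> 2 \<le> length zs) \<and>
    distinct zs \<and> set zs \<inter> U = {} \<and>
    (\<forall>x\<in>set zs. \<forall>t\<in>U \<union> set zs. (x, t) \<in> E \<longleftrightarrow> (x, t) \<in> path_arcs (a # zs @ [b]))"
proof (cases "zs \<noteq> [] \<and> a \<in> U \<and> b \<in> U")
  case True
  then obtain x xs where zs: "zs = x # xs" by (cases zs) auto
  have aU: "a \<in> U" and bU: "b \<in> U" using True by auto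
  let ?n = "hd (xs @ [b])"
  have n: "?n \<in> U \<union> set xs" using hd_append_mem[of xs b] bU by auto
  have p: "(s, t) \<in> path_arcs (a # x # xs @ [b]) \<longleftrightarrow>
      s = a \<and> t = x \<or> s = x \<and> t = a \<or> s = x \<and> t = ?n \<or> s = ?n \<and> t = x \<or> (s, t) \<in> path_arcs (xs @ [b])" for s t
    by (subst path_arcs_Cons, simp, subst path_arcs_Cons) auto
  note sE = sym_iff[OF symE]
  have iE: "(x, x) \<notin> E" using irreflE by (auto simp: irrefl_def)
  show ?thesis
  proof (cases "x \<notin> U \<and> distinct zs \<and> set xs \<inter> U = {}")
    case d: True
    then have x: "x \<notin> U" "x \<notin> set xs" and dis: "set xs \<inter> U = {}" by (auto simp: zs)
    have nx: "?n \<noteq> x" "a \<noteq> x" using x n aU by auto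
    have px: "(x, t) \<notin> path_arcs (xs @ [b])" "(t, x) \<notin> path_arcs (xs @ [b])" for t
      using path_arcsD(1)[of x t "xs @ [b]"] path_arcsD(2)[of t x "xs @ [b]"] x bU by auto
    have an: "a \<noteq> ?n \<longleftrightarrow> (a = b \<longrightarrow> 2 \<le> length zs)"
      using dis aU by (cases xs) (auto simp: zs)
    have "(\<forall>s\<in>set zs. \<forall>t\<in>U \<union> set zs. (s, t) \<in> E \<longleftrightarrow> (s, t) \<in> path_arcs (a # zs @ [b])) \<longleftrightarrow>
      (\<forall>t\<in>U \<union> set xs. (x, t) \<in> E \<longleftrightarrow> t = a \<or> t = ?n) \<and>
      (\<forall>s\<in>set xs. \<forall>t\<in>U \<union> set xs. (s, t) \<in> E \<longleftrightarrow> (s, t) \<in> path_arcs (xs @ [b]))" (is "?L \<longleftrightarrow> ?R")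
    proof
      assume L: ?L
      show ?R
      proof (intro conjI ballI)
        fix t assume t: "t \<in> U \<union> set xs"
        then have "t \<noteq> x" using x by auto
        moreover have "(x, t) \<in> E \<longleftrightarrow> (x, t) \<in> path_arcs (a # zs @ [b])" using L t by (auto simp: zs)
        ultimately show "(x, t) \<in> E \<longleftrightarrow> t = a \<or> t = ?n" using px nx by (auto simp: p zs)
      next
        fix s t assume st: "s \<in> set xs" "t \<in> U \<union> set xs"
        then have "s \<noteq> x" "t \<noteq> x" using x by auto
        moreover have "(s, t) \<in> E \<longleftrightarrow> (s, t) \<in> path_arcs (a # zs @ [b])" using L st by (auto simp: zs)
        ultimately show "(s, t) \<in> E \<longleftrightarrow> (s, t) \<in> path_arcs (xs @ [b])" by (auto simp: p zs)
      qed
    next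
      assume R: ?R
      show ?L
      proof (intro ballI)
        fix s t assume st: "s \<in> set zs" "t \<in> U \<union> set zs"
        have "(s, t) \<in> E \<longleftrightarrow> s = a \<and> t = x \<or> s = x \<and> t = a \<or> s = x \<and> t = ?n \<or> s = ?n \<and> t = x
          \<or> (s, t) \<in> path_arcs (xs @ [b])"
        proof (cases "s = x")
          case True
          then show ?thesis using R st iE px[of t] nx by (auto simp: zs)
        next
          case sx: False
          then have s: "s \<in> set xs" "s \<noteq> a" using st dis aU by (auto simp: zs)
          show ?thesis
          proof (cases "t = x")
            case True
            then show ?thesis using R s sx sE[of s x] px(2)[of s] by auto
          next
            case False
            then have "t \<in> U \<union> set xs" using st by (auto simp: zs)
            then show ?thesis using R s sx False by auto
          qed
        qed
        then show "(s, t) \<in> E \<longleftrightarrow> (s, t) \<in> path_arcs (a # zs @ [b])" by (simp add: p zs)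
      qed
    qed
    moreover have "ear E U a zs b \<longleftrightarrow> pendant E U xs b \<and> a \<noteq> ?n \<and>
        (\<forall>t\<in>U \<union> set xs. (x, t) \<in> E \<longleftrightarrow> t = a \<or> t = ?n)"
      using x aU bU by (simp add: ear_def zs)
    ultimately show ?thesis
      using pendant_iff[OF bU, of xs] an x d True by (auto simp: zs)
  next
    case False
    then show ?thesis using pendant_iff[OF bU, of xs] by (auto simp: ear_def zs)
  qed
qed (auto simp: ear_def)

lemma ear_arcs:
  assumes "ear E U a zs b"
  shows "E \<inter> (U \<union> set zs) \<times> (U \<union> set zs) = E \<inter> U \<times> U \<union> path_arcs (a # zs @ [b])"
proof -
  note e = assms[unfolded ear_iff]
  note sE = sym_iff[OF symE]
  have zs: "zs \<noteq> []" using e by simp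
  have p: "path_arcs (a # zs @ [b]) = {(a, hd zs), (hd zs, a)} \<union> ({(last zs, b), (b, last zs)} \<union> path_arcs zs)"
    using zs by (simp add: path_arcs_Cons path_arcs_snoc)
  have pU: "s \<in> U \<union> set zs \<and> t \<in> U \<union> set zs \<and> (s \<in> set zs \<or> t \<in> set zs)"
    if "(s, t) \<in> path_arcs (a # zs @ [b])" for s t
    using that zs e path_arcsD(1,2)[of s t zs] unfolding p by auto
  have iff: "(s, t) \<in> E \<longleftrightarrow> (s, t) \<in> path_arcs (a # zs @ [b])" if "s \<in> set zs" "t \<in> U \<union> set zs" for s t
    using e that by blast
  have iff': "(s, t) \<in> E \<longleftrightarrow> (s, t) \<in> path_arcs (a # zs @ [b])" if "t \<in> set zs" "s \<in> U \<union> set zs" for s t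
    using iff[OF that] sE path_arcs_sym[of s t] path_arcs_sym[of t s] by blast
  show ?thesis
  proof (intro Set.set_eqI iffI)
    fix p assume "p \<in> E \<inter> (U \<union> set zs) \<times> (U \<union> set zs)"
    then show "p \<in> E \<inter> U \<times> U \<union> path_arcs (a # zs @ [b])"
      using iff iff' by (cases p) auto
  next
    fix p assume "p \<in> E \<inter> U \<times> U \<union> path_arcs (a # zs @ [b])"
    then show "p \<in> E \<inter> (U \<union> set zs) \<times> (U \<union> set zs)"
      using pU iff iff' by (cases p) blast
  qed
qed

lemma ear_attach:
  assumes "ear E U a zs b" "t \<in> U" "x \<in> set zs"
  shows "(t, x) \<in> E \<longleftrightarrow> t = a \<and> x = hd zs \<or> t = b \<and> x = last zs"
proof -
  note e = assms(1)[unfolded ear_iff]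
  have zs: "zs \<noteq> []" using e by simp
  have p: "path_arcs (a # zs @ [b]) = {(a, hd zs), (hd zs, a)} \<union> ({(last zs, b), (b, last zs)} \<union> path_arcs zs)"
    using zs by (simp add: path_arcs_Cons path_arcs_snoc)
  have "(t, x) \<in> E \<longleftrightarrow> (x, t) \<in> E" using symE by (auto simp: sym_def)
  also have "\<dots> \<longleftrightarrow> (x, t) \<in> path_arcs (a # zs @ [b])" using e assms by blast
  also have "\<dots> \<longleftrightarrow> t = a \<and> x = hd zs \<or> t = b \<and> x = last zs"
    using path_arcsD(2)[of x t zs] e assms unfolding p by auto
  finally show ?thesis .
qed

text \<open>A longest path that starts in \<open>S\<close> and stays outside \<open>S\<close> can only be continued into \<open>S\<close>, as a
  vertex of degree 2 cannot be met twice.\<close>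

lemma ex_ear:
  assumes fin: "finite V" and SV: "S \<subseteq> V" and deg: "\<And>x. x \<in> V - S \<Longrightarrow> card (nbs E V x) = 2"
    and a: "a \<in> S" and x: "x \<in> V - S" "(a, x) \<in> E"
  shows "\<exists>zs b. b \<in> S \<and> set zs \<subseteq> V - S \<and> ear E (V - set zs) a zs b"
proof -
  define P where "P zs \<longleftrightarrow> distinct zs \<and> set zs \<subseteq> V - S \<and> zs \<noteq> [] \<and> path_arcs (a # zs) \<subseteq> E" for zs
  note sE = sym_iff[OF symE]
  note iE = irreflD[OF irreflE]
  have finV: "finite (nbs E V y)" for y using fin by (simp add: nbs_def)
  have "P [x]" using x sE by (auto simp: P_def path_arcs_Cons)
  moreover have "length zs < card V + 1" if "P zs" for zs
  proof -
    have "length zs = card (set zs)" using that by (simp add: P_def distinct_card)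
    also have "\<dots> \<le> card V" using that fin by (intro card_mono) (auto simp: P_def)
    finally show ?thesis by simp
  qed
  ultimately obtain zs where P: "P zs" and max: "\<And>zs'. P zs' \<Longrightarrow> length zs' \<le> length zs"
    using ex_has_greatest_nat[of P "[x]" length "card V + 1"] by blast
  have zs: "distinct zs" "set zs \<subseteq> V - S" "zs \<noteq> []" "path_arcs (a # zs) \<subseteq> E" using P by (auto simp: P_def)
  define z where "z = last zs"
  define us where "us = butlast zs"
  have zs': "zs = us @ [z]" using zs by (simp add: z_def us_def)
  define pr where "pr = last (a # us)"
  have aV: "a \<in> V" "a \<notin> set zs" using a SV zs by auto
  have pr: "pr \<in> V" "(z, pr) \<in> E"
  proof -
    have "pr \<in> set (a # us)" by (simp only: pr_def) (rule last_in_set, simp)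
    then show "pr \<in> V" using aV zs zs' by auto
    have "path_arcs (a # zs) = path_arcs ((a # us) @ [z])" by (simp add: zs')
    also have "\<dots> = {(pr, z), (z, pr)} \<union> path_arcs (a # us)"
      unfolding pr_def by (rule path_arcs_snoc) simp
    finally have "(z, pr) \<in> path_arcs (a # zs)" by simp
    then show "(z, pr) \<in> E" using zs by auto
  qed
  have z: "z \<in> V - S" using zs zs' by auto
  have "pr \<in> nbs E V z" using pr by (simp add: nbs_def)
  moreover have "card (nbs E V z) = 2" using deg[OF z] .
  moreover from this obtain r s where rs: "nbs E V z = {r, s}" "r \<noteq> s" by (auto simp: card_2_iff)
  ultimately have "nbs E V z = {pr, if pr = r then s else r} \<and> (if pr = r then s else r) \<noteq> pr" by auto
  \<comment> \<open>The last vertex \<open>z\<close> has degree 2, so besides its predecessor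
    \<open>pr\<close> it has exactly one neighbour \<open>t\<close>.\<close>
  then obtain t where t: "nbs E V z = {pr, t}" "t \<noteq> pr" by blast
  have tV: "t \<in> V" "(z, t) \<in> E" using t by (auto simp: nbs_def)
  \<comment> \<open>An earlier path vertex \<open>t\<close> would have three neighbours: its
    predecessor, its successor and \<open>z\<close>. The successor is not \<open>z\<close>, because
    \<open>t\<close> is not \<open>pr\<close>.\<close>
  have "t \<notin> set zs"
  proof
    assume "t \<in> set zs"
    moreover have "t \<noteq> z" using tV iE by auto
    ultimately have "t \<in> set us" using zs' by auto
    then obtain ys ws where us: "us = ys @ t # ws" by (meson split_list)
    have ws: "ws \<noteq> []"
    proof
      assume "ws = []"
      then have "pr = t" by (simp add: pr_def us)
      then show False using t by simp
    qed
    have full: "a # zs = a # ys @ t # ws @ [z]" by (simp add: zs' us)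
    have "(t, last (a # ys)) \<in> E" "(t, hd (ws @ [z])) \<in> E"
      using path_arcs_mid[of t a ys ws z] zs(4) full by auto
    then have "(t, last (a # ys)) \<in> E" "(t, hd ws) \<in> E" using ws by auto
    moreover have "last (a # ys) \<in> insert a (set ys)"
      using last_in_set[of "a # ys"] by simp
    moreover have "hd ws \<in> set ws" using ws by simp
    moreover have "(t, z) \<in> E" using tV sE by auto
    moreover have "set ys \<subseteq> V" "set ws \<subseteq> V" "z \<in> V" "t \<in> V - S" using zs zs' us by auto
    ultimately have sub: "{last (a # ys), hd ws, z} \<subseteq> nbs E V t" and tVS: "t \<in> V - S" using aV
      by (auto simp: nbs_def)
    have "distinct (a # ys @ t # ws @ [z])" using zs(1) aV full by simp
    then have "l \<noteq> h \<and> l \<noteq> z \<and> h \<noteq> z" if "l \<in> insert a (set ys)" "h \<in> set ws" for l h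
      using that by auto
    then have "card {last (a # ys), hd ws, z} = 3"
      using \<open>last (a # ys) \<in> insert a (set ys)\<close> \<open>hd ws \<in> set ws\<close> by (simp del: last.simps)
    then have "3 \<le> card (nbs E V t)" using card_mono[OF finV sub] by simp
    then show False using deg[OF tVS] by simp
  qed
  have tS: "t \<in> S"
  proof (rule ccontr)
    assume "t \<notin> S"
    have "path_arcs (a # zs @ [t]) = path_arcs ((a # zs) @ [t])" by simp
    also have "\<dots> \<subseteq> E"
      using zs(3,4) tV sE[of t z] by (subst path_arcs_snoc) (auto simp: z_def)
    finally have "P (zs @ [t])"
      using zs tV \<open>t \<notin> S\<close> \<open>t \<notin> set zs\<close> by (auto simp: P_def)
    from max[OF this] show False by simp
  qed
  have sub: "path_arcs (a # zs @ [t]) \<subseteq> E"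
  proof -
    have "path_arcs (a # zs @ [t]) = path_arcs ((a # zs) @ [t])" by simp
    also have "\<dots> \<subseteq> E"
      using zs(3,4) tV sE[of t z] by (subst path_arcs_snoc) (auto simp: z_def)
    finally show ?thesis .
  qed
  \<comment> \<open>There are no chords and no further edges to other vertices, since every path
    vertex already has its two neighbours along the path.\<close>
  have "ear E (V - set zs) a zs t"
    unfolding ear_iff
  proof (intro conjI ballI)
    show "zs \<noteq> []" "distinct zs" "set zs \<inter> (V - set zs) = {}" "a \<in> V - set zs" "t \<in> V - set zs"
      using zs aV tV \<open>t \<notin> set zs\<close> by auto
    show "a = t \<longrightarrow> 2 \<le> length zs"
    proof
      assume "a = t"
      then have "us \<noteq> []" using t by (auto simp: pr_def)
      then show "2 \<le> length zs" by (cases us) (auto simp: zs')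
    qed
    fix y s assume y: "y \<in> set zs" and s: "s \<in> V - set zs \<union> set zs"
    obtain ys ws where yw: "zs = ys @ y # ws" using y by (meson split_list)
    have full: "a # zs @ [t] = a # ys @ y # ws @ [t]" by (simp add: yw)
    note mid = path_arcs_mid[of y a ys ws t, folded full]
    have l: "last (a # ys) \<in> insert a (set ys)" using last_in_set[of "a # ys"] by simp
    have h: "hd (ws @ [t]) \<in> insert t (set ws)" by (rule hd_append_mem)
    have ne: "last (a # ys) \<noteq> hd (ws @ [t])"
    proof (cases "ws = []")
      case True
      then have "us = ys" using yw zs' by simp
      then show ?thesis using t(2) True by (simp add: pr_def)
    next
      case False
      then have "hd (ws @ [t]) \<in> set ws" by simp
      moreover have "distinct (a # ys @ y # ws)" using zs(1) aV yw by (metis distinct.simps(2))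
      ultimately show ?thesis using l by auto
    qed
    have yVS: "y \<in> V - S" using y zs by auto
    have "{last (a # ys), hd (ws @ [t])} \<subseteq> nbs E V y"
      using mid sub l h aV tV zs(2) yw by (auto simp: nbs_def)
    moreover have "card {last (a # ys), hd (ws @ [t])} = card (nbs E V y)" using ne deg[OF yVS] by simp
    ultimately have nb: "nbs E V y = {last (a # ys), hd (ws @ [t])}"
      using finV by (metis card_subset_eq)
    show "(y, s) \<in> E \<longleftrightarrow> (y, s) \<in> path_arcs (a # zs @ [t])"
    proof
      assume "(y, s) \<in> E"
      then have "s \<in> nbs E V y" using s zs by (auto simp: nbs_def)
      then show "(y, s) \<in> path_arcs (a # zs @ [t])" using nb mid by auto
    qed (use sub in auto)
  qed
  then show ?thesis using tS zs by blast
qed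

text \<open>Counting neighbours outside \<open>S\<close> keeps edges within \<open>S\<close> out of
  the bookkeeping. An ear uses one edge at each end, hence two at \<open>a\<close> if it closes up;
  other vertices of \<open>U\<close> are not adjacent to it and keep their degree.\<close>

lemma ear_step:
  assumes fin: "finite V" and SV: "S \<subseteq> V" and deg: "\<And>x. x \<in> V - S \<Longrightarrow> card (nbs E V x) = 2"
    and a: "a \<in> S" and o: "nbs E (V - S) a \<noteq> {}"
  obtains U zs b where "b \<in> S" "V = U \<union> set zs" "S \<subseteq> U" "ear E U a zs b"
    "\<And>x. x \<in> U - S \<Longrightarrow> card (nbs E U x) = 2"
    "\<And>t. t \<in> S \<Longrightarrow> card (nbs E (V - S) t) =
       card (nbs E (U - S) t) + (if t = a then 1 else 0) + (if t = b then 1 else 0)"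
proof -
  obtain x where "x \<in> V - S" "(a, x) \<in> E" using o by (auto simp: nbs_def)
  from ex_ear[OF fin SV deg a this] obtain zs b where
    zs: "b \<in> S" "set zs \<subseteq> V - S" "ear E (V - set zs) a zs b" by blast
  define U where "U = V - set zs"
  have e: "ear E U a zs b" using zs by (simp add: U_def)
  note ei = e[unfolded ear_iff]
  have V: "V = U \<union> set zs" "S \<subseteq> U" using zs SV by (auto simp: U_def)
  have finU: "finite (nbs E (U - S) t)" for t using fin by (simp add: nbs_def U_def)
  have hl: "hd zs \<in> set zs" "last zs \<in> set zs" using ei by auto
  have "nbs E U x = nbs E V x" if "x \<in> U - S" for x
    using ear_attach[OF e, of x] that a zs(1) by (auto simp: nbs_def V(1))
  then have "card (nbs E U x) = 2" if "x \<in> U - S" for x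
    using deg[of x] that by (auto simp: V(1))
  moreover have "card (nbs E (V - S) t) =
       card (nbs E (U - S) t) + (if t = a then 1 else 0) + (if t = b then 1 else 0)" if t: "t \<in> S" for t
  proof -
    have "nbs E (V - S) t = nbs E (U - S) t \<union> {x \<in> set zs. t = a \<and> x = hd zs \<or> t = b \<and> x = last zs}"
      using ear_attach[OF e, of t] t V zs(2) by (auto simp: nbs_def)
    moreover have "nbs E (U - S) t \<inter> {x \<in> set zs. t = a \<and> x = hd zs \<or> t = b \<and> x = last zs} = {}"
      by (auto simp: nbs_def U_def)
    ultimately have "card (nbs E (V - S) t) =
      card (nbs E (U - S) t) + card {x \<in> set zs. t = a \<and> x = hd zs \<or> t = b \<and> x = last zs}"
      using finU by (simp add: card_Un_disjoint)
    moreover have "card {x \<in> set zs. t = a \<and> x = hd zs \<or> t = b \<and> x = last zs} =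
      (if t = a then 1 else 0) + (if t = b then 1 else 0)"
    \<comment> \<open>A closed ear has at least two interior vertices, so its first and last vertex
      are different neighbours of \<open>t\<close>.\<close>
    proof (cases "t = a \<and> t = b")
      case True
      then have "a = b" by blast
      then have "2 \<le> length zs" using ei by blast
      then obtain x y ws where w: "zs = x # y # ws" by (metis Suc_le_length_iff numeral_2_eq_2)
      then have "last zs \<in> set (y # ws)" by simp
      then have "hd zs \<noteq> last zs" using ei w by (auto simp del: last.simps)
      moreover have "{x \<in> set zs. t = a \<and> x = hd zs \<or> t = b \<and> x = last zs} = {hd zs, last zs}"
        using hl True by auto
      moreover have "a = t" "b = t" using True by blast+
      ultimately show ?thesis by simp
    next
      case False
      then have "{x \<in> set zs. t = a \<and> x = hd zs \<or> t = b \<and> x = last zs} =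
        (if t = a then {hd zs} else if t = b then {last zs} else {})"
        using hl by auto
      then show ?thesis using False by auto
    qed
    ultimately show ?thesis by simp
  qed
  ultimately show ?thesis using that[OF zs(1) V e] by blast
qed

text \<open>An ear for \<open>S = {x}\<close> returns to \<open>x\<close> and uses both edges there,
  so it closes a cycle without edges to the rest. The list \<open>cs\<close> is chosen before
  \<open>y\<close>, \<open>d\<close>, \<open>A\<close> and \<open>B\<close>, because later the
  product is regarded as a function of \<open>y\<close>.\<close>

lemma cycle_decomposition:
  fixes R U :: "'a set"
  assumes fin: "finite U" "finite R" and dis: "U \<inter> R = {}"
    and sep: "\<And>s t. s \<in> U \<Longrightarrow> t \<in> R \<Longrightarrow> (s, t) \<notin> E"
    and deg: "\<And>x. x \<in> R \<Longrightarrow> card (nbs E R x) = 2"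
  shows "\<exists>cs. (\<forall>k\<in>set cs. 3 \<le> k) \<and> sum_list cs = card R \<and>
    (\<forall>(y :: 'r::comm_ring_1) d A B. (\<forall>t\<in>R. d t = y) \<longrightarrow> A \<subseteq> U \<longrightarrow> B \<subseteq> U \<longrightarrow>
      perm_on (graph_weight E d) (A \<union> R) (B \<union> R) =
        (\<Prod>c\<leftarrow>cs. cycle_perm y c) * perm_on (graph_weight E d) A B)"
  using fin(2) dis sep deg
proof (induction R rule: finite_psubset_induct)
  case (psubset R)
  show ?case
  proof (cases "R = {}")
    case True
    then show ?thesis by (intro exI[of _ "[]"]) auto
  next
    case False
    then obtain x where x: "x \<in> R" by auto
    note sE = sym_iff[OF symE]
    note iE = irreflD[OF irreflE]
    have ox: "nbs E (R - {x}) x = nbs E R x" using iE by (auto simp: nbs_def)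
    have c2: "card (nbs E (R - {x}) x) = 2" using psubset.prems(3)[OF x] ox by simp
    then have ne: "nbs E (R - {x}) x \<noteq> {}" by auto
    have xR: "{x} \<subseteq> R" using x by simp
    have deg1: "card (nbs E R t) = 2" if "t \<in> R - {x}" for t using psubset.prems(3) that by simp
    obtain R1 zs b where R1: "b \<in> {x}" "R = R1 \<union> set zs" "{x} \<subseteq> R1" "ear E R1 x zs b"
      "\<And>t. t \<in> R1 - {x} \<Longrightarrow> card (nbs E R1 t) = 2"
      "\<And>t. t \<in> {x} \<Longrightarrow> card (nbs E (R - {x}) t) =
        card (nbs E (R1 - {x}) t) + (if t = x then 1 else 0) + (if t = b then 1 else 0)"
      by (rule ear_step[OF psubset.hyps(1) xR deg1 singletonI ne]) (assumption, (rule that; assumption))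
    define R' where "R' = R1 - {x}"
    have e: "ear E R1 x zs x" using R1 by simp
    note ei = e[unfolded ear_iff]
    have "card (nbs E R' x) = 0" using R1(6)[of x] R1(1) c2 by (simp add: R'_def)
    moreover have "finite (nbs E R' x)" using psubset.hyps R1(2) by (simp add: R'_def nbs_def)
    ultimately have nx: "nbs E R' x = {}" by simp
    have R: "R = R' \<union> set (x # zs)" "x \<notin> R'" "set zs \<inter> R' = {}" "x \<notin> set zs"
      using R1 ei by (auto simp: R'_def)
    have xR': "(x, t) \<notin> E" "(t, x) \<notin> E" if "t \<in> R'" for t using nx that sE by (auto simp: nbs_def)
    have deg': "card (nbs E R' t) = 2" if "t \<in> R'" for t
    proof -
      have "nbs E R' t = nbs E R1 t" using xR'[OF that] by (auto simp: nbs_def R'_def)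
      then show ?thesis using R1(5)[of t] that by (auto simp: R'_def)
    qed
    have "R' \<subset> R" using R x by auto
    then have "\<exists>cs. (\<forall>k\<in>set cs. 3 \<le> k) \<and> sum_list cs = card R' \<and>
      (\<forall>(y :: 'r) d A B. (\<forall>t\<in>R'. d t = y) \<longrightarrow> A \<subseteq> U \<longrightarrow> B \<subseteq> U \<longrightarrow>
      perm_on (graph_weight E d) (A \<union> R') (B \<union> R') =
        (\<Prod>c\<leftarrow>cs. cycle_perm y c) * perm_on (graph_weight E d) A B)"
      using psubset.prems(1,2) deg' R by (intro psubset.IH) auto
    then obtain cs where cs: "\<forall>k\<in>set cs. 3 \<le> k" "sum_list cs = card R'"
      "\<And>y d A B. \<forall>t\<in>R'. d t = (y :: 'r) \<Longrightarrow> A \<subseteq> U \<Longrightarrow> B \<subseteq> U \<Longrightarrow>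
      perm_on (graph_weight E d) (A \<union> R') (B \<union> R') =
        (\<Prod>c\<leftarrow>cs. cycle_perm y c) * perm_on (graph_weight E d) A B" by blast
    have e2: "ear E (insert x (U \<union> R')) x zs x"
      unfolding ear_iff
    proof (intro conjI ballI)
      show "zs \<noteq> []" "x \<in> insert x (U \<union> R')" "x \<in> insert x (U \<union> R')" "x = x \<longrightarrow> 2 \<le> length zs" "distinct zs"
        using ei by auto
      show "set zs \<inter> insert x (U \<union> R') = {}" using R psubset.prems(1) by auto
      fix s t assume s: "s \<in> set zs" and t: "t \<in> insert x (U \<union> R') \<union> set zs"
      show "(s, t) \<in> E \<longleftrightarrow> (s, t) \<in> path_arcs (x # zs @ [x])"
      proof (cases "t \<in> U")
        case True
        then have "(s, t) \<notin> E" using psubset.prems(2)[of t s] s R sE by auto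
        moreover have "t \<notin> set (x # zs @ [x])" using True psubset.prems(1) R by auto
        then have "(s, t) \<notin> path_arcs (x # zs @ [x])" using path_arcsD(2) by metis
        ultimately show ?thesis by simp
      next
        case False
        then have "t \<in> R1 \<union> set zs" using t by (auto simp: R'_def R1(3)[simplified])
        then show ?thesis using ei s by blast
      qed
    qed
    show ?thesis
    proof (intro exI[of _ "Suc (length zs) # cs"] conjI allI impI)
      show "\<forall>k\<in>set (Suc (length zs) # cs). 3 \<le> k" using cs(1) ei by auto
      have "card (set (x # zs)) = Suc (length zs)" using ei R(4) by (simp add: distinct_card)
      moreover have "card R = card R' + card (set (x # zs))"
        unfolding R(1) using psubset.hyps R by (intro card_Un_disjoint) (auto simp: R'_def R1(2))
      ultimately show "sum_list (Suc (length zs) # cs) = card R" using cs(2) by simp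
      fix y :: 'r and d A B
      assume d: "\<forall>t\<in>R. d t = y" and A: "A \<subseteq> U" and B: "B \<subseteq> U"
      have AR: "A \<union> R = (A \<union> R') \<union> set (x # zs)" "B \<union> R = (B \<union> R') \<union> set (x # zs)" using R(1) by auto
      have "perm_on (graph_weight E d) ((A \<union> R') \<union> set (x # zs)) ((B \<union> R') \<union> set (x # zs)) =
        cycle_perm y (Suc (length zs)) * perm_on (graph_weight E d) (A \<union> R') (B \<union> R')"
      proof (rule perm_on_cycle[OF e2 symE])
        show "finite (U \<union> R')" using fin(1) psubset.hyps R(1) by simp
        show "x \<notin> U \<union> R'" using x psubset.prems(1) R(2) by auto
        show "A \<union> R' \<subseteq> U \<union> R'" "B \<union> R' \<subseteq> U \<union> R'" using A B by auto
        show "(x, t) \<notin> E" if "t \<in> U \<union> R'" for t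
          using that xR' psubset.prems(2)[of t x] x sE[of x t] by blast
        show "d t = y" if "t \<in> set (x # zs)" for t using d that R(1) by blast
      qed
      also have "perm_on (graph_weight E d) (A \<union> R') (B \<union> R') =
        (\<Prod>c\<leftarrow>cs. cycle_perm y c) * perm_on (graph_weight E d) A B"
        using d R(1) A B by (intro cs(3)) auto
      finally show "perm_on (graph_weight E d) (A \<union> R) (B \<union> R) =
        (\<Prod>c\<leftarrow>Suc (length zs) # cs. cycle_perm y c) * perm_on (graph_weight E d) A B"
        unfolding AR by (simp add: mult.assoc)
    qed
  qed
qed

end

section \<open>Removing ears at two branching vertices\<close>

lemma perm_on_single: "perm_on w {a} {b} = w a b"
  by (subst perm_on_expand_row[of _ _ a]) auto

text \<open>The diagonal of \<open>x I - Q\<close> for \<open>y = x - 2\<close> when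
  \<open>u\<close> and \<open>v\<close> have degree 3 and all other vertices degree 2.\<close>

definition theta_diag :: "'a \<Rightarrow> 'a \<Rightarrow> real \<Rightarrow> 'a \<Rightarrow> real" where
  "theta_diag u v y t = (if t = u \<or> t = v then y - 1 else y)"

definition theta_shape :: "('a \<times> 'a) set \<Rightarrow> 'a set \<Rightarrow> 'a \<Rightarrow> 'a \<Rightarrow> 'a list \<Rightarrow> 'a list \<Rightarrow> 'a list \<Rightarrow> bool" where
  "theta_shape E V u v xs ys zs \<longleftrightarrow> distinct (u # v # xs @ ys @ zs) \<and> V = set (u # v # xs @ ys @ zs) \<and>
     E \<inter> V \<times> V = path_arcs (u # xs @ [v]) \<union> path_arcs (u # ys @ [v]) \<union> path_arcs (u # zs @ [v])"

definition theta_perm :: "real \<Rightarrow> nat \<Rightarrow> nat \<Rightarrow> nat \<Rightarrow> real \<Rightarrow> real" where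
  "theta_perm y a b c K = fst (join_state y a (join_state y b (join_state y c (base_state y K))))"

definition dumbbell_perm :: "real \<Rightarrow> nat \<Rightarrow> nat \<Rightarrow> nat \<Rightarrow> real \<Rightarrow> real" where
  "dumbbell_perm y l g h K =
    fst (join_state y l (loop_state y g (swap_state (loop_state y h (swap_state (base_state y K))))))"

lemma fst_state: "fst (state E d u v V) = perm_on (graph_weight E d) V V"
  by (simp add: state_def)

lemma theta_shapeD:
  assumes "theta_shape E V u v xs ys zs"
  shows "distinct (u # v # xs @ ys @ zs)" "V = set (u # v # xs @ ys @ zs)"
    "E \<inter> V \<times> V = path_arcs (u # xs @ [v]) \<union> path_arcs (u # ys @ [v]) \<union> path_arcs (u # zs @ [v])"
  using assms unfolding theta_shape_def by blast+

text \<open>\<open>i\<close> and \<open>j\<close> count the edges from \<open>u\<close> and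
  \<open>v\<close> into the rest, not counting an edge between the two. While ears are removed the
  other vertices keep degree 2, so these numbers describe the stage reached.\<close>

definition branching :: "('a \<times> 'a) set \<Rightarrow> 'a \<Rightarrow> 'a \<Rightarrow> 'a set \<Rightarrow> nat \<Rightarrow> nat \<Rightarrow> bool" where
  "branching E u v V i j \<longleftrightarrow> finite V \<and> u \<in> V \<and> v \<in> V \<and>
     (\<forall>x\<in>V - {u, v}. card (nbs E V x) = 2) \<and>
     card (nbs E (V - {u, v}) u) = i \<and> card (nbs E (V - {u, v}) v) = j"

lemma branching_commute: "branching E u v V i j \<longleftrightarrow> branching E v u V j i"
  by (auto simp: branching_def insert_commute)

context
  fixes E :: "('a \<times> 'a) set" and u v :: 'a
  assumes symE: "sym E" and irreflE: "irrefl E" and uv: "u \<noteq> v"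
begin

text \<open>If no edge leaves \<open>{u, v}\<close>, the remaining vertices form disjoint cycles.\<close>

lemma branching_base:
  assumes b: "branching E u v V 0 0"
  obtains cs where "\<And>k. k \<in> set cs \<Longrightarrow> 3 \<le> k" "card V = 2 + sum_list cs"
    "\<And>y. state E (theta_diag u v y) u v V =
      (if (u, v) \<in> E then join_state y 1 (base_state y (\<Prod>c\<leftarrow>cs. cycle_perm y c))
       else base_state y (\<Prod>c\<leftarrow>cs. cycle_perm y c))"
proof -
  define R where "R = V - {u, v}"
  have fin: "finite V" "finite R" and V: "V = {u, v} \<union> R" and uvR: "u \<notin> R" "v \<notin> R"
    using b by (auto simp: branching_def R_def)
  have n0: "nbs E R u = {}" "nbs E R v = {}"
    using b fin by (auto simp: branching_def R_def[symmetric] nbs_def)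
  note sE = sym_iff[OF symE]
  have sep: "(s, t) \<notin> E" if "s \<in> {u, v}" "t \<in> R" for s t using n0 that by (auto simp: nbs_def)
  have deg: "card (nbs E R x) = 2" if "x \<in> R" for x
  proof -
    have "nbs E R x = nbs E V x" using sep that sE by (auto simp: nbs_def V)
    then show ?thesis using b that by (auto simp: branching_def R_def)
  qed
  have "\<exists>cs. (\<forall>k\<in>set cs. 3 \<le> k) \<and> sum_list cs = card R \<and>
    (\<forall>(y :: real) d A B. (\<forall>t\<in>R. d t = y) \<longrightarrow> A \<subseteq> {u, v} \<longrightarrow> B \<subseteq> {u, v} \<longrightarrow>
      perm_on (graph_weight E d) (A \<union> R) (B \<union> R) =
        (\<Prod>c\<leftarrow>cs. cycle_perm y c) * perm_on (graph_weight E d) A B)"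
    using sep deg fin uvR by (intro cycle_decomposition[OF symE irreflE]) auto
  then obtain cs where cs: "\<forall>k\<in>set cs. 3 \<le> k" "sum_list cs = card R" and
    p: "\<And>y d A B. \<forall>t\<in>R. d t = (y :: real) \<Longrightarrow> A \<subseteq> {u, v} \<Longrightarrow> B \<subseteq> {u, v} \<Longrightarrow>
      perm_on (graph_weight E d) (A \<union> R) (B \<union> R) =
        (\<Prod>c\<leftarrow>cs. cycle_perm y c) * perm_on (graph_weight E d) A B" by blast
  show ?thesis
  proof (rule that)
    show "\<And>k. k \<in> set cs \<Longrightarrow> 3 \<le> k" using cs by auto
    show "card V = 2 + sum_list cs" using cs(2) uv uvR fin by (simp add: V)
    fix y
    let ?W = "graph_weight E (theta_diag u v y)"
    define K where "K = (\<Prod>c\<leftarrow>cs. cycle_perm y c)"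
    have d: "\<forall>t\<in>R. theta_diag u v y t = y" using uvR by (auto simp: theta_diag_def)
    note q = p[OF d, folded K_def]
    have s: "V - {u} = {v} \<union> R" "V - {v} = {u} \<union> R" "V - {u, v} = {} \<union> R" using uv uvR by (auto simp: V)
    have st: "state E (theta_diag u v y) u v V = (K * perm_on ?W {u, v} {u, v}, K * perm_on ?W {v} {v},
      K * perm_on ?W {u} {u}, K * perm_on ?W {} {}, K * perm_on ?W {v} {u})"
      unfolding state_def s prod.inject
    proof (intro conjI)
      show "perm_on ?W V V = K * perm_on ?W {u, v} {u, v}"
        by (rule q[OF subset_refl subset_refl, folded V])
    qed (rule q; simp)+
    have w: "?W u u = y - 1" "?W v v = y - 1" by (simp_all add: graph_weight_def theta_diag_def)
    have w': "?W v u = (if (u, v) \<in> E then - 1 else 0)" "?W u v = (if (u, v) \<in> E then - 1 else 0)"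
      using uv sE[of u v] by (simp_all add: graph_weight_def)
    have "perm_on ?W {u, v} {u, v} = ?W u u * perm_on ?W {v} {v}
      + (\<Sum>t\<in>{v}. \<Sum>s\<in>{v}. ?W u t * ?W s u * perm_minor ?W {v} {v} s t)"
      using uv by (intro perm_on_insert_both) auto
    then have "perm_on ?W {u, v} {u, v} = (y - 1)\<^sup>2 + (if (u, v) \<in> E then 1 else 0)"
      by (simp add: perm_on_single w w' perm_minor_def power2_eq_square)
    then show "state E (theta_diag u v y) u v V =
      (if (u, v) \<in> E then join_state y 1 (base_state y (\<Prod>c\<leftarrow>cs. cycle_perm y c))
       else base_state y (\<Prod>c\<leftarrow>cs. cycle_perm y c))"
      unfolding st K_def[symmetric] join_base_state by (simp add: base_state_def perm_on_single w w')
  qed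
qed

text \<open>An ear that starts at \<open>u\<close> ends at \<open>v\<close>, using one edge at each,
  or returns to \<open>u\<close> and uses two edges there.\<close>

lemma branching_step:
  assumes b: "branching E u v V (Suc i) j"
  obtains U zs j' where "j = Suc j'" "branching E u v U i j'" "ear E U u zs v" "V = U \<union> set zs"
  | U zs i' where "i = Suc i'" "branching E u v U i' j" "ear E U u zs u" "V = U \<union> set zs"
proof -
  have fin: "finite V" and SV: "{u, v} \<subseteq> V" and ne: "nbs E (V - {u, v}) u \<noteq> {}" and uS: "u \<in> {u, v}"
    using b by (auto simp: branching_def)
  have deg: "card (nbs E V x) = 2" if "x \<in> V - {u, v}" for x using b that by (auto simp: branching_def)
  obtain U zs w where U: "w \<in> {u, v}" "V = U \<union> set zs" "{u, v} \<subseteq> U" "ear E U u zs w"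
    "\<And>x. x \<in> U - {u, v} \<Longrightarrow> card (nbs E U x) = 2"
    "\<And>t. t \<in> {u, v} \<Longrightarrow> card (nbs E (V - {u, v}) t) =
       card (nbs E (U - {u, v}) t) + (if t = u then 1 else 0) + (if t = w then 1 else 0)"
    by (rule ear_step[OF symE irreflE fin SV deg uS ne]) (assumption, (rule that; assumption))
  have c: "card (nbs E (V - {u, v}) u) = Suc i" "card (nbs E (V - {u, v}) v) = j"
    using b by (auto simp: branching_def)
  have br: "branching E u v U (card (nbs E (U - {u, v}) u)) (card (nbs E (U - {u, v}) v))"
    using U(3,5) fin by (auto simp: branching_def U(2))
  show ?thesis
  proof (cases "w = u")
    case True
    then have "card (nbs E (U - {u, v}) v) = j" "i = Suc (card (nbs E (U - {u, v}) u))"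
      using U(6)[of u] U(6)[of v] c uv by auto
    then show ?thesis using that(2) br U True by blast
  next
    case False
    then have w: "w = v" using U(1) by simp
    then have "j = Suc (card (nbs E (U - {u, v}) v))" "card (nbs E (U - {u, v}) u) = i"
      using U(6)[of u] U(6)[of v] c uv by auto
    then show ?thesis using that(1) br U w by blast
  qed
qed

end

context
  fixes E :: "('a \<times> 'a) set" and u v :: 'a
  assumes symE: "sym E" and irreflE: "irrefl E" and uv: "u \<noteq> v"
begin

lemma branching_1_1:
  assumes b: "branching E u v V 1 1"
  obtains U zs where "branching E u v U 0 0" "ear E U u zs v" "V = U \<union> set zs"
proof -
  have b': "branching E u v V (Suc 0) 1" using b by simp
  show ?thesis
  proof (rule branching_step[OF symE irreflE uv b'])
    fix U zs j' assume *: "1 = Suc j'" "branching E u v U 0 j'" "ear E U u zs v" "V = U \<union> set zs"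
    then have "j' = 0" by simp
    then show ?thesis using *(2) by (intro that[OF _ *(3,4)]) simp
  qed auto
qed

text \<open>No edges are left at \<open>u\<close>, so the ear starts at \<open>v\<close>: the step
  is applied with \<open>u\<close> and \<open>v\<close> exchanged, and the ear has to
  return.\<close>

lemma branching_0_2:
  assumes b: "branching E u v V 0 2"
  obtains U zs where "branching E u v U 0 0" "ear E U v zs v" "V = U \<union> set zs"
proof -
  have b': "branching E v u V (Suc 1) 0" using b branching_commute[of E u v V 0 2] by (simp add: numeral_2_eq_2)
  show ?thesis
  proof (rule branching_step[OF symE irreflE uv[symmetric] b'])
    fix U zs i' assume *: "1 = Suc i'" "branching E v u U i' 0" "ear E U v zs v" "V = U \<union> set zs"
    then have "i' = 0" by simp
    then have "branching E u v U 0 0" using *(2) branching_commute[of E v u U 0 0] by simp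
    then show ?thesis using *(3,4) by (rule that)
  qed auto
qed

lemma branching_2_2:
  assumes b: "branching E u v V 2 2"
  obtains U xs ys where "branching E u v U 0 0" "ear E U u xs v" "ear E (U \<union> set xs) u ys v"
    "V = U \<union> set xs \<union> set ys"
  | U xs ys where "branching E u v U 0 0" "ear E U v xs v" "ear E (U \<union> set xs) u ys u"
    "V = U \<union> set xs \<union> set ys"
proof -
  have b': "branching E u v V (Suc 1) 2" using b by (simp add: numeral_2_eq_2)
  show ?thesis
  proof (rule branching_step[OF symE irreflE uv b'])
    fix U zs j' assume *: "2 = Suc j'" "branching E u v U 1 j'" "ear E U u zs v" "V = U \<union> set zs"
    then have "j' = 1" by simp
    then have "branching E u v U 1 1" using *(2) by simp
    then obtain U' xs where "branching E u v U' 0 0" "ear E U' u xs v" "U = U' \<union> set xs" by (rule branching_1_1)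
    then show ?thesis using *(3,4) by (intro that(1)[of U' xs zs]) simp_all
  next
    fix U zs i' assume *: "1 = Suc i'" "branching E u v U i' 2" "ear E U u zs u" "V = U \<union> set zs"
    then have "i' = 0" by simp
    then have "branching E u v U 0 2" using *(2) by simp
    then obtain U' xs where "branching E u v U' 0 0" "ear E U' v xs v" "U = U' \<union> set xs" by (rule branching_0_2)
    then show ?thesis using *(3,4) by (intro that(2)[of U' xs zs]) simp_all
  qed
qed

text \<open>Either all three ears join \<open>u\<close> and \<open>v\<close>, or each of the two
  carries a closed ear and one ear joins them. The last two alternatives differ only in whether the
  joining ear is removed before or after the closed ear at \<open>u\<close>.\<close>

lemma branching_3_3:
  assumes b: "branching E u v V 3 3"
  obtains U xs ys zs where "branching E u v U 0 0" "ear E U u xs v" "ear E (U \<union> set xs) u ys v"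
    "ear E (U \<union> set xs \<union> set ys) u zs v" "V = U \<union> set xs \<union> set ys \<union> set zs"
  | U xs ys zs where "branching E u v U 0 0" "ear E U v xs v" "ear E (U \<union> set xs) u ys u"
    "ear E (U \<union> set xs \<union> set ys) u zs v" "V = U \<union> set xs \<union> set ys \<union> set zs"
  | U xs ys zs where "branching E u v U 0 0" "ear E U v xs v" "ear E (U \<union> set xs) u ys v"
    "ear E (U \<union> set xs \<union> set ys) u zs u" "V = U \<union> set xs \<union> set ys \<union> set zs"
proof -
  have b': "branching E u v V (Suc 2) 3" using b by (simp add: eval_nat_numeral)
  show ?thesis
  proof (rule branching_step[OF symE irreflE uv b'])
    fix U zs j' assume *: "3 = Suc j'" "branching E u v U 2 j'" "ear E U u zs v" "V = U \<union> set zs"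
    then have "j' = 2" by simp
    then have "branching E u v U 2 2" using *(2) by simp
    then show ?thesis
    proof (rule branching_2_2)
      fix U' xs ys assume "branching E u v U' 0 0" "ear E U' u xs v" "ear E (U' \<union> set xs) u ys v"
        "U = U' \<union> set xs \<union> set ys"
      then show ?thesis using *(3,4) by (intro that(1)[of U' xs ys zs]) simp_all
    next
      fix U' xs ys assume "branching E u v U' 0 0" "ear E U' v xs v" "ear E (U' \<union> set xs) u ys u"
        "U = U' \<union> set xs \<union> set ys"
      then show ?thesis using *(3,4) by (intro that(2)[of U' xs ys zs]) simp_all
    qed
  next
    fix U zs i' assume *: "2 = Suc i'" "branching E u v U i' 3" "ear E U u zs u" "V = U \<union> set zs"
    then have "i' = Suc 0" by simp
    then have "branching E u v U (Suc 0) 3" using *(2) by simp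
    then show ?thesis
    proof (rule branching_step[OF symE irreflE uv])
      fix U' zs' j' assume **: "3 = Suc j'" "branching E u v U' 0 j'" "ear E U' u zs' v" "U = U' \<union> set zs'"
      then have "j' = 2" by simp
      then have "branching E u v U' 0 2" using **(2) by simp
      then obtain U1 xs where "branching E u v U1 0 0" "ear E U1 v xs v" "U' = U1 \<union> set xs" by (rule branching_0_2)
      then show ?thesis using *(3,4) **(3,4) by (intro that(3)[of U1 xs zs' zs]) simp_all
    qed auto
  qed
qed

lemma theta_diag_ear: "u \<in> U \<Longrightarrow> v \<in> U \<Longrightarrow> ear E U a zs b \<Longrightarrow> t \<in> set zs \<Longrightarrow> theta_diag u v y t = y"
  using ear_disjoint[of E U a zs b] by (auto simp: theta_diag_def)

lemma branching_finite: "branching E u v V i j \<Longrightarrow> finite V" "branching E u v V i j \<Longrightarrow> u \<in> V"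
   "branching E u v V i j \<Longrightarrow> v \<in> V"
  by (auto simp: branching_def)

lemma state_join_theta:
  "ear E U u zs v \<Longrightarrow> finite U \<Longrightarrow> state E (theta_diag u v y) u v (U \<union> set zs) =
    join_state y (Suc (length zs)) (state E (theta_diag u v y) u v U)"
  by (intro state_join symE uv) (auto intro: theta_diag_ear simp: ear_def)

lemma state_loop_theta:
  "ear E U u zs u \<Longrightarrow> finite U \<Longrightarrow> v \<in> U \<Longrightarrow> state E (theta_diag u v y) u v (U \<union> set zs) =
    loop_state y (Suc (length zs)) (state E (theta_diag u v y) u v U)"
  by (intro state_loop symE uv) (auto intro: theta_diag_ear simp: ear_def)

lemma state_loop_theta':
  "ear E U v zs v \<Longrightarrow> finite U \<Longrightarrow> u \<in> U \<Longrightarrow> state E (theta_diag u v y) u v (U \<union> set zs) =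
    swap_state (loop_state y (Suc (length zs)) (swap_state (state E (theta_diag u v y) u v U)))"
  by (intro state_loop' symE uv) (auto intro: theta_diag_ear simp: ear_def)

lemma card_ear:
  assumes "ear E U a zs b" "finite U"
  shows "card (U \<union> set zs) = card U + length zs" "a = b \<Longrightarrow> 2 \<le> length zs" "zs \<noteq> []"
proof -
  note e = assms(1)[unfolded ear_iff[OF symE irreflE]]
  have "card (U \<union> set zs) = card U + card (set zs)" using assms(2) e by (intro card_Un_disjoint) auto
  then show "card (U \<union> set zs) = card U + length zs" using e by (simp add: distinct_card)
  show "a = b \<Longrightarrow> 2 \<le> length zs" "zs \<noteq> []" using e by auto
qed

lemma theta_shape_ears:
  assumes "U = {u, v} \<union> set xs" "distinct (u # v # xs)" "E \<inter> U \<times> U = path_arcs (u # xs @ [v])"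
    and "ear E U u ys v" "ear E (U \<union> set ys) u zs v"
  shows "theta_shape E (U \<union> set ys \<union> set zs) u v xs ys zs"
proof -
  note e1 = assms(4)[unfolded ear_iff[OF symE irreflE]]
  note e2 = assms(5)[unfolded ear_iff[OF symE irreflE]]
  have d: "distinct ys" "distinct zs" "set ys \<inter> U = {}" "set zs \<inter> (U \<union> set ys) = {}"
    using e1 e2 by blast+
  show ?thesis
    unfolding theta_shape_def
  proof (intro conjI)
    show "distinct (u # v # xs @ ys @ zs)" using d assms(1,2) by auto
    show "U \<union> set ys \<union> set zs = set (u # v # xs @ ys @ zs)" using assms(1) by auto
    show "E \<inter> (U \<union> set ys \<union> set zs) \<times> (U \<union> set ys \<union> set zs) =
      path_arcs (u # xs @ [v]) \<union> path_arcs (u # ys @ [v]) \<union> path_arcs (u # zs @ [v])"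
      unfolding ear_arcs[OF symE irreflE assms(5)] ear_arcs[OF symE irreflE assms(4)] assms(3) ..
  qed
qed

lemma theta_shape_base:
  shows "E \<inter> {u, v} \<times> {u, v} = (if (u, v) \<in> E then path_arcs (u # [] @ [v]) else {})"
proof -
  have "(u, v) \<in> E \<longleftrightarrow> (v, u) \<in> E" using symE by (auto simp: sym_def)
  moreover have "(u, u) \<notin> E" "(v, v) \<notin> E" using irreflE by (auto simp: irrefl_def)
  ultimately show ?thesis by (auto simp: path_arcs_Cons)
qed

text \<open>\<open>card V + 1\<close> is the number of edges. An edge between \<open>u\<close> and
  \<open>v\<close> replaces one ear: it is the path with empty interior \<open>xs\<close> of a theta
  graph, or the connecting path with \<open>l = 1\<close> of a dumbbell. The shape is recorded only
  when there are no disjoint cycles, the other cases being excluded by the polynomial.\<close>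

theorem branching_classification:
  assumes b: "branching E u v V n n" and n: "n = (if (u, v) \<in> E then 2 else 3)"
  obtains cs xs ys zs where "\<And>k. k \<in> set cs \<Longrightarrow> 3 \<le> k" "ys \<noteq> []" "zs \<noteq> []"
    "card V + 1 = Suc (length zs) + Suc (length ys) + Suc (length xs) + sum_list cs"
    "\<And>y. perm_on (graph_weight E (theta_diag u v y)) V V =
      theta_perm y (Suc (length zs)) (Suc (length ys)) (Suc (length xs)) (\<Prod>c\<leftarrow>cs. cycle_perm y c)"
    "cs = [] \<Longrightarrow> theta_shape E V u v xs ys zs"
  | cs l g h where "\<And>k. k \<in> set cs \<Longrightarrow> 3 \<le> k" "1 \<le> l" "3 \<le> g" "3 \<le> h"
    "card V + 1 = l + g + h + sum_list cs"
    "\<And>y. perm_on (graph_weight E (theta_diag u v y)) V V =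
      dumbbell_perm y l g h (\<Prod>c\<leftarrow>cs. cycle_perm y c)"
proof -
  have core: "\<exists>cs. (\<forall>k\<in>set cs. 3 \<le> k) \<and> card U = 2 + sum_list cs \<and> (cs = [] \<longrightarrow> U = {u, v}) \<and> finite U \<and>
      u \<in> U \<and> v \<in> U \<and> (\<forall>y. state E (theta_diag u v y) u v U = (if (u, v) \<in> E
        then join_state y 1 (base_state y (\<Prod>c\<leftarrow>cs. cycle_perm y c))
        else base_state y (\<Prod>c\<leftarrow>cs. cycle_perm y c)))" if U: "branching E u v U 0 0" for U
  proof -
    obtain cs where cs: "\<And>k. k \<in> set cs \<Longrightarrow> 3 \<le> k" "card U = 2 + sum_list cs"
      "\<And>y. state E (theta_diag u v y) u v U = (if (u, v) \<in> E
        then join_state y 1 (base_state y (\<Prod>c\<leftarrow>cs. cycle_perm y c))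
        else base_state y (\<Prod>c\<leftarrow>cs. cycle_perm y c))"
      using branching_base[OF symE irreflE uv U] by blast
    have "U = {u, v}" if "cs = []"
    proof -
      have "card {u, v} = card U" using cs(2) that uv by simp
      then show ?thesis using branching_finite[OF U] card_subset_eq[of U "{u, v}"] by auto
    qed
    then show ?thesis using cs branching_finite[OF U] by (intro exI[of _ cs]) auto
  qed
  show ?thesis
  proof (cases "(u, v) \<in> E")
    case True
    then have "branching E u v V 2 2" using b n by simp
    then show ?thesis
    proof (rule branching_2_2)
      fix U xs ys assume U: "branching E u v U 0 0" "ear E U u xs v" "ear E (U \<union> set xs) u ys v"
        "V = U \<union> set xs \<union> set ys"
      from core[OF U(1)] True obtain cs where cs: "\<forall>k\<in>set cs. 3 \<le> k" "card U = 2 + sum_list cs"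
        "cs = [] \<longrightarrow> U = {u, v}" "finite U" "u \<in> U" "v \<in> U"
        "\<And>y. state E (theta_diag u v y) u v U = join_state y 1 (base_state y (\<Prod>c\<leftarrow>cs. cycle_perm y c))"
        by auto
      have fin: "finite (U \<union> set xs)" using cs(4) by simp
      show ?thesis
      proof (rule that(1)[of cs xs ys "[]"])
        show "3 \<le> k" if "k \<in> set cs" for k using cs(1) that by blast
        show "xs \<noteq> []" "ys \<noteq> []" using card_ear(3)[OF U(2) cs(4)] card_ear(3)[OF U(3) fin] .
        show "card V + 1 = Suc (length ys) + Suc (length xs) + Suc (length []) + sum_list cs"
          using card_ear(1)[OF U(2) cs(4)] card_ear(1)[OF U(3) fin] cs(2) U(4) by simp
        show "perm_on (graph_weight E (theta_diag u v y)) V V =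
          theta_perm y (Suc (length ys)) (Suc (length xs)) (Suc (length [])) (\<Prod>c\<leftarrow>cs. cycle_perm y c)" for y
          unfolding fst_state[of E _ u v, symmetric] U(4) theta_perm_def state_join_theta[OF U(3) fin]
            state_join_theta[OF U(2) cs(4)] cs(7) by simp
        show "theta_shape E V u v [] xs ys" if "cs = []"
          unfolding U(4)
        proof (rule theta_shape_ears[OF _ _ _ U(2,3)])
          have "U = {u, v}" using cs(3) that by simp
          then show "U = {u, v} \<union> set []" "E \<inter> U \<times> U = path_arcs (u # [] @ [v])"
            using theta_shape_base True by simp_all
          show "distinct (u # v # [])" using uv by simp
        qed
      qed
    next
      fix U xs ys assume U: "branching E u v U 0 0" "ear E U v xs v" "ear E (U \<union> set xs) u ys u"
        "V = U \<union> set xs \<union> set ys"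
      from core[OF U(1)] True obtain cs where cs: "\<forall>k\<in>set cs. 3 \<le> k" "card U = 2 + sum_list cs"
        "cs = [] \<longrightarrow> U = {u, v}" "finite U" "u \<in> U" "v \<in> U"
        "\<And>y. state E (theta_diag u v y) u v U = join_state y 1 (base_state y (\<Prod>c\<leftarrow>cs. cycle_perm y c))"
        by auto
      have fin: "finite (U \<union> set xs)" and vU: "v \<in> U \<union> set xs" using cs(4,6) by simp_all
      show ?thesis
      proof (rule that(2)[of cs 1 "Suc (length ys)" "Suc (length xs)"])
        show "3 \<le> k" if "k \<in> set cs" for k using cs(1) that by blast
        show "3 \<le> Suc (length ys)" "3 \<le> Suc (length xs)"
          using card_ear(2)[OF U(2) cs(4)] card_ear(2)[OF U(3) fin] by simp_all
        show "card V + 1 = 1 + Suc (length ys) + Suc (length xs) + sum_list cs"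
          using card_ear(1)[OF U(2) cs(4)] card_ear(1)[OF U(3) fin] cs(2) U(4) by simp
        \<comment> \<open>The edge between \<open>u\<close> and \<open>v\<close> belongs to the core
          and is attached before the cycles; commutation moves it to the outermost place.\<close>
        show "perm_on (graph_weight E (theta_diag u v y)) V V =
          dumbbell_perm y 1 (Suc (length ys)) (Suc (length xs)) (\<Prod>c\<leftarrow>cs. cycle_perm y c)" for y
          unfolding fst_state[of E _ u v, symmetric] U(4) dumbbell_perm_def state_loop_theta[OF U(3) fin vU]
            state_loop_theta'[OF U(2) cs(4,5)] cs(7) loop_join_commute' loop_join_commute ..
      qed simp
    qed
  next
    case False
    then have "branching E u v V 3 3" using b n by simp
    then show ?thesis
    proof (rule branching_3_3)
      fix U xs ys zs assume U: "branching E u v U 0 0" "ear E U u xs v" "ear E (U \<union> set xs) u ys v"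
        "ear E (U \<union> set xs \<union> set ys) u zs v" "V = U \<union> set xs \<union> set ys \<union> set zs"
      from core[OF U(1)] False obtain cs where cs: "\<forall>k\<in>set cs. 3 \<le> k" "card U = 2 + sum_list cs"
        "cs = [] \<longrightarrow> U = {u, v}" "finite U" "u \<in> U" "v \<in> U"
        "\<And>y. state E (theta_diag u v y) u v U = base_state y (\<Prod>c\<leftarrow>cs. cycle_perm y c)"
        by auto
      have fin: "finite (U \<union> set xs)" "finite (U \<union> set xs \<union> set ys)" using cs(4) by simp_all
      note c = card_ear[OF U(2) cs(4)] card_ear[OF U(3) fin(1)] card_ear[OF U(4) fin(2)]
      show ?thesis
      proof (rule that(1)[of cs ys zs xs])
        show "3 \<le> k" if "k \<in> set cs" for k using cs(1) that by blast
        show "ys \<noteq> []" "zs \<noteq> []" using c(6,9) .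
        show "card V + 1 = Suc (length zs) + Suc (length ys) + Suc (length xs) + sum_list cs"
          using c(1,4,7) cs(2) U(5) by simp
        show "perm_on (graph_weight E (theta_diag u v y)) V V =
          theta_perm y (Suc (length zs)) (Suc (length ys)) (Suc (length xs)) (\<Prod>c\<leftarrow>cs. cycle_perm y c)" for y
          unfolding fst_state[of E _ u v, symmetric] U(5) theta_perm_def state_join_theta[OF U(4) fin(2)]
            state_join_theta[OF U(3) fin(1)] state_join_theta[OF U(2) cs(4)] cs(7) ..
        show "theta_shape E V u v xs ys zs" if "cs = []"
          unfolding U(5)
        proof (rule theta_shape_ears[OF _ _ _ U(3,4)])
          have Uuv: "U = {u, v}" using cs(3) that by simp
          then show "U \<union> set xs = {u, v} \<union> set xs" by simp
          have "E \<inter> U \<times> U = {}" using theta_shape_base False Uuv by simp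
          then show "E \<inter> (U \<union> set xs) \<times> (U \<union> set xs) = path_arcs (u # xs @ [v])"
            using ear_arcs[OF symE irreflE U(2)] by simp
          show "distinct (u # v # xs)"
            using U(2)[unfolded ear_iff[OF symE irreflE]] uv by auto
        qed
      qed
    next
      fix U xs ys zs assume U: "branching E u v U 0 0" "ear E U v xs v" "ear E (U \<union> set xs) u ys u"
        "ear E (U \<union> set xs \<union> set ys) u zs v" "V = U \<union> set xs \<union> set ys \<union> set zs"
      from core[OF U(1)] False obtain cs where cs: "\<forall>k\<in>set cs. 3 \<le> k" "card U = 2 + sum_list cs"
        "cs = [] \<longrightarrow> U = {u, v}" "finite U" "u \<in> U" "v \<in> U"
        "\<And>y. state E (theta_diag u v y) u v U = base_state y (\<Prod>c\<leftarrow>cs. cycle_perm y c)"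
        by auto
      have fin: "finite (U \<union> set xs)" "finite (U \<union> set xs \<union> set ys)" and vU: "v \<in> U \<union> set xs"
        using cs(4,6) by simp_all
      note c = card_ear[OF U(2) cs(4)] card_ear[OF U(3) fin(1)] card_ear[OF U(4) fin(2)]
      show ?thesis
      proof (rule that(2)[of cs "Suc (length zs)" "Suc (length ys)" "Suc (length xs)"])
        show "3 \<le> k" if "k \<in> set cs" for k using cs(1) that by blast
        show "3 \<le> Suc (length ys)" "3 \<le> Suc (length xs)" using c(2,5) by simp_all
        show "card V + 1 = Suc (length zs) + Suc (length ys) + Suc (length xs) + sum_list cs"
          using c(1,4,7) cs(2) U(5) by simp
        show "perm_on (graph_weight E (theta_diag u v y)) V V =
          dumbbell_perm y (Suc (length zs)) (Suc (length ys)) (Suc (length xs)) (\<Prod>c\<leftarrow>cs. cycle_perm y c)" for y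
          unfolding fst_state[of E _ u v, symmetric] U(5) dumbbell_perm_def state_join_theta[OF U(4) fin(2)]
            state_loop_theta[OF U(3) fin(1) vU] state_loop_theta'[OF U(2) cs(4,5)] cs(7) ..
      qed simp
    next
      fix U xs ys zs assume U: "branching E u v U 0 0" "ear E U v xs v" "ear E (U \<union> set xs) u ys v"
        "ear E (U \<union> set xs \<union> set ys) u zs u" "V = U \<union> set xs \<union> set ys \<union> set zs"
      from core[OF U(1)] False obtain cs where cs: "\<forall>k\<in>set cs. 3 \<le> k" "card U = 2 + sum_list cs"
        "cs = [] \<longrightarrow> U = {u, v}" "finite U" "u \<in> U" "v \<in> U"
        "\<And>y. state E (theta_diag u v y) u v U = base_state y (\<Prod>c\<leftarrow>cs. cycle_perm y c)"
        by auto
      have fin: "finite (U \<union> set xs)" "finite (U \<union> set xs \<union> set ys)" and vU: "v \<in> U \<union> set xs \<union> set ys"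
        using cs(4,6) by simp_all
      note c = card_ear[OF U(2) cs(4)] card_ear[OF U(3) fin(1)] card_ear[OF U(4) fin(2)]
      show ?thesis
      proof (rule that(2)[of cs "Suc (length ys)" "Suc (length zs)" "Suc (length xs)"])
        show "3 \<le> k" if "k \<in> set cs" for k using cs(1) that by blast
        show "3 \<le> Suc (length zs)" "3 \<le> Suc (length xs)" using c(2,8) by simp_all
        show "card V + 1 = Suc (length ys) + Suc (length zs) + Suc (length xs) + sum_list cs"
          using c(1,4,7) cs(2) U(5) by simp
        show "perm_on (graph_weight E (theta_diag u v y)) V V =
          dumbbell_perm y (Suc (length ys)) (Suc (length zs)) (Suc (length xs)) (\<Prod>c\<leftarrow>cs. cycle_perm y c)" for y
          unfolding fst_state[of E _ u v, symmetric] U(5) dumbbell_perm_def state_loop_theta[OF U(4) fin(2) vU]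
            state_join_theta[OF U(3) fin(1)] state_loop_theta'[OF U(2) cs(4,5)] cs(7) loop_join_commute ..
      qed simp
    qed
  qed
qed

lemma theta_shape_swap:
  assumes "theta_shape E V u v xs ys zs"
  shows "theta_shape E V u v ys xs zs" "theta_shape E V u v xs zs ys"
proof -
  note d = theta_shapeD(1)[OF assms] and V = theta_shapeD(2)[OF assms] and E = theta_shapeD(3)[OF assms]
  show "theta_shape E V u v ys xs zs"
    unfolding theta_shape_def
  proof (intro conjI)
    show "distinct (u # v # ys @ xs @ zs)" using d by auto
    show "V = set (u # v # ys @ xs @ zs)" unfolding V by auto
  qed (unfold E, blast)
  show "theta_shape E V u v xs zs ys"
    unfolding theta_shape_def
  proof (intro conjI)
    show "distinct (u # v # xs @ zs @ ys)" using d by auto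
    show "V = set (u # v # xs @ zs @ ys)" unfolding V by auto
  qed (unfold E, blast)
qed

lemma theta_shape_imp_ear:
  assumes s: "theta_shape E V u v xs ys zs" and ne: "zs \<noteq> []"
  shows "ear E ({u, v} \<union> set xs \<union> set ys) u zs v"
  unfolding ear_iff[OF symE irreflE]
proof (intro conjI ballI)
  let ?U = "{u, v} \<union> set xs \<union> set ys"
  note d = theta_shapeD(1)[OF s] and V' = theta_shapeD(2)[OF s] and E = theta_shapeD(3)[OF s]
  have V: "V = ?U \<union> set zs" unfolding V' by auto
  show "zs \<noteq> []" "u \<in> ?U" "v \<in> ?U" "u = v \<longrightarrow> 2 \<le> length zs" "distinct zs" "set zs \<inter> ?U = {}"
    using d ne by auto
  fix x t assume x: "x \<in> set zs" "t \<in> ?U \<union> set zs"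
  then have "(x, t) \<in> E \<longleftrightarrow> (x, t) \<in> E \<inter> V \<times> V" by (simp add: V)
  also have "\<dots> \<longleftrightarrow> (x, t) \<in> path_arcs (u # zs @ [v])"
  proof -
    have "x \<notin> set (u # xs @ [v])" "x \<notin> set (u # ys @ [v])" using d x by auto
    then have "(x, t) \<notin> path_arcs (u # xs @ [v])" "(x, t) \<notin> path_arcs (u # ys @ [v])"
      using path_arcsD(1)[of x t] by blast+
    then show ?thesis unfolding E by blast
  qed
  finally show "(x, t) \<in> E \<longleftrightarrow> (x, t) \<in> path_arcs (u # zs @ [v])" .
qed

end

section \<open>Degrees and permanent of a theta graph\<close>

lemma path_arcs_append:
  "xs \<noteq> [] \<Longrightarrow> ys \<noteq> [] \<Longrightarrow>
    path_arcs (xs @ ys) = path_arcs xs \<union> {(last xs, hd ys), (hd ys, last xs)} \<union> path_arcs ys"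
  by (induction xs) (auto simp: path_arcs_Cons)

lemma path_arcs_interior_degree:
  assumes "distinct (a # zs @ [b])" "x \<in> set zs"
  shows "card {t. (x, t) \<in> path_arcs (a # zs @ [b])} = 2"
proof -
  obtain ys ws where zs: "zs = ys @ x # ws" using assms(2) by (meson split_list)
  define l h where "l = last (a # ys)" and "h = hd (ws @ [b])"
  have "path_arcs (a # zs @ [b]) = path_arcs ((a # ys) @ (x # ws @ [b]))" by (simp add: zs)
  also have "\<dots> = path_arcs (a # ys) \<union> {(l, hd (x # ws @ [b])), (hd (x # ws @ [b]), l)} \<union> path_arcs (x # ws @ [b])"
    unfolding l_def by (rule path_arcs_append) simp_all
  also have "path_arcs (x # ws @ [b]) = {(x, h), (h, x)} \<union> path_arcs (ws @ [b])"
    unfolding h_def by (rule path_arcs_Cons) simp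
  finally have p: "path_arcs (a # zs @ [b]) = path_arcs (a # ys) \<union> {(l, x), (x, l)} \<union>
    ({(x, h), (h, x)} \<union> path_arcs (ws @ [b]))" by simp
  have "x \<notin> set (a # ys)" "x \<notin> set (ws @ [b])" using assms(1) by (auto simp: zs)
  then have n: "(x, t) \<notin> path_arcs (a # ys)" "(x, t) \<notin> path_arcs (ws @ [b])" for t
    using path_arcsD(1)[of x t "a # ys"] path_arcsD(1)[of x t "ws @ [b]"] by auto
  have "l \<in> insert a (set ys)" unfolding l_def using last_in_set[of "a # ys"] by simp
  moreover have "h \<in> insert b (set ws)" unfolding h_def by (rule hd_append_mem)
  moreover have "insert a (set ys) \<inter> insert b (set ws) = {}" "x \<notin> insert a (set ys)" "x \<notin> insert b (set ws)"
    using assms(1) by (auto simp: zs)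
  ultimately have lh: "l \<noteq> h" "l \<noteq> x" "h \<noteq> x" by auto
  have "(x, t) \<in> path_arcs (a # zs @ [b]) \<longleftrightarrow> t = l \<or> t = h" for t
    unfolding p using n[of t] lh by auto
  then have "{t. (x, t) \<in> path_arcs (a # zs @ [b])} = {l, h}" by auto
  then show ?thesis using lh by simp
qed

lemma path_arcs_start:
  assumes "distinct (a # zs @ [b])"
  shows "{t. (a, t) \<in> path_arcs (a # zs @ [b])} = {hd (zs @ [b])}"
proof -
  have p: "path_arcs (a # zs @ [b]) = {(a, hd (zs @ [b])), (hd (zs @ [b]), a)} \<union> path_arcs (zs @ [b])"
    by (rule path_arcs_Cons) simp
  have "(a, t) \<notin> path_arcs (zs @ [b])" for t using path_arcsD(1)[of a t "zs @ [b]"] assms by auto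
  moreover have "hd (zs @ [b]) \<noteq> a" using hd_append_mem[of zs b] assms by auto
  ultimately show ?thesis unfolding p by blast
qed

lemma path_arcs_end:
  assumes "distinct (a # zs @ [b])"
  shows "{t. (b, t) \<in> path_arcs (a # zs @ [b])} = {last (a # zs)}"
proof -
  have p: "path_arcs ((a # zs) @ [b]) = {(last (a # zs), b), (b, last (a # zs))} \<union> path_arcs (a # zs)"
    by (rule path_arcs_snoc) simp
  have "(b, t) \<notin> path_arcs (a # zs)" for t using path_arcsD(1)[of b t "a # zs"] assms by auto
  moreover have "last (a # zs) \<noteq> b" using last_in_set[of "a # zs"] assms by auto
  ultimately have "{t. (b, t) \<in> path_arcs ((a # zs) @ [b])} = {last (a # zs)}" unfolding p by blast
  then show ?thesis by simp
qed

text \<open>Only \<open>xs\<close> may be empty, in which case \<open>v\<close> takes the place of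
  its first vertex. The three paths therefore start at different neighbours of \<open>u\<close>, and
  similarly at \<open>v\<close>.\<close>

lemma theta_shape_degrees:
  assumes s: "theta_shape E V u v xs ys zs" and ne: "ys \<noteq> []" "zs \<noteq> []"
  shows "x \<in> V - {u, v} \<Longrightarrow> card (nbs E V x) = 2" "card (nbs E V u) = 3" "card (nbs E V v) = 3"
proof -
  note d = theta_shapeD(1)[OF s] and V = theta_shapeD(2)[OF s] and E = theta_shapeD(3)[OF s]
  have dd: "distinct (u # xs @ [v])" "distinct (u # ys @ [v])" "distinct (u # zs @ [v])" using d by auto
  have VV: "{t. (x, t) \<in> E \<inter> V \<times> V} = nbs E V x" if "x \<in> V" for x using that by (auto simp: nbs_def)
  have nb: "nbs E V x = {t. (x, t) \<in> path_arcs (u # xs @ [v])} \<union> {t. (x, t) \<in> path_arcs (u # ys @ [v])}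
    \<union> {t. (x, t) \<in> path_arcs (u # zs @ [v])}" if "x \<in> V" for x
    unfolding VV[OF that, symmetric] E by auto
  have off: "{t. (x, t) \<in> path_arcs (u # ws @ [v])} = {}" if "x \<notin> set ws" "x \<noteq> u" "x \<noteq> v" for x ws
    using path_arcsD(1)[of x _ "u # ws @ [v]"] that by auto
  show "card (nbs E V x) = 2" if x: "x \<in> V - {u, v}"
  proof -
    have xV: "x \<in> V" and xuv: "x \<noteq> u" "x \<noteq> v" using x by auto
    consider "x \<in> set xs" | "x \<in> set ys" | "x \<in> set zs" using x V by auto
    then show ?thesis
    proof cases
      case 1
      then have n: "x \<notin> set ys" "x \<notin> set zs" using d by auto
      have "nbs E V x = {t. (x, t) \<in> path_arcs (u # xs @ [v])}"
        unfolding nb[OF xV] by (simp add: off[OF n(1) xuv] off[OF n(2) xuv] del: Collect_empty_eq)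
      then show ?thesis using path_arcs_interior_degree[OF dd(1) 1] by simp
    next
      case 2
      then have n: "x \<notin> set xs" "x \<notin> set zs" using d by auto
      have "nbs E V x = {t. (x, t) \<in> path_arcs (u # ys @ [v])}"
        unfolding nb[OF xV] by (simp add: off[OF n(1) xuv] off[OF n(2) xuv] del: Collect_empty_eq)
      then show ?thesis using path_arcs_interior_degree[OF dd(2) 2] by simp
    next
      case 3
      then have n: "x \<notin> set ys" "x \<notin> set xs" using d by auto
      have "nbs E V x = {t. (x, t) \<in> path_arcs (u # zs @ [v])}"
        unfolding nb[OF xV] by (simp add: off[OF n(1) xuv] off[OF n(2) xuv] del: Collect_empty_eq)
      then show ?thesis using path_arcs_interior_degree[OF dd(3) 3] by simp
    qed
  qed
  have uV: "u \<in> V" "v \<in> V" by (simp_all add: V)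
  have ne3: "a \<noteq> b \<and> a \<noteq> c \<and> b \<noteq> c"
    if "a \<in> A" "b \<in> B" "c \<in> C" "A \<inter> B = {}" "A \<inter> C = {}" "B \<inter> C = {}" for a b c :: 'a and A B C
    using that by auto
  have card3: "card ({a} \<union> {b} \<union> {c}) = 3" if "a \<noteq> b \<and> a \<noteq> c \<and> b \<noteq> c" for a b c :: 'a
    using that by auto
  have "hd (xs @ [v]) \<in> insert v (set xs)" by (rule hd_append_mem)
  moreover have "hd (ys @ [v]) \<in> set ys" "hd (zs @ [v]) \<in> set zs" using ne by simp_all
  moreover have "insert v (set xs) \<inter> set ys = {}" "insert v (set xs) \<inter> set zs = {}" "set ys \<inter> set zs = {}"
    using d by auto
  ultimately have "hd (xs @ [v]) \<noteq> hd (ys @ [v]) \<and> hd (xs @ [v]) \<noteq> hd (zs @ [v]) \<and> hd (ys @ [v]) \<noteq> hd (zs @ [v])"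
    by (rule ne3)
  then show "card (nbs E V u) = 3"
    unfolding nb[OF uV(1)] path_arcs_start[OF dd(1)] path_arcs_start[OF dd(2)] path_arcs_start[OF dd(3)]
    by (rule card3)
  have "last (u # xs) \<in> insert u (set xs)" using last_in_set[of "u # xs"] by simp
  moreover have "last (u # ys) \<in> set ys" "last (u # zs) \<in> set zs" using ne by simp_all
  moreover have "insert u (set xs) \<inter> set ys = {}" "insert u (set xs) \<inter> set zs = {}" "set ys \<inter> set zs = {}"
    using d by auto
  ultimately have "last (u # xs) \<noteq> last (u # ys) \<and> last (u # xs) \<noteq> last (u # zs) \<and> last (u # ys) \<noteq> last (u # zs)"
    by (rule ne3)
  then show "card (nbs E V v) = 3"
    unfolding nb[OF uV(2)] path_arcs_end[OF dd(1)] path_arcs_end[OF dd(2)] path_arcs_end[OF dd(3)]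
    by (rule card3)
qed

lemma ear_mono:
  assumes "sym E" "irrefl E" "ear E U a zs b" "U' \<subseteq> U" "a \<in> U'" "b \<in> U'"
  shows "ear E U' a zs b"
proof -
  note e = assms(3)[unfolded ear_iff[OF assms(1,2)]]
  have 1: "zs \<noteq> []" "a = b \<longrightarrow> 2 \<le> length zs" "distinct zs" "set zs \<inter> U = {}"
    and 2: "\<forall>x\<in>set zs. \<forall>t\<in>U \<union> set zs. (x, t) \<in> E \<longleftrightarrow> (x, t) \<in> path_arcs (a # zs @ [b])"
    using e by simp_all
  have "set zs \<inter> U' = {}" using 1(4) assms(4) by auto
  moreover have "\<forall>x\<in>set zs. \<forall>t\<in>U' \<union> set zs. (x, t) \<in> E \<longleftrightarrow> (x, t) \<in> path_arcs (a # zs @ [b])"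
    using 2 assms(4) by auto
  ultimately show ?thesis unfolding ear_iff[OF assms(1,2)] using 1(1-3) assms(5,6) by simp
qed

text \<open>The paths are attached to the two bare vertices \<open>u\<close> and \<open>v\<close>,
  which leave no room for disjoint cycles, so the factor is 1. An empty \<open>xs\<close> is the
  edge already present between them.\<close>

lemma theta_shape_perm:
  assumes E: "sym E" "irrefl E" and s: "theta_shape E V u v xs ys zs" and ne: "ys \<noteq> []" "zs \<noteq> []"
  shows "perm_on (graph_weight E (theta_diag u v y)) V V =
    theta_perm y (Suc (length zs)) (Suc (length ys)) (Suc (length xs)) 1"
proof -
  note d = theta_shapeD(1)[OF s] and V = theta_shapeD(2)[OF s] and EV = theta_shapeD(3)[OF s]
  have uv: "u \<noteq> v" using d by auto
  note swap = theta_shape_swap[OF E uv]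
  have s': "theta_shape E V u v xs zs ys" "theta_shape E V u v zs ys xs"
    by (rule swap(2)[OF s], rule swap(2)[OF swap(1)[OF swap(2)[OF s]]])
  have e3: "ear E ({u, v} \<union> set xs \<union> set ys) u zs v"
    by (rule theta_shape_imp_ear[OF E uv s ne(2)])
  have e2: "ear E ({u, v} \<union> set xs) u ys v"
    by (rule ear_mono[OF E theta_shape_imp_ear[OF E uv s'(1) ne(1)]]) auto
  have br: "branching E u v {u, v} 0 0" by (simp add: branching_def nbs_def)
  obtain cs where cs: "\<And>k. k \<in> set cs \<Longrightarrow> 3 \<le> k" "card {u, v} = 2 + sum_list cs"
    "\<And>y. state E (theta_diag u v y) u v {u, v} =
      (if (u, v) \<in> E then join_state y 1 (base_state y (\<Prod>c\<leftarrow>cs. cycle_perm y c))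
       else base_state y (\<Prod>c\<leftarrow>cs. cycle_perm y c))"
    using branching_base[OF E uv br] by blast
  have "cs = []"
  proof (rule ccontr)
    assume "cs \<noteq> []"
    then have hd: "hd cs \<in> set cs" by simp
    then have "hd cs \<le> sum_list cs" by (intro member_le_sum_list) auto
    moreover have "3 \<le> hd cs" by (rule cs(1)[OF hd])
    moreover have "card {u, v} = 2" using uv by simp
    ultimately show False using cs(2) by linarith
  qed
  then have base: "state E (theta_diag u v y) u v {u, v} =
    (if (u, v) \<in> E then join_state y 1 (base_state y 1) else base_state y 1)" using cs(3)[of y] by simp
  have "state E (theta_diag u v y) u v ({u, v} \<union> set xs) = join_state y (Suc (length xs)) (base_state y 1)"
  proof (cases "xs = []")
    case True
    have "(u, v) \<in> E \<inter> V \<times> V" unfolding EV True by (simp add: path_arcs_Cons)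
    then show ?thesis using base True by simp
  next
    case False
    have e1: "ear E {u, v} u xs v"
      by (rule ear_mono[OF E theta_shape_imp_ear[OF E uv s'(2) False]]) auto
    have "(u, v) \<notin> E"
    proof
      assume "(u, v) \<in> E"
      then have "(u, v) \<in> E \<inter> V \<times> V" by (simp add: V)
      then have "v \<in> {t. (u, t) \<in> path_arcs (u # xs @ [v])} \<union> {t. (u, t) \<in> path_arcs (u # ys @ [v])}
        \<union> {t. (u, t) \<in> path_arcs (u # zs @ [v])}" unfolding EV by blast
      moreover have dist: "distinct (u # xs @ [v])" "distinct (u # ys @ [v])" "distinct (u # zs @ [v])" using d by auto
      ultimately have "v \<in> {hd (xs @ [v]), hd (ys @ [v]), hd (zs @ [v])}"
        unfolding path_arcs_start[OF dist(1)] path_arcs_start[OF dist(2)] path_arcs_start[OF dist(3)] by blast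
      moreover have "hd (xs @ [v]) \<in> set xs" "hd (ys @ [v]) \<in> set ys" "hd (zs @ [v]) \<in> set zs"
        using ne False by simp_all
      ultimately show False using d by auto
    qed
    then show ?thesis
      using base state_join_theta[OF E uv e1] by simp
  qed
  then have st: "state E (theta_diag u v y) u v ({u, v} \<union> set xs \<union> set ys \<union> set zs) =
    join_state y (Suc (length zs)) (join_state y (Suc (length ys)) (join_state y (Suc (length xs)) (base_state y 1)))"
    using state_join_theta[OF E uv e2] state_join_theta[OF E uv e3] by simp
  have "V = {u, v} \<union> set xs \<union> set ys \<union> set zs" unfolding V by auto
  then show ?thesis unfolding fst_state[of E _ u v, symmetric] theta_perm_def st[symmetric] by simp
qed

section \<open>Comparison of the scaled permanents\<close>

text \<open>The substitution \<open>y = e - 1 / e\<close> excludes only \<open>e = 0\<close>, and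
  infinitely many points are enough.\<close>

lemma poly_eq_if_eq_nonzero:
  fixes p q :: "real poly"
  assumes "\<And>x. x \<noteq> 0 \<Longrightarrow> poly p x = poly q x"
  shows "p = q"
proof (rule ccontr)
  assume "p \<noteq> q"
  then have "finite {x. poly (p - q) x = 0}" by (intro poly_roots_finite) simp
  moreover have "UNIV - {0} \<subseteq> {x. poly (p - q) x = 0}" using assms by auto
  ultimately have "finite (UNIV - {0 :: real})" by (rule rev_finite_subset)
  then show False using infinite_UNIV_char_0[where ?'a = real] by simp
qed

lemma cycle_product_closed:
  assumes "e \<noteq> 0" "y = e - 1 / e" "\<forall>k\<in>set cs. 3 \<le> k"
  shows "(- e) ^ sum_list cs * (\<Prod>c\<leftarrow>cs. cycle_perm y c) = poly (cycle_poly cs) e"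
  using assms(3)
proof (induction cs)
  case Nil
  then show ?case by (simp add: cycle_poly_def)
next
  case (Cons c cs)
  have "(- e) ^ sum_list (c # cs) * (\<Prod>c\<leftarrow>c # cs. cycle_perm y c) =
    ((- e) ^ c * cycle_perm y c) * ((- e) ^ sum_list cs * (\<Prod>c\<leftarrow>cs. cycle_perm y c))"
    by (simp add: power_add algebra_simps)
  also have "(- e) ^ c * cycle_perm y c = 1 + 2 * e ^ c + (- (e\<^sup>2)) ^ c"
    using Cons.prems by (intro cycle_perm_closed[OF assms(1,2)]) simp
  also have "(- e) ^ sum_list cs * (\<Prod>c\<leftarrow>cs. cycle_perm y c) = poly (cycle_poly cs) e"
    using Cons by simp
  finally show ?case by (simp add: poly_cycle_poly)
qed

text \<open>The exponent is the number of all edges, disjoint cycles included. Graphs with equally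
  many edges are thus scaled by the same factor.\<close>

lemma theta_perm_scaled:
  assumes e: "e \<noteq> 0" "y = e - 1 / e" and cs: "\<forall>k\<in>set cs. 3 \<le> k"
    and pos: "1 \<le> a" "1 \<le> b" "1 \<le> c"
  shows "(- e) ^ (a + b + c + sum_list cs) * (1 + e\<^sup>2) ^ 3 * theta_perm y a b c (\<Prod>c\<leftarrow>cs. cycle_perm y c) =
    - e * poly (theta_poly a b c * cycle_poly cs) e"
proof -
  have "(- e) ^ (a + b + c + sum_list cs) * (1 + e\<^sup>2) ^ 3 * theta_perm y a b c (\<Prod>c\<leftarrow>cs. cycle_perm y c) =
    (- e) ^ sum_list cs * ((- e) ^ (a + b + c) * (1 + e\<^sup>2) ^ 3 *
      theta_perm y a b c (\<Prod>c\<leftarrow>cs. cycle_perm y c))"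
    by (simp add: power_add algebra_simps)
  also have "\<dots> = - e * theta_fun e a b c * ((- e) ^ sum_list cs * (\<Prod>c\<leftarrow>cs. cycle_perm y c))"
    unfolding theta_perm_def theta_closed[OF e pos] by (simp add: algebra_simps)
  also have "\<dots> = - e * poly (theta_poly a b c * cycle_poly cs) e"
    unfolding cycle_product_closed[OF e cs] by (simp add: poly_theta_poly)
  finally show ?thesis .
qed

lemma dumbbell_perm_scaled:
  assumes e: "e \<noteq> 0" "y = e - 1 / e" and cs: "\<forall>k\<in>set cs. 3 \<le> k"
    and pos: "1 \<le> l" "1 \<le> g" "1 \<le> h"
  shows "(- e) ^ (l + g + h + sum_list cs) * (1 + e\<^sup>2) ^ 3 * dumbbell_perm y l g h (\<Prod>c\<leftarrow>cs. cycle_perm y c) =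
    - e * (dumbbell_fun e l g h * poly (cycle_poly cs) e)"
proof -
  have "(- e) ^ (l + g + h + sum_list cs) * (1 + e\<^sup>2) ^ 3 * dumbbell_perm y l g h (\<Prod>c\<leftarrow>cs. cycle_perm y c) =
    (- e) ^ sum_list cs * ((- e) ^ (l + g + h) * (1 + e\<^sup>2) ^ 3 *
      dumbbell_perm y l g h (\<Prod>c\<leftarrow>cs. cycle_perm y c))"
    by (simp add: power_add algebra_simps)
  also have "\<dots> = - e * dumbbell_fun e l g h * ((- e) ^ sum_list cs * (\<Prod>c\<leftarrow>cs. cycle_perm y c))"
    unfolding dumbbell_perm_def dumbbell_closed[OF e pos] by (simp add: algebra_simps)
  also have "\<dots> = - e * (dumbbell_fun e l g h * poly (cycle_poly cs) e)"
    unfolding cycle_product_closed[OF e cs] by simp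
  finally show ?thesis .
qed

lemma theta_perm_eq_theta_perm:
  assumes eq: "\<And>y. theta_perm y a b c 1 = theta_perm y a' b' c' (\<Prod>c\<leftarrow>cs. cycle_perm y c)"
    and cs: "\<forall>k\<in>set cs. 3 \<le> k" and s: "a + b + c = a' + b' + c' + sum_list cs"
    and pos: "2 \<le> a" "2 \<le> b" "1 \<le> c" "2 \<le> a'" "2 \<le> b'" "1 \<le> c'"
  shows "cs = []" "mset [a, b, c] = mset [a', b', c']"
proof -
  have "theta_poly a b c = theta_poly a' b' c' * cycle_poly cs"
  proof (rule poly_eq_if_eq_nonzero)
    fix e :: real assume e: "e \<noteq> 0"
    have "- e * poly (theta_poly a b c * cycle_poly []) e = - e * poly (theta_poly a' b' c' * cycle_poly cs) e"
      using theta_perm_scaled[OF e refl, where cs = "[]" and a = a and b = b and c = c]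
        theta_perm_scaled[OF e refl cs, where a = a' and b = b' and c = c'] pos s eq
      by auto
    then show "poly (theta_poly a b c) e = poly (theta_poly a' b' c' * cycle_poly cs) e"
      using e by (simp add: cycle_poly_def)
  qed
  note p = this
  show "cs = []" by (rule theta_mult_cycles[OF p s]) (use pos cs in auto)
  then have "theta_poly a b c = theta_poly a' b' c'" "a + b + c = a' + b' + c'"
    using p s by (simp_all add: cycle_poly_def)
  \<comment> \<open>The path that may be a single edge is the last argument here but the first one
    in \<open>theta_poly_inject\<close>.\<close>
  moreover have "theta_poly a b c = theta_poly c b a" "theta_poly a' b' c' = theta_poly c' b' a'"
    by (rule theta_poly_mset, simp)+
  ultimately have "mset [c, b, a] = mset [c', b', a']" using pos by (intro theta_poly_inject) auto
  then show "mset [a, b, c] = mset [a', b', c']" by (simp add: add_mset_commute)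
qed

lemma theta_perm_neq_dumbbell_perm:
  assumes eq: "\<And>y. theta_perm y a b c 1 = dumbbell_perm y l g h (\<Prod>c\<leftarrow>cs. cycle_perm y c)"
    and cs: "\<forall>k\<in>set cs. 3 \<le> k" and s: "a + b + c = l + g + h + sum_list cs"
    and pos: "2 \<le> a" "2 \<le> b" "1 \<le> c" "1 \<le> l" "3 \<le> g" "3 \<le> h"
  shows False
proof -
  obtain D where D: "\<And>x. poly D x = dumbbell_fun x l g h"
  proof (cases "g \<le> h")
    case True
    then show ?thesis using dumbbell_fun_poly[of g h l] pos that by (metis One_nat_def Suc_leI gr0I not_numeral_le_zero)
  next
    case False
    have "dumbbell_fun x l g h = dumbbell_fun x l h g" for x by (simp add: dumbbell_fun_def)
    then show ?thesis using dumbbell_fun_poly[of h g l] False pos that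
      by (metis One_nat_def Suc_leI gr0I not_numeral_le_zero nat_le_linear)
  qed
  have "theta_poly a b c = D * cycle_poly cs"
  proof (rule poly_eq_if_eq_nonzero)
    fix e :: real assume e: "e \<noteq> 0"
    have "- e * poly (theta_poly a b c * cycle_poly []) e = - e * (dumbbell_fun e l g h * poly (cycle_poly cs) e)"
      using theta_perm_scaled[OF e refl, where cs = "[]" and a = a and b = b and c = c]
        dumbbell_perm_scaled[OF e refl cs, where l = l and g = g and h = h] pos s eq
      by auto
    then show "poly (theta_poly a b c) e = poly (D * cycle_poly cs) e"
      using e by (simp add: cycle_poly_def D)
  qed
  then have "poly (theta_poly c b a) x = dumbbell_fun x l g h * poly (cycle_poly cs) x" for x
    using theta_poly_mset[of a b c c b a] by (simp add: D)
  then show False by (rule theta_neq_dumbbell[where cs = cs]) (use s pos cs in auto)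
qed

section \<open>Leading coefficients\<close>

text \<open>Outside the index range a permutation is the identity and an extensional function is
  undefined; exchanging these default values translates one kind of bijection into the
  other.\<close>

lemma permanent_eq_perm_on:
  "permanent A = perm_on (\<lambda>i j. A $$ (i, j)) {0..<dim_row A} {0..<dim_row A}"
  unfolding permanent_def perm_on_def
proof (rule sum.reindex_bij_witness[where j = "\<lambda>p. restrict p {0..<dim_row A}"
      and i = "\<lambda>f x. if x \<in> {0..<dim_row A} then f x else x"])
  fix p assume "p \<in> {p. p permutes {0..<dim_row A}}"
  then have p: "p permutes {0..<dim_row A}" by simp
  show "(\<lambda>x. if x \<in> {0..<dim_row A} then restrict p {0..<dim_row A} x else x) = p"
    using p by (auto simp: fun_eq_iff permutes_def)
  have "bij_betw p {0..<dim_row A} {0..<dim_row A}" using p by (rule permutes_imp_bij)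
  then have "bij_betw (restrict p {0..<dim_row A}) {0..<dim_row A} {0..<dim_row A}"
    by (subst bij_betw_cong[of _ _ p]) auto
  then show "restrict p {0..<dim_row A} \<in>
      {f. f \<in> {0..<dim_row A} \<rightarrow>\<^sub>E {0..<dim_row A} \<and> bij_betw f {0..<dim_row A} {0..<dim_row A}}"
    by (auto simp: bij_betw_def)
  show "(\<Prod>a\<in>{0..<dim_row A}. A $$ (a, restrict p {0..<dim_row A} a)) = (\<Prod>i = 0..<dim_row A. A $$ (i, p i))"
    by (intro prod.cong) auto
next
  fix f assume f: "f \<in> {f. f \<in> {0..<dim_row A} \<rightarrow>\<^sub>E {0..<dim_row A} \<and> bij_betw f {0..<dim_row A} {0..<dim_row A}}"
  then have b: "bij_betw f {0..<dim_row A} {0..<dim_row A}" by auto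
  show "restrict (\<lambda>x. if x \<in> {0..<dim_row A} then f x else x) {0..<dim_row A} = f"
    using f by (auto simp: fun_eq_iff PiE_def extensional_def)
  have "bij_betw (\<lambda>x. if x \<in> {0..<dim_row A} then f x else x) {0..<dim_row A} {0..<dim_row A}"
    using b by (subst bij_betw_cong[of _ _ f]) auto
  then show "(\<lambda>x. if x \<in> {0..<dim_row A} then f x else x) \<in> {p. p permutes {0..<dim_row A}}"
    by (auto intro!: bij_imp_permutes)
qed

text \<open>Up to sign these are the elementary symmetric functions of the values
  \<open>d i\<close>. The second one is obtained from power sums, and doubling it avoids a division
  in the integers.\<close>

lemma prod_linear_coeffs:
  fixes d :: "'i \<Rightarrow> int"
  assumes "finite S"
  defines "p \<equiv> \<Prod>i\<in>S. [:- d i, 1:]"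
  shows "degree p = card S" "coeff p (card S) = 1"
    "Suc k = card S \<Longrightarrow> coeff p k = - (\<Sum>i\<in>S. d i)"
    "Suc (Suc k) = card S \<Longrightarrow> 2 * coeff p k = (\<Sum>i\<in>S. d i)\<^sup>2 - (\<Sum>i\<in>S. (d i)\<^sup>2)"
proof -
  have "degree p = card S \<and> coeff p (card S) = 1 \<and> (\<forall>k. Suc k = card S \<longrightarrow> coeff p k = - (\<Sum>i\<in>S. d i)) \<and>
    (\<forall>k. Suc (Suc k) = card S \<longrightarrow> 2 * coeff p k = (\<Sum>i\<in>S. d i)\<^sup>2 - (\<Sum>i\<in>S. (d i)\<^sup>2))"
    unfolding p_def using assms(1)
  proof (induction S rule: finite_induct)
    case empty
    then show ?case by simp
  next
    case (insert x S)
    let ?q = "\<Prod>i\<in>S. [:- d i, 1:]"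
    have q: "degree ?q = card S" "coeff ?q (card S) = 1"
      "\<And>k. Suc k = card S \<Longrightarrow> coeff ?q k = - (\<Sum>i\<in>S. d i)"
      "\<And>k. Suc (Suc k) = card S \<Longrightarrow> 2 * coeff ?q k = (\<Sum>i\<in>S. d i)\<^sup>2 - (\<Sum>i\<in>S. (d i)\<^sup>2)"
      using insert.IH by blast+
    have q0: "?q \<noteq> 0" using q(2) by auto
    have e: "(\<Prod>i\<in>insert x S. [:- d i, 1:]) = Polynomial.smult (- d x) ?q + pCons 0 ?q"
      using insert.hyps by (simp add: mult_pCons_left)
    have c: "card (insert x S) = Suc (card S)" using insert.hyps by simp
    have z: "coeff ?q (Suc (card S)) = 0" using q(1) by (intro coeff_eq_0) simp
    have s: "(\<Sum>i\<in>insert x S. d i) = d x + (\<Sum>i\<in>S. d i)"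
      "(\<Sum>i\<in>insert x S. (d i)\<^sup>2) = (d x)\<^sup>2 + (\<Sum>i\<in>S. (d i)\<^sup>2)" using insert.hyps by simp_all
    have "degree (\<Prod>i\<in>insert x S. [:- d i, 1:]) = degree ([:- d x, 1:] * ?q)" using insert.hyps by simp
    also have "\<dots> = Suc (card S)" using q0 q(1) by (subst degree_mult_eq) auto
    finally have 1: "degree (\<Prod>i\<in>insert x S. [:- d i, 1:]) = Suc (card S)" .
    have 2: "coeff (\<Prod>i\<in>insert x S. [:- d i, 1:]) (Suc (card S)) = 1"
      unfolding e using q z by simp
    have 3: "coeff (\<Prod>i\<in>insert x S. [:- d i, 1:]) (card S) = - (d x + (\<Sum>i\<in>S. d i))"
    proof (cases "card S")
      case 0
      then show ?thesis unfolding e using q(2) insert.hyps by simp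
    next
      case (Suc k)
      then show ?thesis unfolding e using q(2) q(3)[of k] by simp
    qed
    have 4: "2 * coeff (\<Prod>i\<in>insert x S. [:- d i, 1:]) k =
      (d x + (\<Sum>i\<in>S. d i))\<^sup>2 - ((d x)\<^sup>2 + (\<Sum>i\<in>S. (d i)\<^sup>2))" if k: "Suc k = card S" for k
    proof (cases k)
      case 0
      then obtain y where "S = {y}" using k by (metis One_nat_def card_1_singletonE)
      then show ?thesis using 0 unfolding e by (simp add: power2_eq_square algebra_simps)
    next
      case (Suc j)
      have "2 * coeff ?q j = (\<Sum>i\<in>S. d i)\<^sup>2 - (\<Sum>i\<in>S. (d i)\<^sup>2)" using q(4)[of j] k Suc by simp
      moreover have "coeff ?q (Suc j) = - (\<Sum>i\<in>S. d i)" using q(3)[of k] k Suc by simp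
      moreover have "coeff (Polynomial.smult (- d x) ?q + pCons 0 ?q) k = - d x * coeff ?q (Suc j) + coeff ?q j"
        by (simp add: Suc)
      ultimately show ?thesis unfolding e by (simp add: power2_eq_square algebra_simps)
    qed
    show ?case unfolding c s using 1 2 3 4 by auto
  qed
  then show "degree p = card S" "coeff p (card S) = 1"
    "Suc k = card S \<Longrightarrow> coeff p k = - (\<Sum>i\<in>S. d i)"
    "Suc (Suc k) = card S \<Longrightarrow> 2 * coeff p k = (\<Sum>i\<in>S. d i)\<^sup>2 - (\<Sum>i\<in>S. (d i)\<^sup>2)"
    by blast+
qed

text \<open>Each moved point costs one degree in \<open>x\<close>. Hence degrees \<open>n\<close>
  and \<open>n - 1\<close> see only the identity, while degree \<open>n - 2\<close> also sees the
  permutations that move exactly two points.\<close>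

lemma permutes_moved_card:
  assumes "finite S" "p permutes S" "p \<noteq> id"
  shows "2 \<le> card {i\<in>S. p i \<noteq> i}"
    and "card {i\<in>S. p i \<noteq> i} = 2 \<Longrightarrow> \<exists>i j. i \<noteq> j \<and> i \<in> S \<and> j \<in> S \<and> p = Transposition.transpose i j"
proof -
  let ?M = "{i\<in>S. p i \<noteq> i}"
  have fin: "finite ?M" using assms(1) by simp
  have inj: "inj p" using assms(2) by (rule permutes_inj)
  obtain x where "p x \<noteq> x" using assms(3) by (auto simp: fun_eq_iff)
  then have x: "x \<in> ?M" using assms(2) by (auto simp: permutes_def)
  have pm: "p y \<in> ?M" if "y \<in> ?M" for y
    using that assms(2) inj by (auto simp: permutes_in_image dest: injD)
  have "{x, p x} \<subseteq> ?M" using x pm[OF x] by auto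
  then have "card {x, p x} \<le> card ?M" by (rule card_mono[OF fin])
  moreover have "card {x, p x} = 2" using x by auto
  ultimately show "2 \<le> card ?M" by simp
  assume c: "card ?M = 2"
  have M: "?M = {x, p x}" using \<open>{x, p x} \<subseteq> ?M\<close> \<open>card {x, p x} = 2\<close> c fin by (metis card_subset_eq)
  have "p (p x) = x"
  proof -
    have "p (p x) \<in> {x, p x}" using pm[OF pm[OF x]] M by auto
    moreover have "p (p x) \<noteq> p x" using x inj by (auto dest: injD)
    ultimately show ?thesis by auto
  qed
  have "p = Transposition.transpose x (p x)"
  proof
    fix y
    show "p y = Transposition.transpose x (p x) y"
    proof (cases "y \<in> ?M")
      case True
      then have "y = x \<or> y = p x" using M by auto
      then show ?thesis using \<open>p (p x) = x\<close> by auto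
    next
      case False
      then have "p y = y" using assms(2) by (auto simp: permutes_def)
      moreover have "y \<noteq> x" "y \<noteq> p x" using False x pm[OF x] by auto
      ultimately show ?thesis by simp
    qed
  qed
  then show "\<exists>i j. i \<noteq> j \<and> i \<in> S \<and> j \<in> S \<and> p = Transposition.transpose i j"
    using x pm[OF x] by (intro exI[of _ x] exI[of _ "p x"]) auto
qed

definition perm_term :: "int mat \<Rightarrow> nat \<Rightarrow> (nat \<Rightarrow> nat) \<Rightarrow> int poly" where
  "perm_term A n p = (\<Prod>i\<in>{0..<n}. if p i = i then [:- A $$ (i, i), 1:] else [:- A $$ (i, p i):])"

lemma permanental_poly_sum:
  assumes A: "A \<in> carrier_mat n n"
  shows "permanental_poly A = (\<Sum>p | p permutes {0..<n}. perm_term A n p)"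
proof -
  have d: "dim_row (char_poly_matrix A) = n" using A by (simp add: char_poly_matrix_def)
  have "char_poly_matrix A $$ (i, p i) = (if p i = i then [:- A $$ (i, i), 1:] else [:- A $$ (i, p i):])"
    if "p permutes {0..<n}" "i \<in> {0..<n}" for p i
  proof -
    have "p i < n" "i < n" using that permutes_in_image[of p "{0..<n}" i] by auto
    then show ?thesis using A by (auto simp: char_poly_matrix_def)
  qed
  then show ?thesis
    unfolding permanental_poly_def permanent_def d perm_term_def
    by (intro sum.cong prod.cong refl) auto
qed

lemma degree_perm_term: "degree (perm_term A n p) \<le> n - card {i\<in>{0..<n}. p i \<noteq> i}"
proof -
  have "degree (perm_term A n p) \<le>
      (\<Sum>i\<in>{0..<n}. degree (if p i = i then [:- A $$ (i, i), 1:] else [:- A $$ (i, p i):]))"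
    unfolding perm_term_def by (rule degree_prod_sum_le[unfolded o_def]) simp
  also have "\<dots> \<le> (\<Sum>i\<in>{0..<n}. if p i = i then 1 else 0)" by (intro sum_mono) simp
  also have "\<dots> = card {i\<in>{0..<n}. p i = i}" by (simp add: sum.If_cases Int_def)
  also have "{i\<in>{0..<n}. p i = i} = {0..<n} - {i\<in>{0..<n}. p i \<noteq> i}" by auto
  also have "card \<dots> = n - card {i\<in>{0..<n}. p i \<noteq> i}" by (subst card_Diff_subset) auto
  finally show ?thesis .
qed

lemma coeff_perm_term_transpose:
  assumes "i < n" "j < n" "i \<noteq> j" "Suc (Suc k) = n"
  shows "coeff (perm_term A n (Transposition.transpose i j)) k = A $$ (i, j) * A $$ (j, i)"
proof -
  let ?p = "Transposition.transpose i j"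
  let ?f = "\<lambda>x. if ?p x = x then [:- A $$ (x, x), 1:] else [:- A $$ (x, ?p x):]"
  have "{0..<n} = insert i (insert j ({0..<n} - {i, j}))" using assms by auto
  then have "perm_term A n ?p = (\<Prod>x\<in>insert i (insert j ({0..<n} - {i, j})). ?f x)"
    unfolding perm_term_def by simp
  also have "\<dots> = ?f i * (?f j * (\<Prod>x\<in>{0..<n} - {i, j}. ?f x))" using assms(3) by simp
  also have "(\<Prod>x\<in>{0..<n} - {i, j}. ?f x) = (\<Prod>x\<in>{0..<n} - {i, j}. [:- A $$ (x, x), 1:])"
    by (intro prod.cong) auto
  also have "?f i * (?f j * (\<Prod>x\<in>{0..<n} - {i, j}. [:- A $$ (x, x), 1:])) =
    Polynomial.smult (A $$ (i, j) * A $$ (j, i)) (\<Prod>x\<in>{0..<n} - {i, j}. [:- A $$ (x, x), 1:])"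
    using assms(3) by (simp add: mult.commute)
  finally have e: "perm_term A n ?p = Polynomial.smult (A $$ (i, j) * A $$ (j, i)) (\<Prod>x\<in>{0..<n} - {i, j}. [:- A $$ (x, x), 1:])" .
  have "card ({0..<n} - {i, j}) = k" using assms by (subst card_Diff_subset) auto
  then show ?thesis
    unfolding e coeff_smult using prod_linear_coeffs(2)[of "{0..<n} - {i, j}" "\<lambda>x. A $$ (x, x)"] by simp
qed

lemma perm_term_id: "perm_term A n id = (\<Prod>i\<in>{0..<n}. [:- A $$ (i, i), 1:])"
  by (simp add: perm_term_def)

lemma permanental_poly_coeff_split:
  fixes A :: "int mat"
  assumes A: "A \<in> carrier_mat n n"
  shows "coeff (permanental_poly A) k = coeff (perm_term A n id) k +
    (\<Sum>p | p permutes {0..<n} \<and> p \<noteq> id \<and> k + card {i\<in>{0..<n}. p i \<noteq> i} \<le> n. coeff (perm_term A n p) k)"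
proof -
  have fin: "finite {p. p permutes {0..<n}}" by (rule finite_permutations) simp
  have "coeff (permanental_poly A) k = (\<Sum>p | p permutes {0..<n}. coeff (perm_term A n p) k)"
    unfolding permanental_poly_sum[OF A] by (rule coeff_sum)
  also have "\<dots> = coeff (perm_term A n id) k + (\<Sum>p\<in>{p. p permutes {0..<n}} - {id}. coeff (perm_term A n p) k)"
    using fin permutes_id by (intro sum.remove) auto
  also have "(\<Sum>p\<in>{p. p permutes {0..<n}} - {id}. coeff (perm_term A n p) k) =
    (\<Sum>p | p permutes {0..<n} \<and> p \<noteq> id \<and> k + card {i\<in>{0..<n}. p i \<noteq> i} \<le> n. coeff (perm_term A n p) k)"
  proof (rule sum.mono_neutral_right)
    show "finite ({p. p permutes {0..<n}} - {id})" using fin by simp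
    show "\<forall>p\<in>{p. p permutes {0..<n}} - {id} - {p. p permutes {0..<n} \<and> p \<noteq> id \<and>
        k + card {i\<in>{0..<n}. p i \<noteq> i} \<le> n}. coeff (perm_term A n p) k = 0"
    proof
      fix p assume "p \<in> {p. p permutes {0..<n}} - {id} - {p. p permutes {0..<n} \<and> p \<noteq> id \<and>
        k + card {i\<in>{0..<n}. p i \<noteq> i} \<le> n}"
      then have g: "k + card {i\<in>{0..<n}. p i \<noteq> i} > n" by auto
      have "card {i\<in>{0..<n}. p i \<noteq> i} \<le> card {0..<n}" by (intro card_mono) auto
      then have "degree (perm_term A n p) < k" using degree_perm_term[of A n p] g by simp
      then show "coeff (perm_term A n p) k = 0" by (rule coeff_eq_0)
    qed
  qed auto
  finally show ?thesis .
qed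

text \<open>Each transposition occurs twice in the double sum, as \<open>(i, j)\<close> and as
  \<open>(j, i)\<close>, in accordance with the factor 2 on the left.\<close>

lemma permanental_poly_coeffs:
  fixes A :: "int mat"
  assumes A: "A \<in> carrier_mat n n"
  shows "n < k \<Longrightarrow> coeff (permanental_poly A) k = 0" "coeff (permanental_poly A) n = 1"
    "Suc k = n \<Longrightarrow> coeff (permanental_poly A) k = - (\<Sum>i\<in>{0..<n}. A $$ (i, i))"
    "Suc (Suc k) = n \<Longrightarrow> 2 * coeff (permanental_poly A) k =
       (\<Sum>i\<in>{0..<n}. A $$ (i, i))\<^sup>2 - (\<Sum>i\<in>{0..<n}. (A $$ (i, i))\<^sup>2)
       + (\<Sum>i\<in>{0..<n}. \<Sum>j\<in>{0..<n} - {i}. A $$ (i, j) * A $$ (j, i))"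
proof -
  have big: "coeff (permanental_poly A) k = coeff (perm_term A n id) k" if k: "n \<le> Suc k" for k
  proof -
    have e: "{p. p permutes {0..<n} \<and> p \<noteq> id \<and> k + card {i\<in>{0..<n}. p i \<noteq> i} \<le> n} = {}"
    proof -
      have False if "p permutes {0..<n}" "p \<noteq> id" "k + card {i\<in>{0..<n}. p i \<noteq> i} \<le> n" for p
        using permutes_moved_card(1)[OF _ that(1,2)] that(3) k by simp
      then show ?thesis by blast
    qed
    show ?thesis unfolding permanental_poly_coeff_split[OF A] e by simp
  qed
  note id = prod_linear_coeffs[where S = "{0..<n}" and d = "\<lambda>i. A $$ (i, i)", folded perm_term_id]
  show "coeff (permanental_poly A) k = 0" if "n < k"
    using that id(1) by (subst big) (auto intro: coeff_eq_0)
  show "coeff (permanental_poly A) n = 1" using id(2) by (subst big) auto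
  show "coeff (permanental_poly A) k = - (\<Sum>i\<in>{0..<n}. A $$ (i, i))" if "Suc k = n"
    using id(3)[of k] that by (subst big) auto
  assume k: "Suc (Suc k) = n"
  let ?T = "{p. p permutes {0..<n} \<and> p \<noteq> id \<and> k + card {i\<in>{0..<n}. p i \<noteq> i} \<le> n}"
  let ?I = "{(i, j). i < j \<and> j < n}"
  let ?t = "\<lambda>(i, j). Transposition.transpose i j :: nat \<Rightarrow> nat"
  have moved: "{x. Transposition.transpose i j x \<noteq> x} = {i, j}" if "i \<noteq> j" for i j :: nat
    using that by (auto simp: transpose_eq_iff)
  have inj: "inj_on ?t ?I"
  proof (rule inj_onI, clarify)
    fix i j i' j' :: nat
    assume ij: "i < j" "i' < j'" and e: "Transposition.transpose i j = Transposition.transpose i' j'"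
    have "{i, j} = {i', j'}" using moved[of i j] moved[of i' j'] ij e by simp
    then show "i = i' \<and> j = j'" using ij by (auto simp: doubleton_eq_iff)
  qed
  have T: "?T = ?t ` ?I"
  proof (intro equalityI subsetI)
    fix p assume p: "p \<in> ?T"
    then have "2 \<le> card {i\<in>{0..<n}. p i \<noteq> i}" by (intro permutes_moved_card) auto
    then have "card {i\<in>{0..<n}. p i \<noteq> i} = 2" using p k by auto
    then obtain i j where ij: "i \<noteq> j" "i \<in> {0..<n}" "j \<in> {0..<n}" "p = Transposition.transpose i j"
      using permutes_moved_card(2)[of "{0..<n}" p] p by auto
    show "p \<in> ?t ` ?I"
    proof (cases "i < j")
      case True
      then show ?thesis using ij by (intro image_eqI[of _ _ "(i, j)"]) auto
    next
      case False
      then show ?thesis using ij by (intro image_eqI[of _ _ "(j, i)"]) (auto simp: transpose_commute)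
    qed
  next
    fix p assume "p \<in> ?t ` ?I"
    then obtain i j where ij: "i < j" "j < n" "p = Transposition.transpose i j" by auto
    have "p permutes {0..<n}" using ij by (auto intro: permutes_swap_id)
    moreover have "p i \<noteq> id i" using ij by simp
    then have "p \<noteq> id" by metis
    moreover have "{x\<in>{0..<n}. p x \<noteq> x} = {i, j}" using moved[of i j] ij by auto
    then have "card {x\<in>{0..<n}. p x \<noteq> x} = 2" using ij by simp
    ultimately show "p \<in> ?T" using k by simp
  qed
  have sum1: "(\<Sum>p\<in>?T. coeff (perm_term A n p) k) = (\<Sum>(i, j)\<in>?I. A $$ (i, j) * A $$ (j, i))"
    unfolding T
  proof (subst sum.reindex[OF inj], rule sum.cong[OF refl])
    fix x assume "x \<in> ?I"
    then show "((\<lambda>p. coeff (perm_term A n p) k) \<circ> ?t) x = (case x of (i, j) \<Rightarrow> A $$ (i, j) * A $$ (j, i))"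
      using k by (auto simp: coeff_perm_term_transpose)
  qed
  have finI: "finite ?I" by (rule finite_subset[of _ "{0..<n} \<times> {0..<n}"]) auto
  have "(\<Sum>i\<in>{0..<n}. \<Sum>j\<in>{0..<n} - {i}. A $$ (i, j) * A $$ (j, i)) =
    (\<Sum>(i, j)\<in>(SIGMA i:{0..<n}. {0..<n} - {i}). A $$ (i, j) * A $$ (j, i))"
    by (intro sum.Sigma) auto
  also have "(SIGMA i:{0..<n}. {0..<n} - {i}) = ?I \<union> prod.swap ` ?I" by (auto simp: image_iff)
  also have "(\<Sum>(i, j)\<in>?I \<union> prod.swap ` ?I. A $$ (i, j) * A $$ (j, i)) =
    (\<Sum>(i, j)\<in>?I. A $$ (i, j) * A $$ (j, i)) + (\<Sum>(i, j)\<in>prod.swap ` ?I. A $$ (i, j) * A $$ (j, i))"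
    using finI by (intro sum.union_disjoint) auto
  also have "(\<Sum>(i, j)\<in>prod.swap ` ?I. A $$ (i, j) * A $$ (j, i)) = (\<Sum>(i, j)\<in>?I. A $$ (i, j) * A $$ (j, i))"
    by (subst sum.reindex) (auto intro!: sum.cong inj_onI simp: mult.commute)
  finally have sum2: "(\<Sum>i\<in>{0..<n}. \<Sum>j\<in>{0..<n} - {i}. A $$ (i, j) * A $$ (j, i)) =
    2 * (\<Sum>(i, j)\<in>?I. A $$ (i, j) * A $$ (j, i))" by simp
  show "2 * coeff (permanental_poly A) k =
       (\<Sum>i\<in>{0..<n}. A $$ (i, i))\<^sup>2 - (\<Sum>i\<in>{0..<n}. (A $$ (i, i))\<^sup>2)
       + (\<Sum>i\<in>{0..<n}. \<Sum>j\<in>{0..<n} - {i}. A $$ (i, j) * A $$ (j, i))"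
    unfolding permanental_poly_coeff_split[OF A] sum1 sum2 using id(4)[of k] k by simp
qed

section \<open>Determination of theta graphs\<close>

locale enumerated_graph = pair_graph G for G :: "'a pair_pre_digraph" +
  fixes vs :: "'a list"
  assumes enum: "vertex_enum G vs"
begin

abbreviation "deg x \<equiv> card (nbs (parcs G) (pverts G) x)"

lemma distinct_vs: "distinct vs" and set_vs: "set vs = pverts G"
  using enum by (auto simp: vertex_enum_def)

lemma length_vs: "length vs = card (pverts G)"
  using distinct_vs set_vs distinct_card by metis

lemma sym_arcs: "sym (parcs G)"
  using pair_sym_arcs by (simp add: symmetric_def)

lemma irrefl_arcs: "irrefl (parcs G)"
  using pair_no_loops by (force simp: irrefl_def)

lemma out_degree_eq: "out_degree (with_proj G) x = deg x"
proof -
  have "out_arcs (with_proj G) x = Pair x ` nbs (parcs G) (pverts G) x"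
    using in_arcsD2 by (auto simp: out_arcs_def nbs_def image_iff)
  then show ?thesis by (simp add: out_degree_def card_image inj_on_def)
qed

lemma bij_nth: "bij_betw (nth vs) {0..<length vs} (pverts G)"
  using bij_betw_nth[OF distinct_vs, of "{0..<length vs}" "pverts G"] set_vs by (simp add: atLeast0LessThan)

lemma sum_nth: "(\<Sum>i\<in>{0..<length vs}. f (vs ! i)) = (\<Sum>x\<in>pverts G. f x)"
  by (rule sum.reindex_bij_betw[OF bij_nth])

lemma signless_laplacian_carrier: "signless_laplacian G vs \<in> carrier_mat (length vs) (length vs)"
  by (simp add: signless_laplacian_def degree_mat_def adjacency_mat_def mat_diag_def)

lemma signless_laplacian_entry:
  assumes "i < length vs" "j < length vs"
  shows "signless_laplacian G vs $$ (i, j) =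
    (if i = j then int (deg (vs ! i)) else if (vs ! i, vs ! j) \<in> parcs G then 1 else 0)"
proof -
  have "(vs ! i, vs ! i) \<notin> parcs G" using irrefl_arcs by (simp add: irrefl_def)
  then show ?thesis
    using assms by (auto simp: signless_laplacian_def degree_mat_def adjacency_mat_def mat_diag_def out_degree_eq)
qed

lemma off_diagonal_sum:
  assumes i: "i < length vs"
  shows "(\<Sum>j\<in>{0..<length vs} - {i}. signless_laplacian G vs $$ (i, j) * signless_laplacian G vs $$ (j, i)) =
    int (deg (vs ! i))"
proof -
  note sE = sym_iff[OF sym_arcs]
  have lf: "(vs ! i, vs ! i) \<notin> parcs G" using irrefl_arcs by (simp add: irrefl_def)
  have fin: "finite (pverts G)" by (rule pair_finite_verts)
  have "(\<Sum>j\<in>{0..<length vs} - {i}. signless_laplacian G vs $$ (i, j) * signless_laplacian G vs $$ (j, i)) =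
    (\<Sum>j\<in>{0..<length vs} - {i}. if (vs ! i, vs ! j) \<in> parcs G then 1 else 0)"
    using i sE by (intro sum.cong) (auto simp: signless_laplacian_entry)
  also have "\<dots> = (\<Sum>j\<in>{0..<length vs}. if (vs ! i, vs ! j) \<in> parcs G then 1 else 0)"
    using i lf by (intro sum.mono_neutral_left) auto
  also have "\<dots> = (\<Sum>t\<in>pverts G. if (vs ! i, t) \<in> parcs G then 1 else 0)"
    by (rule sum_nth)
  also have "\<dots> = int (deg (vs ! i))"
    using fin by (simp add: nbs_def sum.If_cases Int_def)
  finally show ?thesis .
qed

abbreviation "\<pi> \<equiv> signless_laplacian_permanental_poly G vs"

text \<open>For a graph the off-diagonal sum is again the sum of the degrees. The coefficient next
  to the leading one determines this sum, and the following one then determines the sum of the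
  squares.\<close>

lemma poly_coeffs:
  shows "degree \<pi> = length vs"
    "Suc k = length vs \<Longrightarrow> coeff \<pi> k = - (\<Sum>x\<in>pverts G. int (deg x))"
    "Suc (Suc k) = length vs \<Longrightarrow> 2 * coeff \<pi> k = (\<Sum>x\<in>pverts G. int (deg x))\<^sup>2
       - (\<Sum>x\<in>pverts G. (int (deg x))\<^sup>2) + (\<Sum>x\<in>pverts G. int (deg x))"
proof -
  note c = permanental_poly_coeffs[OF signless_laplacian_carrier, folded signless_laplacian_permanental_poly_def]
  have d1: "(\<Sum>i\<in>{0..<length vs}. signless_laplacian G vs $$ (i, i)) = (\<Sum>x\<in>pverts G. int (deg x))"
    unfolding sum_nth[of "\<lambda>x. int (deg x)", symmetric] by (intro sum.cong) (auto simp: signless_laplacian_entry)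
  have d2: "(\<Sum>i\<in>{0..<length vs}. (signless_laplacian G vs $$ (i, i))\<^sup>2) = (\<Sum>x\<in>pverts G. (int (deg x))\<^sup>2)"
    unfolding sum_nth[of "\<lambda>x. (int (deg x))\<^sup>2", symmetric] by (intro sum.cong) (auto simp: signless_laplacian_entry)
  have d3: "(\<Sum>i\<in>{0..<length vs}. \<Sum>j\<in>{0..<length vs} - {i}.
      signless_laplacian G vs $$ (i, j) * signless_laplacian G vs $$ (j, i)) = (\<Sum>x\<in>pverts G. int (deg x))"
    unfolding sum_nth[of "\<lambda>x. int (deg x)", symmetric] by (intro sum.cong) (auto simp: off_diagonal_sum)
  show "degree \<pi> = length vs"
  proof (rule antisym)
    show "degree \<pi> \<le> length vs" using c(1) by (intro degree_le) auto
    show "length vs \<le> degree \<pi>" using c(2) by (intro le_degree) auto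
  qed
  show "Suc k = length vs \<Longrightarrow> coeff \<pi> k = - (\<Sum>x\<in>pverts G. int (deg x))"
    using c(3)[of k] d1 by simp
  show "Suc (Suc k) = length vs \<Longrightarrow> 2 * coeff \<pi> k = (\<Sum>x\<in>pverts G. int (deg x))\<^sup>2
       - (\<Sum>x\<in>pverts G. (int (deg x))\<^sup>2) + (\<Sum>x\<in>pverts G. int (deg x))"
    using c(4)[of k] d1 d2 d3 by simp
qed

text \<open>Evaluation is a ring homomorphism and passes into the permanent entry by entry; the
  positions are then relabelled by vertices.\<close>

lemma poly_eval:
  "poly (map_poly real_of_int \<pi>) z =
    perm_on (graph_weight (parcs G) (\<lambda>t. z - real (deg t))) (pverts G) (pverts G)"
proof -
  define n where "n = length vs"
  define A where "A = signless_laplacian G vs"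
  have A: "A \<in> carrier_mat n n" using signless_laplacian_carrier by (simp add: A_def n_def)
  define ev where "ev q = poly (map_poly real_of_int q) z" for q :: "int poly"
  have ev_prod: "ev (prod f I) = (\<Prod>i\<in>I. ev (f i))" for f :: "nat \<Rightarrow> int poly" and I
    unfolding ev_def by (simp add: of_int_poly_hom.hom_prod poly_prod)
  have ev_sum: "ev (sum f I) = (\<Sum>i\<in>I. ev (f i))" for f :: "(nat \<Rightarrow> nat) \<Rightarrow> int poly" and I
    unfolding ev_def by (simp add: of_int_poly_hom.hom_sum poly_sum)
  let ?W = "graph_weight (parcs G) (\<lambda>t. z - real (deg t))"
  have d: "dim_row (char_poly_matrix A) = n" using A by (simp add: char_poly_matrix_def)
  have entry: "ev (char_poly_matrix A $$ (i, j)) = ?W (vs ! i) (vs ! j)" if "i < n" "j < n" for i j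
  proof -
    have "char_poly_matrix A $$ (i, j) = (if i = j then [:- A $$ (i, i), 1:] else [:- A $$ (i, j):])"
      using A that by (auto simp: char_poly_matrix_def)
    moreover have "vs ! i = vs ! j \<longleftrightarrow> i = j"
      using distinct_vs that by (simp add: n_def nth_eq_iff_index_eq)
    ultimately show ?thesis
      using that by (auto simp: ev_def graph_weight_def A_def signless_laplacian_entry n_def)
  qed
  have "poly (map_poly real_of_int \<pi>) z = ev (permanent (char_poly_matrix A))"
    by (simp add: ev_def A_def signless_laplacian_permanental_poly_def permanental_poly_def)
  also have "\<dots> = perm_on (\<lambda>i j. ev (char_poly_matrix A $$ (i, j))) {0..<n} {0..<n}"
    unfolding permanent_eq_perm_on d perm_on_def ev_sum ev_prod ..
  also have "\<dots> = perm_on (\<lambda>i j. ?W (vs ! i) (vs ! j)) {0..<n} {0..<n}"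
    by (intro perm_on_cong entry) auto
  also have "\<dots> = perm_on ?W (nth vs ` {0..<n}) (nth vs ` {0..<n})"
    using bij_nth by (subst perm_on_image) (auto simp: bij_betw_def n_def)
  also have "nth vs ` {0..<n} = pverts G" using bij_nth by (simp add: bij_betw_def n_def)
  finally show ?thesis .
qed

lemma poly_eval_theta_diag:
  assumes "\<And>x. x \<in> pverts G \<Longrightarrow> deg x = (if x = u \<or> x = v then 3 else 2)"
  shows "poly (map_poly real_of_int \<pi>) (y + 2) =
    perm_on (graph_weight (parcs G) (theta_diag u v y)) (pverts G) (pverts G)"
  unfolding poly_eval
  using assms by (intro perm_on_cong) (auto simp: graph_weight_def theta_diag_def)

end

section \<open>Identification with the numbered theta graph\<close>

lemma map_prod_path_arcs: "map_prod f f ` path_arcs xs = path_arcs (map f xs)"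
proof (induction xs)
  case Nil
  then show ?case by (simp add: path_arcs_def)
next
  case (Cons x xs)
  show ?case
  proof (cases "xs = []")
    case False
    then show ?thesis using Cons.IH by (simp add: path_arcs_Cons hd_map)
  qed simp
qed

lemma upt_split3: "[k..<k + p + q + r] = [k..<k + p] @ [k + p..<k + p + q] @ [k + p + q..<k + p + q + r]"
  using upt_add_eq_append[of k "k + p + q" r] upt_add_eq_append[of k "k + p" q] by simp

lemma theta_shape_theta:
  "theta_shape (parcs (theta p q r)) (pverts (theta p q r)) 0 1 [2..<2 + p] [2 + p..<2 + p + q]
     [2 + p + q..<2 + p + q + r]"
proof -
  have l: "[2..<2 + p] @ [2 + p..<2 + p + q] @ [2 + p + q..<2 + p + q + r] = [2..<2 + p + q + r]"
    by (rule upt_split3[symmetric])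
  have sub: "parcs (theta p q r) \<subseteq> pverts (theta p q r) \<times> pverts (theta p q r)"
  proof -
    interpret pair_graph "theta p q r" by (rule pair_graph_theta)
    show ?thesis using in_arcsD1 in_arcsD2 by auto
  qed
  show ?thesis
    unfolding theta_shape_def l
  proof (intro conjI)
    show "distinct (0 # 1 # [2..<2 + p + q + r])" by (simp only: distinct.simps list.set set_upt distinct_upt) auto
    show "pverts (theta p q r) = set (0 # 1 # [2..<2 + p + q + r])" by (auto simp: theta_def)
    have "parcs (theta p q r) \<inter> pverts (theta p q r) \<times> pverts (theta p q r) = parcs (theta p q r)"
      using sub by blast
    then show "parcs (theta p q r) \<inter> pverts (theta p q r) \<times> pverts (theta p q r) =
      path_arcs (0 # [2..<2 + p] @ [1]) \<union> path_arcs (0 # [2 + p..<2 + p + q] @ [1]) \<union>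
      path_arcs (0 # [2 + p + q..<2 + p + q + r] @ [1])"
      by (simp add: theta_def)
  qed
qed

text \<open>The graph \<open>theta p q r\<close> numbers its two branching vertices first and then
  the three interiors in order. Sending each vertex to its position in
  \<open>u # v # xs @ ys @ zs\<close> therefore maps the paths onto each other.\<close>

lemma theta_shape_iso:
  assumes H: "pair_graph H" and s: "theta_shape (parcs H) (pverts H) u v xs ys zs"
    and len: "length xs = p" "length ys = q" "length zs = r"
  shows "digraph_iso (with_proj H) (with_proj (theta p q r))"
proof -
  interpret pair_graph H by (rule H)
  define L where "L = u # v # xs @ ys @ zs"
  have d: "distinct L" and V: "pverts H = set L"
    and E': "parcs H \<inter> pverts H \<times> pverts H =
      path_arcs (u # xs @ [v]) \<union> path_arcs (u # ys @ [v]) \<union> path_arcs (u # zs @ [v])"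
    using s unfolding theta_shape_def L_def by blast+
  have "parcs H \<inter> pverts H \<times> pverts H = parcs H" using in_arcsD1 in_arcsD2 by auto
  then have E: "parcs H = path_arcs (u # xs @ [v]) \<union> path_arcs (u # ys @ [v]) \<union> path_arcs (u # zs @ [v])"
    using E' by simp
  define n where "n = length L"
  have n: "n = 2 + p + q + r" by (simp add: n_def L_def len)
  define f where "f = the_inv_into {0..<n} (nth L)"
  have inj: "inj_on (nth L) {0..<n}" using d by (auto simp: inj_on_def n_def nth_eq_iff_index_eq)
  have fn: "f (L ! i) = i" if "i < n" for i
    unfolding f_def using inj that by (intro the_inv_into_f_f) auto
  have fL: "map f L = [0..<n]"
    by (rule nth_equalityI) (auto simp: n_def[symmetric] fn)
  have "0 < n" "1 < n" using n by auto
  then have "[0..<n] = 0 # 1 # [2..<n]"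
    using upt_conv_Cons[of 0 n] upt_conv_Cons[of 1 n] by (simp add: numeral_2_eq_2)
  then have uv: "f u = 0" "f v = 1" and rest: "map f xs @ map f ys @ map f zs =
      [2..<2 + p] @ [2 + p..<2 + p + q] @ [2 + p + q..<2 + p + q + r]"
    using fL unfolding upt_split3[symmetric] by (simp_all add: L_def n)
  have l: "length (map f xs) = length [2..<2 + p]" "length (map f ys) = length [2 + p..<2 + p + q]"
    by (simp_all only: len length_map length_upt diff_add_inverse)
  note m1 = iffD1[OF append_eq_append_conv[OF disjI1[OF l(1)]] rest]
  note m2 = iffD1[OF append_eq_append_conv[OF disjI1[OF l(2)]] conjunct2[OF m1]]
  note m = conjunct1[OF m1] m2[THEN conjunct1] m2[THEN conjunct2]
  have injf: "inj_on f (pverts H)"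
  proof -
    have "distinct (map f L)" unfolding fL by simp
    then show ?thesis by (simp add: distinct_map V)
  qed
  have img: "f ` pverts H = {0..<n}"
    unfolding V using arg_cong[OF fL, of set] by simp
  define hom where "hom = \<lparr>iso_verts = f, iso_arcs = map_prod f f, iso_head = snd, iso_tail = fst\<rparr>"
  have "digraph_isomorphism hom"
    unfolding digraph_isomorphism_def
  proof (intro conjI)
    show "wf_digraph (with_proj H)" by unfold_locales
    show "inj_on (iso_verts hom) (pverts H)" using injf by (simp add: hom_def)
    have "inj_on (map_prod f f) (pverts H \<times> pverts H)" using injf injf by (rule map_prod_inj_on)
    moreover have "parcs H \<subseteq> pverts H \<times> pverts H" using in_arcsD1 in_arcsD2 by auto
    ultimately show "inj_on (iso_arcs hom) (parcs H)" by (auto simp: hom_def intro: inj_on_subset)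
    show "\<forall>a\<in>parcs H. iso_verts hom (fst a) = iso_tail hom (iso_arcs hom a) \<and>
      iso_verts hom (snd a) = iso_head hom (iso_arcs hom a)" by (simp add: hom_def)
  qed
  moreover have "with_proj (theta p q r) = app_iso hom (with_proj H)"
  proof -
    have "map_prod f f ` parcs H = parcs (theta p q r)"
      unfolding E image_Un map_prod_path_arcs using uv m by (simp add: theta_def)
    moreover have "f ` pverts H = pverts (theta p q r)" unfolding img n by (simp add: theta_def algebra_simps)
    ultimately show ?thesis by (simp add: app_iso_def hom_def with_proj_def)
  qed
  ultimately show ?thesis unfolding digraph_iso_def by blast
qed

context enumerated_graph
begin

lemma branching_of_degrees:
  assumes deg: "\<And>x. x \<in> pverts G \<Longrightarrow> deg x = (if x = u \<or> x = v then 3 else 2)"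
    and uv: "u \<in> pverts G" "v \<in> pverts G"
  shows "branching (parcs G) u v (pverts G) (if (u, v) \<in> parcs G then 2 else 3) (if (u, v) \<in> parcs G then 2 else 3)"
proof -
  have fin: "finite (nbs (parcs G) (pverts G) x)" for x
    using pair_finite_verts by (simp add: nbs_def)
  note sE = sym_iff[OF sym_arcs]
  have iE: "(x, x) \<notin> parcs G" for x using irrefl_arcs by (simp add: irrefl_def)
  have "nbs (parcs G) (pverts G - {u, v}) u = nbs (parcs G) (pverts G) u - {v}"
    "nbs (parcs G) (pverts G - {u, v}) v = nbs (parcs G) (pverts G) v - {u}"
    using iE by (auto simp: nbs_def)
  moreover have "v \<in> nbs (parcs G) (pverts G) u \<longleftrightarrow> (u, v) \<in> parcs G"
    "u \<in> nbs (parcs G) (pverts G) v \<longleftrightarrow> (u, v) \<in> parcs G"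
    using uv sE[of u v] by (auto simp: nbs_def)
  moreover have "deg u = 3" "deg v = 3" using deg uv by auto
  ultimately have "card (nbs (parcs G) (pverts G - {u, v}) u) = (if (u, v) \<in> parcs G then 2 else 3)"
    "card (nbs (parcs G) (pverts G - {u, v}) v) = (if (u, v) \<in> parcs G then 2 else 3)"
    using fin by (simp_all add: card_Diff_singleton_if)
  then show ?thesis unfolding branching_def using uv deg pair_finite_verts by simp
qed

text \<open>\<open>(k - 2) * (k - 3)\<close> is nonnegative at every integer, because no integer
  lies strictly between 2 and 3; a vanishing sum makes every summand vanish.\<close>

lemma degrees_of_sums:
  assumes "(\<Sum>x\<in>pverts G. int (deg x)) = 2 * int (card (pverts G)) + 2"
    and "(\<Sum>x\<in>pverts G. (int (deg x))\<^sup>2) = 4 * int (card (pverts G)) + 10"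
  obtains u v where "u \<noteq> v" "u \<in> pverts G" "v \<in> pverts G"
    "\<And>x. x \<in> pverts G \<Longrightarrow> deg x = (if x = u \<or> x = v then 3 else 2)"
proof -
  let ?V = "pverts G"
  have fin: "finite ?V" by (rule pair_finite_verts)
  have "(\<Sum>x\<in>?V. (int (deg x) - 2) * (int (deg x) - 3)) =
    (\<Sum>x\<in>?V. (int (deg x))\<^sup>2 - 5 * int (deg x) + 6)"
    by (intro sum.cong) (auto simp: power2_eq_square algebra_simps)
  also have "\<dots> = (\<Sum>x\<in>?V. (int (deg x))\<^sup>2) - 5 * (\<Sum>x\<in>?V. int (deg x)) + 6 * int (card ?V)"
    by (simp add: sum.distrib sum_subtractf sum_distrib_left)
  also have "\<dots> = 0" unfolding assms by simp
  finally have s0: "(\<Sum>x\<in>?V. (int (deg x) - 2) * (int (deg x) - 3)) = 0" .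
  have nonneg: "0 \<le> (k - 2) * (k - 3)" for k :: int
  proof (cases "k \<le> 2")
    case True
    then show ?thesis by (intro mult_nonpos_nonpos) auto
  next
    case False
    then show ?thesis by (intro mult_nonneg_nonneg) auto
  qed
  have "\<forall>x\<in>?V. (int (deg x) - 2) * (int (deg x) - 3) = 0"
    by (rule sum_nonneg_eq_0_iff[OF fin nonneg, THEN iffD1, OF s0])
  then have d23: "deg x = 2 \<or> deg x = 3" if "x \<in> ?V" for x
    using that by (auto simp only: mult_eq_0_iff)
  have "(\<Sum>x\<in>?V. int (deg x) - 2) = 2"
    using assms(1) by (simp add: sum_subtractf)
  moreover have "(\<Sum>x\<in>?V. int (deg x) - 2) = (\<Sum>x\<in>?V. if deg x = 3 then 1 else 0)"
    using d23 by (intro sum.cong) auto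
  moreover have "\<dots> = int (card {x\<in>?V. deg x = 3})"
    using fin by (simp add: sum.If_cases Int_def)
  ultimately have "card {x\<in>?V. deg x = 3} = 2" by simp
  then obtain u v where uv: "{x\<in>?V. deg x = 3} = {u, v}" "u \<noteq> v" by (auto simp: card_2_iff)
  have mem: "x \<in> ?V \<and> deg x = 3 \<longleftrightarrow> x = u \<or> x = v" for x using uv(1) by blast
  show ?thesis
  proof (rule that[of u v])
    show "deg x = (if x = u \<or> x = v then 3 else 2)" if "x \<in> ?V" for x
      using mem[of x] d23[OF that] that by auto
  qed (use mem uv(2) in auto)
qed

lemma sums_of_degrees:
  assumes "u \<noteq> v" "u \<in> pverts G" "v \<in> pverts G"
    and deg: "\<And>x. x \<in> pverts G \<Longrightarrow> deg x = (if x = u \<or> x = v then 3 else 2)"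
  shows "(\<Sum>x\<in>pverts G. int (deg x)) = 2 * int (card (pverts G)) + 2"
    "(\<Sum>x\<in>pverts G. (int (deg x))\<^sup>2) = 4 * int (card (pverts G)) + 10"
proof -
  have fin: "finite (pverts G)" by (rule pair_finite_verts)
  have "{u, v} \<subseteq> pverts G" using assms by simp
  then have "card {u, v} \<le> card (pverts G)" by (rule card_mono[OF fin])
  then have c: "2 \<le> card (pverts G)" using assms(1) by simp
  have "card (pverts G - {u, v}) = card (pverts G) - 2"
    using assms fin by (subst card_Diff_subset) auto
  then have r: "int (card (pverts G - {u, v})) = int (card (pverts G)) - 2" using c by simp
  have s: "(\<Sum>x\<in>pverts G. f x) = (\<Sum>x\<in>pverts G - {u, v}. f x) + (f u + f v)" for f :: "'a \<Rightarrow> int"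
    using sum.subset_diff[of "{u, v}" "pverts G" f] assms fin by simp
  have d: "deg u = 3" "deg v = 3" "\<And>x. x \<in> pverts G - {u, v} \<Longrightarrow> deg x = 2" using deg assms by auto
  have "(\<Sum>x\<in>pverts G - {u, v}. int (deg x)) = (\<Sum>x\<in>pverts G - {u, v}. 2)"
    by (rule sum.cong[OF refl]) (simp only: d)
  then show "(\<Sum>x\<in>pverts G. int (deg x)) = 2 * int (card (pverts G)) + 2"
    unfolding s d(1,2) using r by simp
  have "(\<Sum>x\<in>pverts G - {u, v}. (int (deg x))\<^sup>2) = (\<Sum>x\<in>pverts G - {u, v}. 4)"
    by (rule sum.cong[OF refl]) (simp only: d, simp)
  then show "(\<Sum>x\<in>pverts G. (int (deg x))\<^sup>2) = 4 * int (card (pverts G)) + 10"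
    unfolding s d(1,2) using r by simp
qed

end

text \<open>The path that may lack interior vertices is moved to the position \<open>xs\<close>,
  where the preceding results allow it. Only the multiset of lengths is preserved.\<close>

lemma theta_shape_nonempty_order:
  assumes sym: "sym E" "irrefl E" "u \<noteq> v" and s: "theta_shape E V u v as bs cs"
    and ne: "\<not> (as = [] \<and> bs = [])" "\<not> (as = [] \<and> cs = [])" "\<not> (bs = [] \<and> cs = [])"
  obtains xs ys zs where "theta_shape E V u v xs ys zs" "ys \<noteq> []" "zs \<noteq> []"
    "mset [length zs, length ys, length xs] = mset [length as, length bs, length cs]"
proof -
  note swap = theta_shape_swap[OF sym]
  consider "bs \<noteq> []" "cs \<noteq> []" | "bs = []" | "cs = []" by blast
  then show ?thesis
  proof cases
    case 1
    then show ?thesis using s by (intro that[of as bs cs]) auto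
  next
    case 2
    then show ?thesis using swap(1)[OF s] ne by (intro that[of bs as cs]) auto
  next
    case 3
    then show ?thesis using swap(1)[OF swap(2)[OF s]] ne by (intro that[of cs as bs]) auto
  qed
qed

text \<open>The polynomial determines the lengths only as a multiset; exchanging neighbouring paths
  reaches each of the six orders.\<close>

lemma theta_shape_reorder:
  assumes sym: "sym E" "irrefl E" "u \<noteq> v" and s: "theta_shape E V u v xs ys zs"
    and m: "mset [length zs, length ys, length xs] = mset [p, q, r]"
  obtains as bs cs where "theta_shape E V u v as bs cs" "length as = p" "length bs = q" "length cs = r"
proof -
  note swap = theta_shape_swap[OF sym]
  note s6 = s
  note s5 = swap(2)[OF s]
  note s4 = swap(1)[OF s]
  note s3 = swap(1)[OF s5]
  note s2 = swap(2)[OF s4]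
  note s1 = swap(2)[OF s3]
  from mset3_cases[OF m] show ?thesis
  proof (elim disjE)
    assume "(p, q, r) = (length zs, length ys, length xs)"
    then show ?thesis by (intro that[OF s1]) simp_all
  next
    assume "(p, q, r) = (length ys, length zs, length xs)"
    then show ?thesis by (intro that[OF s2]) simp_all
  next
    assume "(p, q, r) = (length zs, length xs, length ys)"
    then show ?thesis by (intro that[OF s3]) simp_all
  next
    assume "(p, q, r) = (length ys, length xs, length zs)"
    then show ?thesis by (intro that[OF s4]) simp_all
  next
    assume "(p, q, r) = (length xs, length zs, length ys)"
    then show ?thesis by (intro that[OF s5]) simp_all
  next
    assume "(p, q, r) = (length xs, length ys, length zs)"
    then show ?thesis by (intro that[OF s6]) simp_all
  qed
qed

theorem theorem1p4:
  fixes p q r :: nat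
    and H :: "'a pair_pre_digraph"
    and vs :: "'a list"
    and ws :: "nat list"
  assumes "\<not> (p = 0 \<and> q = 0)" and "\<not> (p = 0 \<and> r = 0)" and "\<not> (q = 0 \<and> r = 0)"
    and "pair_graph H"
    and "vertex_enum H vs"
    and "vertex_enum (theta p q r) ws"
    and "signless_laplacian_permanental_poly H vs =
         signless_laplacian_permanental_poly (theta p q r) ws"
  shows "digraph_iso (with_proj H) (with_proj (theta p q r))"
proof -
  interpret H: enumerated_graph H vs
    using assms(4,5) by (simp add: enumerated_graph_def enumerated_graph_axioms_def)
  interpret T: enumerated_graph "theta p q r" ws
    using pair_graph_theta assms(6) by (simp add: enumerated_graph_def enumerated_graph_axioms_def)
  let ?T = "theta p q r"
  let ?A = "[2..<2 + p]" and ?B = "[2 + p..<2 + p + q]" and ?C = "[2 + p + q..<2 + p + q + r]"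
  have lens: "length ?A = p" "length ?B = q" "length ?C = r"
    by (simp_all only: length_upt diff_add_inverse)
  have "?A = [] \<longleftrightarrow> p = 0" "?B = [] \<longleftrightarrow> q = 0" "?C = [] \<longleftrightarrow> r = 0"
    unfolding length_0_conv[symmetric] lens by blast+
  then have "\<not> (?A = [] \<and> ?B = [])" "\<not> (?A = [] \<and> ?C = [])" "\<not> (?B = [] \<and> ?C = [])"
    using assms(1-3) by blast+
  then obtain xs ys zs where T: "theta_shape (parcs ?T) (pverts ?T) 0 1 xs ys zs" "ys \<noteq> []" "zs \<noteq> []"
    and mT: "mset [length zs, length ys, length xs] = mset [p, q, r]"
    by (rule theta_shape_nonempty_order[OF T.sym_arcs T.irrefl_arcs zero_neq_one theta_shape_theta, unfolded lens])
      (rule that; assumption)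
  have T01: "0 \<in> pverts ?T" "1 \<in> pverts ?T" by (simp_all add: theta_def)
  have degT: "T.deg x = (if x = 0 \<or> x = 1 then 3 else 2)" if "x \<in> pverts ?T" for x
  proof (cases "x = 0 \<or> x = 1")
    case True
    then show ?thesis using theta_shape_degrees(2,3)[OF T] by auto
  next
    case False
    then show ?thesis using theta_shape_degrees(1)[OF T, of x] that by simp
  qed
  have card_T: "card (pverts ?T) = p + q + r + 2" by (simp add: theta_def)
  have card_H: "card (pverts H) = card (pverts ?T)"
    unfolding H.length_vs[symmetric] T.length_vs[symmetric] H.poly_coeffs(1)[symmetric]
      T.poly_coeffs(1)[symmetric] assms(7) ..
  \<comment> \<open>In this form \<open>Suc (p + q + r)\<close> and \<open>p + q + r\<close> are the
    indices of the two coefficients below the leading one.\<close>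
  have len: "Suc (Suc (p + q + r)) = length vs" "Suc (Suc (p + q + r)) = length ws"
    using H.length_vs T.length_vs card_H card_T by simp_all
  have s1: "(\<Sum>x\<in>pverts H. int (H.deg x)) = (\<Sum>x\<in>pverts ?T. int (T.deg x))"
    using H.poly_coeffs(2)[OF len(1)] T.poly_coeffs(2)[OF len(2)] assms(7) by simp
  have s2: "(\<Sum>x\<in>pverts H. (int (H.deg x))\<^sup>2) = (\<Sum>x\<in>pverts ?T. (int (T.deg x))\<^sup>2)"
    using H.poly_coeffs(3)[OF len(1)] T.poly_coeffs(3)[OF len(2)] assms(7) s1 by simp
  have "(\<Sum>x\<in>pverts H. int (H.deg x)) = 2 * int (card (pverts H)) + 2"
    unfolding s1 card_H by (rule T.sums_of_degrees(1)[OF zero_neq_one T01 degT])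
  moreover have "(\<Sum>x\<in>pverts H. (int (H.deg x))\<^sup>2) = 4 * int (card (pverts H)) + 10"
    unfolding s2 card_H by (rule T.sums_of_degrees(2)[OF zero_neq_one T01 degT])
  ultimately obtain u v where uv: "u \<noteq> v" "u \<in> pverts H" "v \<in> pverts H"
    and degH: "\<And>x. x \<in> pverts H \<Longrightarrow> H.deg x = (if x = u \<or> x = v then 3 else 2)"
    by (rule H.degrees_of_sums) (rule that; assumption)
  have eq: "perm_on (graph_weight (parcs ?T) (theta_diag 0 1 y)) (pverts ?T) (pverts ?T) =
    perm_on (graph_weight (parcs H) (theta_diag u v y)) (pverts H) (pverts H)" for y
    using H.poly_eval_theta_diag[OF degH, of y] T.poly_eval_theta_diag[OF degT, of y] assms(7) by simp
  note permT = theta_shape_perm[OF T.sym_arcs T.irrefl_arcs T]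
  have lenT: "length zs + length ys + length xs = p + q + r"
    using mset3_cases[OF mT] by auto
  have br: "branching (parcs H) u v (pverts H) (if (u, v) \<in> parcs H then 2 else 3)
      (if (u, v) \<in> parcs H then 2 else 3)"
    by (rule H.branching_of_degrees[OF degH uv(2,3)])
  show ?thesis
  proof (rule branching_classification[OF H.sym_arcs H.irrefl_arcs uv(1) br refl])
    fix cs xs' ys' zs'
    assume cs: "\<And>k. k \<in> set cs \<Longrightarrow> 3 \<le> k" and ne: "ys' \<noteq> []" "zs' \<noteq> []"
      and card: "card (pverts H) + 1 = Suc (length zs') + Suc (length ys') + Suc (length xs') + sum_list cs"
      and perm: "\<And>y. perm_on (graph_weight (parcs H) (theta_diag u v y)) (pverts H) (pverts H) =
        theta_perm y (Suc (length zs')) (Suc (length ys')) (Suc (length xs')) (\<Prod>c\<leftarrow>cs. cycle_perm y c)"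
      and shape: "cs = [] \<Longrightarrow> theta_shape (parcs H) (pverts H) u v xs' ys' zs'"
    have cs': "\<forall>k\<in>set cs. 3 \<le> k" using cs by blast
    have eq': "theta_perm y (Suc (length zs)) (Suc (length ys)) (Suc (length xs)) 1 =
      theta_perm y (Suc (length zs')) (Suc (length ys')) (Suc (length xs')) (\<Prod>c\<leftarrow>cs. cycle_perm y c)" for y
      using eq[of y] unfolding permT perm .
    have s: "Suc (length zs) + Suc (length ys) + Suc (length xs) =
      Suc (length zs') + Suc (length ys') + Suc (length xs') + sum_list cs"
      using card card_H card_T lenT by simp
    have pos: "2 \<le> Suc (length zs)" "2 \<le> Suc (length ys)" "1 \<le> Suc (length xs)"
      "2 \<le> Suc (length zs')" "2 \<le> Suc (length ys')" "1 \<le> Suc (length xs')"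
      using T(2,3) ne by (simp_all add: Suc_le_eq)
    have "cs = []" by (rule theta_perm_eq_theta_perm(1)[OF eq' cs' s pos])
    then have shape': "theta_shape (parcs H) (pverts H) u v xs' ys' zs'" by (rule shape)
    have "mset [Suc (length zs), Suc (length ys), Suc (length xs)] =
      mset [Suc (length zs'), Suc (length ys'), Suc (length xs')]"
      by (rule theta_perm_eq_theta_perm(2)[OF eq' cs' s pos])
    \<comment> \<open>The polynomials speak about numbers of edges; subtracting 1 returns to numbers
      of interior vertices.\<close>
    from arg_cong[OF this, of "image_mset (\<lambda>k. k - 1)"]
    have "mset [length zs', length ys', length xs'] = mset [length zs, length ys, length xs]"
      by (simp only: mset.simps image_mset_add_mset image_mset_empty diff_Suc_1)
    then have m: "mset [length zs', length ys', length xs'] = mset [p, q, r]" using mT by simp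
    obtain as bs ds where "theta_shape (parcs H) (pverts H) u v as bs ds"
      "length as = p" "length bs = q" "length ds = r"
      by (rule theta_shape_reorder[OF H.sym_arcs H.irrefl_arcs uv(1) shape' m])
    then show ?thesis by (rule theta_shape_iso[OF assms(4)])
  next
    fix cs l g h
    assume cs: "\<And>k. k \<in> set cs \<Longrightarrow> 3 \<le> k" and pos: "1 \<le> l" "3 \<le> g" "3 \<le> h"
      and card: "card (pverts H) + 1 = l + g + h + sum_list cs"
      and perm: "\<And>y. perm_on (graph_weight (parcs H) (theta_diag u v y)) (pverts H) (pverts H) =
        dumbbell_perm y l g h (\<Prod>c\<leftarrow>cs. cycle_perm y c)"
    have cs': "\<forall>k\<in>set cs. 3 \<le> k" using cs by blast
    have eq': "theta_perm y (Suc (length zs)) (Suc (length ys)) (Suc (length xs)) 1 =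
      dumbbell_perm y l g h (\<Prod>c\<leftarrow>cs. cycle_perm y c)" for y
      using eq[of y] unfolding permT perm .
    have s: "Suc (length zs) + Suc (length ys) + Suc (length xs) = l + g + h + sum_list cs"
      using card card_H card_T lenT by simp
    have posT: "2 \<le> Suc (length zs)" "2 \<le> Suc (length ys)" "1 \<le> Suc (length xs)"
      using T(2,3) by (simp_all add: Suc_le_eq)
    have False by (rule theta_perm_neq_dumbbell_perm[OF eq' cs' s posT pos])
    then show ?thesis ..
  qed
qed

end
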